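(* Let $X=(X_n)_{n\in\mathbb{N}}$ be the Harris chain and let $X_\infty$ be its almost sure Doob-Martin limit. Let $$Y_\infty:=\sum_{u\in\mathbb{V}}X_\infty(A_u)\,C\bigl(\rho(X_\infty,u)\bigr),\qquad Z_\infty:=\sum_{u\in\mathbb{V}}X_\infty(A_u)\,D\bigl(\rho(X_\infty,u)\bigr).$$ Then, as $n\to\infty$, $$\frac1n\,\mathrm{HPL}(X_n)-H_n+2\;\to\;Y_\infty+Z_\infty,$$ almost surely and in $L^p$ for every $p>0$.
   Context: $\mathbb{N}=\{1,2,\ldots\}$ and $\mathbb{V}=\mathbb{N}^\star$ is the set of finite sequences of natural numbers (including the empty sequence $\emptyset$); $u+v$ denotes concatenation and $ui:=u+(i)$. For $u=(u_1,\ldots,u_l)\in\mathbb{V}$, $|u|:=l$ and $|u|_1:=\sum_{i=1}^l u_i$. A Harris tree is a finite nonempty set $x\subset\mathbb{V}$ such that (i) $u+v\in x$ implies $u\in x$, and (ii) $ui\in x$ with $i>1$ implies $uj\in x$ for $1\le j\le i-1$. $\mathbb{H}_n$ is the set of Harris trees with $n$ nodes. For a Harris tree $x$, $x(u):=\{v\in\mathbb{V}:u+v\in x\}$. The Harris chain $X=(X_n)_{n\in\mathbb{N}}$ is the Markov chain with $X_1=\{\emptyset\}$ and, for $x_n\in\mathbb{H}_n$, $x_{n+1}\in\mathbb{H}_{n+1}$, $P(X_{n+1}=x_{n+1}\mid X_n=x_n)=1/n$ if $x_n\subset x_{n+1}$ and $0$ otherwise. (It is the image of the chain of random recursive trees,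 where each new node chooses its ancestor uniformly at random.) The horizontal total path length of a Harris tree $x$ is $\mathrm{HPL}(x):=\sum_{u\in x}\bigl(|u|_1-|u|\bigr)$. $H_n:=\sum_{k=1}^n\frac1k$. $\bar{\mathbb{V}}:=\mathbb{N}^\star\sqcup\mathbb{N}^\infty\sqcup\bigsqcup_{k=0}^\infty\mathbb{N}^k\times\{\infty\}^\infty$; $A_u:=\{v\in\bar{\mathbb{V}}: u\text{ is a prefix of }v\}$ for $u\in\mathbb{V}$; $\mathcal{V}$ is the $\sigma$-field generated by the sets $A_u$, $u\in\mathbb{V}$. $X_\infty$ is the random probability measure on $(\bar{\mathbb{V}},\mathcal{V})$ with, almost surely, $X_\infty(A_u)=\lim_{n\to\infty}\frac1n\#X_n(u)$ for all $u\in\mathbb{V}$ (it is known that this limit exists almost surely). $\Sigma_\infty$ is the set of sequences $(s_i)_{i\in\mathbb{N}}$ with $s_i\ge0$ and $\sum_{i=1}^\infty s_i=1$. For $u\in\mathbb{V}$, $\rho(X_\infty,u)=(\rho_i(X_\infty,u))_{i\in\mathbb{N}}$ with $\rho_i(X_\infty,u):=X_\infty(A_{ui})/X_\infty(A_u)$, which is almost surely a well-defined element of $\Sigma_\infty$. The functions $C:\Sigma_\infty\to[-\infty,1]$ and $D:\Sigma_\infty\to[-2,\infty]$ are $C\bigl((s_i)_{i\in\mathbb{N}}\bigr):=1+\sum_{i=1}^\infty s_i\log s_i$ (with $0\log0:=0$) and $D\bigl((s_i)_{i\in\mathbb{N}}\bigr):=-2+\sum_{i=1}^\infty i\,s_i$.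 The infinite sums defining $Y_\infty$ and $Z_\infty$ are understood as limits, in $L^p$ for all $p>1$, of the partial sums over $\{u\in\mathbb{V}:|u|_1\le k\}$ as $k\to\infty$ (these limits exist). *)

theory Defs
  imports "HOL-Probability.Probability" "HOL-Library.Sublist"
begin

section \<open>Harris trees\<close>

text \<open>Here the natural numbers start at 1, so nodes are lists without the entry 0.
  For a node \<open>u\<close>, the numbers $|u|$ and $|u|_1$ are \<open>length u\<close> and \<open>sum_list u\<close>.\<close>

definition nodes :: "nat list set" where
  "nodes = {u. 0 \<notin> set u}"

definition harris_tree :: "nat list set \<Rightarrow> bool" where
  "harris_tree x \<longleftrightarrow>
     finite x \<and> x \<noteq> {} \<and> x \<subseteq> nodes \<and>
     (\<forall>u v. u @ v \<in> x \<longrightarrow> u \<in> x) \<and>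
     (\<forall>u i. u @ [i] \<in> x \<longrightarrow> i > 1 \<longrightarrow> (\<forall>j. 1 \<le> j \<and> j \<le> i - 1 \<longrightarrow> u @ [j] \<in> x))"

definition harris_trees :: "nat \<Rightarrow> nat list set set" where
  "harris_trees n = {x. harris_tree x \<and> card x = n}"

definition subtree :: "nat list set \<Rightarrow> nat list \<Rightarrow> nat list set" where
  "subtree x u = {v \<in> nodes. u @ v \<in> x}"

definition HPL :: "nat list set \<Rightarrow> real" where
  "HPL x = (\<Sum>u\<in>x. real (sum_list u) - real (length u))"

lemma countable_harris_tree: "countable {x. harris_tree x}"
  by (rule countable_subset[OF _ countable_Collect_finite]) (auto simp: harris_tree_def)


section \<open>The Harris chain\<close>

text \<open>Time starts at 1; the value of a process at time 0 is irrelevant.\<close>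

definition markov_chain :: "'a measure \<Rightarrow> 's set \<Rightarrow> (nat \<Rightarrow> 'a \<Rightarrow> 's) \<Rightarrow> bool" where
  "markov_chain M S X \<longleftrightarrow>
     countable S \<and> (\<forall>n\<ge>1. X n \<in> measurable M (count_space S)) \<and>
     (\<forall>n\<ge>1. \<forall>x y. y \<in> S \<longrightarrow>
        measure M {\<omega> \<in> space M. \<forall>k\<in>{1..n}. X k \<omega> = x k} > 0 \<longrightarrow>
        cond_prob M (\<lambda>\<omega>. X (Suc n) \<omega> = y) (\<lambda>\<omega>. \<forall>k\<in>{1..n}. X k \<omega> = x k)
          = cond_prob M (\<lambda>\<omega>. X (Suc n) \<omega> = y) (\<lambda>\<omega>. X n \<omega> = x n))"

definition harris_chain :: "'a measure \<Rightarrow> (nat \<Rightarrow> 'a \<Rightarrow> nat list set) \<Rightarrow> bool" where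
  "harris_chain M X \<longleftrightarrow>
     markov_chain M {x. harris_tree x} X \<and>
     (AE \<omega> in M. X 1 \<omega> = {[]}) \<and>
     (\<forall>n\<ge>1. \<forall>x\<in>harris_trees n. \<forall>y\<in>harris_trees (Suc n).
        measure M {\<omega> \<in> space M. X n \<omega> = x} > 0 \<longrightarrow>
        cond_prob M (\<lambda>\<omega>. X (Suc n) \<omega> = y) (\<lambda>\<omega>. X n \<omega> = x)
          = (if x \<subseteq> y then 1 / real n else 0))"


section \<open>The compactified node space and the limit measure\<close>

text \<open>Finite sequences are injected by \<^const>\<open>Inl\<close>. Infinite sequences are functions into
  \<^typ>\<open>enat\<close>, injected by \<^const>\<open>Inr\<close>; either all their entries are finite, or
  exactly the first \<open>k\<close> are, for some \<open>k\<close>.\<close>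

type_synonym ext_node = "nat list + (nat \<Rightarrow> enat)"

definition ext_nodes :: "ext_node set" where
  "ext_nodes =
     Inl ` nodes \<union>
     Inr ` {s. \<forall>i. s i \<noteq> 0 \<and> s i \<noteq> \<infinity>} \<union>
     (\<Union>k. Inr ` {s. (\<forall>i<k. s i \<noteq> 0 \<and> s i \<noteq> \<infinity>) \<and> (\<forall>i\<ge>k. s i = \<infinity>)})"

fun prefix_ext :: "nat list \<Rightarrow> ext_node \<Rightarrow> bool" where
  "prefix_ext u (Inl v) \<longleftrightarrow> prefix u v"
| "prefix_ext u (Inr s) \<longleftrightarrow> (\<forall>i<length u. s i = enat (u ! i))"

definition cyl :: "nat list \<Rightarrow> ext_node set" where
  "cyl u = {v \<in> ext_nodes. prefix_ext u v}"

definition ext_node_algebra :: "ext_node measure" where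
  "ext_node_algebra = sigma ext_nodes (cyl ` nodes)"

definition harris_limit ::
    "'a measure \<Rightarrow> (nat \<Rightarrow> 'a \<Rightarrow> nat list set) \<Rightarrow> ('a \<Rightarrow> ext_node measure) \<Rightarrow> bool" where
  "harris_limit M X Xinf \<longleftrightarrow>
     Xinf \<in> measurable M (prob_algebra ext_node_algebra) \<and>
     (AE \<omega> in M. \<forall>u\<in>nodes.
        (\<lambda>n. real (card (subtree (X n \<omega>) u)) / real n) \<longlonglongrightarrow> measure (Xinf \<omega>) (cyl u))"


section \<open>The functionals of the limit\<close>

text \<open>A sequence $(s_i)_{i \ge 1}$ is a function on \<^typ>\<open>nat\<close> whose value at 0 is ignored.
  For nonnegative sequences with sum 1 the terms of each series below have constant sign,
  so both series converge in \<^typ>\<open>ereal\<close>.\<close>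

definition C_fun :: "(nat \<Rightarrow> real) \<Rightarrow> ereal" where
  "C_fun s = 1 + (\<Sum>i. ereal (s (Suc i) * ln (s (Suc i))))"

definition D_fun :: "(nat \<Rightarrow> real) \<Rightarrow> ereal" where
  "D_fun s = - 2 + (\<Sum>i. ereal (real (Suc i) * s (Suc i)))"

definition rho :: "ext_node measure \<Rightarrow> nat list \<Rightarrow> nat \<Rightarrow> real" where
  "rho \<mu> u i = measure \<mu> (cyl (u @ [i])) / measure \<mu> (cyl u)"

definition partial_sum ::
    "((nat \<Rightarrow> real) \<Rightarrow> ereal) \<Rightarrow> ext_node measure \<Rightarrow> nat \<Rightarrow> ereal" where
  "partial_sum F \<mu> k =
     (\<Sum>u | u \<in> nodes \<and> sum_list u \<le> k. ereal (measure \<mu> (cyl u)) * F (rho \<mu> u))"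

lemma finite_partial_sum_index: "finite {u. u \<in> nodes \<and> sum_list u \<le> k}"
proof (rule finite_subset)
  show "{u. u \<in> nodes \<and> sum_list u \<le> k} \<subseteq> {u. set u \<subseteq> {..k} \<and> length u \<le> k}"
  proof safe
    fix u :: "nat list" and i
    assume "sum_list u \<le> k" "i \<in> set u"
    then show "i \<le> k" using member_le_sum_list[of i u] by simp
  next
    fix u :: "nat list"
    assume "u \<in> nodes" "sum_list u \<le> k"
    moreover have "0 \<notin> set u \<Longrightarrow> length u \<le> sum_list u" by (induction u) auto
    ultimately show "length u \<le> k" by (simp add: nodes_def)
  qed
  show "finite {u :: nat list. set u \<subseteq> {..k} \<and> length u \<le> k}"
    by (rule finite_lists_length_le) simp
qed


section \<open>Convergence in $L^p$\<close>

text \<open>Elements of $L^p$ may be extended-real valued but are almost surely finite, so that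
  \<^const>\<open>real_of_ereal\<close> only changes them on a null set.\<close>

definition in_Lp :: "'a measure \<Rightarrow> real \<Rightarrow> ('a \<Rightarrow> ereal) \<Rightarrow> bool" where
  "in_Lp M p f \<longleftrightarrow>
     f \<in> borel_measurable M \<and> (AE \<omega> in M. \<bar>f \<omega>\<bar> \<noteq> \<infinity>) \<and>
     integrable M (\<lambda>\<omega>. \<bar>real_of_ereal (f \<omega>)\<bar> powr p)"

definition tendsto_Lp ::
    "'a measure \<Rightarrow> real \<Rightarrow> (nat \<Rightarrow> 'a \<Rightarrow> ereal) \<Rightarrow> ('a \<Rightarrow> ereal) \<Rightarrow> bool" where
  "tendsto_Lp M p f g \<longleftrightarrow>
     (\<forall>n\<ge>1. in_Lp M p (f n)) \<and> in_Lp M p g \<and>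
     (\<lambda>n. \<integral>\<omega>. \<bar>real_of_ereal (f n \<omega> - g \<omega>)\<bar> powr p \<partial>M) \<longlonglongrightarrow> 0"

end

theory Submission
  imports Defs "HOL-Real_Asymp.Real_Asymp"
begin

text \<open>Let \<open>g(x) = HPL x - mean_HPL (card x)\<close>, where \<open>mean_HPL n = n * H\<^sub>n - 2 * n + 1\<close> is the mean of
the horizontal path length of a tree with \<open>n\<close> nodes. A new child of \<open>p\<close> adds \<open>next_depth x p\<close> to
the path length, and summing this over \<open>p\<close> shows that the increments of \<open>g\<close> at the \<open>n\<close> possible
places of growth add up to \<open>g(x)\<close> (\<open>centered_HPL_drift\<close>). Hence \<open>g(X\<^sub>n) / n\<close>, which is the
normalized path length of the theorem minus \<open>1 / n\<close>, is a martingale.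

The same is true of each subtree, and therefore of the sum \<open>frontier_HPL k\<close> of \<open>g\<close> over the
subtrees rooted at the frontier of level \<open>k\<close>, the first nodes on each branch with $|w|_1 \ge k$.
Level 0 gives back \<open>g\<close> itself. Three facts about these martingales carry the proof.

\<^item> The increment of \<open>frontier_HPL k\<close> at \<open>p\<close> is at most \<open>next_depth x p + H\<^sub>n\<close>, uniformly in \<open>k\<close>,
  and the mean of \<open>2 ^ next_depth\<close> over the nodes has expectation \<open>(n + 1) / 2\<close>. So every moment
  of the increments is controlled, and the martingales are Cauchy in every \<open>L\<^sup>p\<close> at a polynomial
  rate which does not depend on \<open>k\<close> (\<open>martingale_moment\<close>).

\<^item> A tree with at most \<open>k\<close> nodes has no node on the frontier of level \<open>k\<close>, so that martingale
  starts from 0 at time \<open>k\<close>. By the uniform rate it stays small for ever if \<open>k\<close> is large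
  (\<open>martingale_tail_L1\<close>).

\<^item> The difference \<open>frontier_HPL 0 - frontier_HPL (k + 1)\<close> telescopes into a sum of tolls over the
  nodes \<open>u\<close> with $|u|_1 \le k$ and their children (\<open>frontier_HPL_toll\<close>). A toll depends only on
  the sizes of the subtrees at \<open>u\<close> and at the child, so it converges almost surely, by
  \<open>H\<^sub>n - ln n \<longlonglongrightarrow> \<gamma>\<close>. The sum of the limits over the children of \<open>u\<close> is
  $X_\infty(A_u)\,(C + D)(\rho(X_\infty, u))$ (\<open>AE_partial_sum\<close>).

The third fact needs a domination in the number \<open>i\<close> of the child, because a node has infinitely
many children in the limit. It comes from a symmetry: the subtree at a child and the subtrees at
all its later siblings together compete like the two colours of a Polya urn, so the expected
number of nodes beyond the \<open>i\<close>-th child is at most \<open>n / 2 ^ i\<close> (\<open>expectation_later\<close>). The same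
bound shows that $X_\infty$ has no mass at infinity below \<open>u\<close>, that is $\sum_i \rho_i = 1$.

Together, the martingale of level 0 converges in \<open>L\<^sup>1\<close> to the limit of the partial sums, which
is $Y_\infty + Z_\infty$. Its polynomial rate in \<open>L\<^sup>8\<close> is summable, which makes the convergence
almost sure, and its rates in the other \<open>L\<^sup>p\<close> give convergence there.\<close>

section \<open>Growing Harris trees\<close>

definition nchild :: "nat list set \<Rightarrow> nat list \<Rightarrow> nat" where
  "nchild x u = card {i. u @ [i] \<in> x}"

definition new_node :: "nat list set \<Rightarrow> nat list \<Rightarrow> nat list" where
  "new_node x u = u @ [Suc (nchild x u)]"

abbreviation grow :: "nat list set \<Rightarrow> nat list \<Rightarrow> nat list set" where
  "grow x u \<equiv> insert (new_node x u) x"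

text \<open>The trees that the chain can reach, with the order of arrival as an induction principle. Almost
all combinatorial facts below follow by induction on this growth.\<close>

inductive grown :: "nat list set \<Rightarrow> bool" where
  root: "grown {[]}"
| step: "grown x \<Longrightarrow> p \<in> x \<Longrightarrow> grown (grow x p)"

lemma grown_finite: "grown x \<Longrightarrow> finite x"
  by (induction rule: grown.induct) auto

lemma grown_root: "grown x \<Longrightarrow> [] \<in> x"
  by (induction rule: grown.induct) auto

lemma grown_card_pos: "grown x \<Longrightarrow> card x \<ge> 1"
  using grown_finite grown_root by (metis One_nat_def Suc_leI card_gt_0_iff empty_iff)

lemma grown_child_iff:
  assumes "grown x"
  shows "u @ [i] \<in> x \<longleftrightarrow> u \<in> x \<and> 1 \<le> i \<and> i \<le> nchild x u"
  using assms
proof (induction arbitrary: u i rule: grown.induct)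
  case root
  have "{i. u @ [i] \<in> {[]}} = {}" by auto
  then show ?case by (auto simp: nchild_def)
next
  case (step x p)
  have q: "u @ [i] = new_node x p \<longleftrightarrow> u = p \<and> i = Suc (nchild x p)" for u i
    by (auto simp: new_node_def)
  have nchild: "nchild (grow x p) u = (if u \<in> x then nchild x u + (if u = p then 1 else 0) else 0)" for u
  proof -
    have "{j. u @ [j] \<in> grow x p} =
        {j. u \<in> x \<and> 1 \<le> j \<and> j \<le> nchild x u \<or> u = p \<and> j = Suc (nchild x p)}"
      using step.IH[of u] q[of u] by auto
    also have "\<dots> = (if u \<in> x then {1..nchild x u + (if u = p then 1 else 0)} else {})"
      using step.hyps(2) by auto
    finally show ?thesis by (simp add: nchild_def)
  qed
  show ?case
  proof (cases "u \<in> x")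
    case True
    then show ?thesis using step.IH[of u i] q[of u i] nchild[of u] by auto
  next
    case False
    then show ?thesis using step.IH[of u i] q[of u i] step.hyps(2) nchild[of u] by auto
  qed
qed

lemma new_node_notin: "grown x \<Longrightarrow> new_node x p \<notin> x"
  using grown_child_iff[of x p "Suc (nchild x p)"] by (simp add: new_node_def)

lemma new_node_neq: "new_node x p \<noteq> p"
  by (simp add: new_node_def)

lemma card_grow: "grown x \<Longrightarrow> card (grow x p) = Suc (card x)"
  using new_node_notin grown_finite by simp

lemma inj_new_node: "inj (new_node x)"
  by (auto simp: new_node_def inj_on_def)

lemma inj_on_grow: "grown x \<Longrightarrow> inj_on (grow x) x"
  by (rule inj_onI) (metis insert_iff inj_new_node injD new_node_notin)

lemma nchild_grow:
  assumes "grown x" "p \<in> x"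
  shows "nchild (grow x p) u = nchild x u + (if u = p then 1 else 0)"
proof -
  have eq: "{j. u @ [j] \<in> grow x p} = {j. u @ [j] \<in> x} \<union> (if u = p then {Suc (nchild x p)} else {})"
    by (auto simp: new_node_def)
  have "{j. u @ [j] \<in> x} \<subseteq> {1..nchild x u}"
    using grown_child_iff[OF assms(1), of u] by auto
  then have fin: "finite {j. u @ [j] \<in> x}" by (rule finite_subset) simp
  have notin: "Suc (nchild x p) \<notin> {j. p @ [j] \<in> x}"
    using grown_child_iff[OF assms(1), of p] by auto
  show ?thesis
  proof (cases "u = p")
    case True
    then have "{j. u @ [j] \<in> grow x p} = insert (Suc (nchild x p)) {j. u @ [j] \<in> x}"
      using eq by auto
    then show ?thesis using True fin notin by (simp add: nchild_def)
  next
    case False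
    then show ?thesis using eq by (simp add: nchild_def)
  qed
qed

lemma nchild_notin: "grown x \<Longrightarrow> u \<notin> x \<Longrightarrow> nchild x u = 0"
  using grown_child_iff[of x u] by (auto simp: nchild_def)

lemma grown_prefix: "grown x \<Longrightarrow> u @ v \<in> x \<Longrightarrow> u \<in> x"
proof (induction v rule: rev_induct)
  case (snoc i v)
  then show ?case using grown_child_iff[of x "u @ v" i] by simp
qed simp

lemma grown_nodes: "grown x \<Longrightarrow> x \<subseteq> nodes"
  by (induction rule: grown.induct) (auto simp: nodes_def new_node_def)

lemma grown_harris_tree:
  assumes "grown x" shows "harris_tree x"
  unfolding harris_tree_def
  using grown_finite[OF assms] grown_root[OF assms] grown_nodes[OF assms]
    grown_prefix[OF assms] grown_child_iff[OF assms]
  by (auto; force)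

definition grown_trees :: "nat \<Rightarrow> nat list set set" where
  "grown_trees n = {x. grown x \<and> card x = n}"

lemma grown_trees_subset_harris_trees: "grown_trees n \<subseteq> harris_trees n"
  by (auto simp: grown_trees_def harris_trees_def grown_harris_tree)

lemma grown_trees_one: "grown_trees 1 = {{[]}}"
proof -
  have "x = {[]}" if "grown x" "card x = 1" for x
  proof -
    obtain v where "x = {v}" using \<open>card x = 1\<close> by (rule card_1_singletonE)
    then show ?thesis using grown_root[OF \<open>grown x\<close>] by simp
  qed
  then have "x \<in> grown_trees 1 \<longleftrightarrow> x = {[]}" for x
    unfolding grown_trees_def mem_Collect_eq using grown.root by (metis is_singletonI is_singleton_altdef)
  then show ?thesis by blast
qed

lemma grow_in_grown_trees: "x \<in> grown_trees n \<Longrightarrow> p \<in> x \<Longrightarrow> grow x p \<in> grown_trees (Suc n)"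
  using card_grow grown.step by (auto simp: grown_trees_def)

lemma grown_trees_Suc: "n \<ge> 1 \<Longrightarrow> grown_trees (Suc n) = (\<Union>x\<in>grown_trees n. grow x ` x)"
proof
  assume n: "n \<ge> 1"
  show "grown_trees (Suc n) \<subseteq> (\<Union>x\<in>grown_trees n. grow x ` x)"
  proof
    fix y assume "y \<in> grown_trees (Suc n)"
    then have "grown y" "card y = Suc n" by (auto simp: grown_trees_def)
    then show "y \<in> (\<Union>x\<in>grown_trees n. grow x ` x)"
    proof (cases rule: grown.cases)
      case root
      with \<open>card y = Suc n\<close> n show ?thesis by simp
    next
      case (step x p)
      with \<open>card y = Suc n\<close> card_grow[of x p] show ?thesis by (auto simp: grown_trees_def)
    qed
  qed
qed (use grow_in_grown_trees in blast)

lemma finite_grown_trees: "finite (grown_trees n)"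
proof (cases "n \<ge> 1")
  case True
  then show ?thesis
  proof (induction n rule: dec_induct)
    case base
    show ?case using grown_trees_one by simp
  next
    case (step n)
    then have "finite x" if "x \<in> grown_trees n" for x
      using that grown_finite by (auto simp: grown_trees_def)
    then show ?case using step grown_trees_Suc[of n] by auto
  qed
next
  case False
  then have "grown_trees n = {}" using grown_card_pos by (fastforce simp: grown_trees_def)
  then show ?thesis by simp
qed

text \<open>On the way to the next child of \<open>u\<close>, every prefix and all earlier siblings of each prefix are in
the tree; these are as many nodes as the entries of that child add up to. The consequence is
that a small tree cannot reach a high level.\<close>

lemma grown_sum_list_less: "grown x \<Longrightarrow> u \<in> x \<Longrightarrow> sum_list u + nchild x u < card x"
proof (induction arbitrary: u rule: grown.induct)
  case root
  then show ?case by (simp add: nchild_def)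
next
  case (step x p)
  show ?case
  proof (cases "u \<in> x")
    case True
    then show ?thesis using step by (force simp: nchild_grow card_grow)
  next
    case False
    then have u: "u = new_node x p" using step.prems by simp
    then have "nchild (grow x p) u = 0"
      using step.hyps False nchild_grow nchild_notin by auto
    then show ?thesis
      using u card_grow[OF step.hyps(1), of p] step.IH[OF step.hyps(2)] by (simp add: new_node_def)
  qed
qed

lemma sum_nchild: "grown x \<Longrightarrow> (\<Sum>u\<in>x. nchild x u) = card x - 1"
proof (induction rule: grown.induct)
  case root
  then show ?case by (simp add: nchild_def)
next
  case (step x p)
  then have "(\<Sum>u\<in>grow x p. nchild (grow x p) u) = (\<Sum>u\<in>x. nchild x u + (if u = p then 1 else 0))"
    using nchild_grow nchild_notin new_node_notin new_node_neq grown_finite by auto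
  also have "\<dots> = (card x - 1) + 1"
    using step grown_finite by (simp add: sum.distrib)
  finally show ?case using step grown_card_pos[of x] card_grow[of x p] by simp
qed

lemma subtree_grown: "grown x \<Longrightarrow> subtree x u = {v. u @ v \<in> x}"
  using grown_nodes by (fastforce simp: subtree_def nodes_def)

lemma subtree_empty: "grown x \<Longrightarrow> u \<notin> x \<Longrightarrow> subtree x u = {}"
  using subtree_grown grown_prefix by fastforce

lemma subtree_Nil: "grown x \<Longrightarrow> subtree x [] = x"
  by (simp add: subtree_grown)

lemma nchild_subtree: "grown x \<Longrightarrow> nchild (subtree x u) v = nchild x (u @ v)"
  by (simp add: nchild_def subtree_grown)

text \<open>Seen from \<open>u\<close>, growth below \<open>u\<close> is growth of the subtree at \<open>u\<close>. This and the next two lemmas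
cover all places of growth, and make the Harris chain self-similar.\<close>

lemma subtree_grow_below:
  assumes "grown x" "u @ v \<in> x"
  shows "subtree (grow x (u @ v)) u = grow (subtree x u) v"
  using assms grown.step[OF assms]
  by (auto simp: subtree_grown new_node_def) (auto simp: nchild_def)

lemma subtree_grow_other:
  assumes "grown x" "p \<in> x" "\<not> prefix u p" "u \<noteq> new_node x p"
  shows "subtree (grow x p) u = subtree x u"
proof -
  have "u @ v \<noteq> new_node x p" for v
    using assms(3,4) by (cases v rule: rev_cases) (auto simp: new_node_def prefix_def)
  then show ?thesis using assms grown.step[OF assms(1,2)] by (auto simp: subtree_grown)
qed

lemma subtree_grow_new:
  assumes "grown x" "p \<in> x"
  shows "subtree (grow x p) (new_node x p) = {[]}"
proof -
  have "new_node x p @ v \<notin> x" for v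
    using new_node_notin[OF assms(1)] grown_prefix[OF assms(1)] by blast
  then show ?thesis using grown.step[OF assms] by (auto simp: subtree_grown)
qed

lemma grown_subtree: "grown x \<Longrightarrow> u \<in> x \<Longrightarrow> grown (subtree x u)"
proof (induction arbitrary: u rule: grown.induct)
  case root
  then show ?case using subtree_Nil grown.root by simp
next
  case (step x p)
  consider "u = new_node x p" | v where "p = u @ v" | "u \<noteq> new_node x p" "\<not> prefix u p"
    by (auto simp: prefix_def)
  then show ?case
  proof cases
    case 1
    then show ?thesis using subtree_grow_new step grown.root by simp
  next
    case (2 v)
    then have "u \<in> x" "v \<in> subtree x u"
      using step.hyps grown_prefix[of x u v] subtree_grown[of x u] by simp_all
    then have "grown (grow (subtree x u) v)" using step.IH by (intro grown.step)
    moreover have "subtree (grow x p) u = grow (subtree x u) v"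
      using 2 step.hyps subtree_grow_below[of x u v] by simp
    ultimately show ?thesis by simp
  next
    case 3
    then show ?thesis using step subtree_grow_other[of x p u] by auto
  qed
qed

lemma finite_subtree: "grown x \<Longrightarrow> finite (subtree x u)"
  using grown_subtree grown_finite subtree_empty by (metis finite.emptyI)

text \<open>A proper descendant of \<open>u\<close> is reached through exactly one child of \<open>u\<close>.\<close>

lemma sum_subtree_children:
  fixes f :: "nat list \<Rightarrow> real"
  assumes "grown x" "u \<in> x"
  shows "(\<Sum>v\<in>subtree x u. f v) =
    f [] + (\<Sum>i=1..nchild x u. \<Sum>v\<in>subtree x (u @ [i]). f (i # v))"
proof -
  have split: "subtree x u = insert [] (\<Union>i\<in>{1..nchild x u}. (#) i ` subtree x (u @ [i]))"
  proof (intro equalityI subsetI)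
    fix v assume v: "v \<in> subtree x u"
    show "v \<in> insert [] (\<Union>i\<in>{1..nchild x u}. (#) i ` subtree x (u @ [i]))"
    proof (cases v)
      case (Cons i w)
      then have "(u @ [i]) @ w \<in> x" using v assms by (simp add: subtree_grown)
      then have "u @ [i] \<in> x" using grown_prefix[OF assms(1)] by blast
      then show ?thesis
        using \<open>(u @ [i]) @ w \<in> x\<close> Cons grown_child_iff[OF assms(1)] assms(1)
        by (auto simp: subtree_grown)
    qed simp
  qed (use assms in \<open>auto simp: subtree_grown\<close>)
  have "(\<Sum>v\<in>(\<Union>i\<in>{1..nchild x u}. (#) i ` subtree x (u @ [i])). f v) =
      (\<Sum>i=1..nchild x u. \<Sum>v\<in>(#) i ` subtree x (u @ [i]). f v)"
    using finite_subtree[OF assms(1)] by (intro sum.UNION_disjoint) auto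
  also have "\<dots> = (\<Sum>i=1..nchild x u. \<Sum>v\<in>subtree x (u @ [i]). f (i # v))"
    by (intro sum.cong refl trans[OF sum.reindex]) (auto simp: inj_on_def)
  finally show ?thesis
    unfolding split using finite_subtree[OF assms(1)] by (subst sum.insert) auto
qed

definition below :: "nat list set \<Rightarrow> nat list \<Rightarrow> nat" where
  "below x u = card (subtree x u)"

lemma below_Nil: "grown x \<Longrightarrow> below x [] = card x"
  by (simp add: below_def subtree_Nil)

lemma below_pos_iff: "grown x \<Longrightarrow> below x u > 0 \<longleftrightarrow> u \<in> x"
  using finite_subtree[of x u] subtree_empty[of x u] grown_root[OF grown_subtree, of x u]
  by (auto simp: below_def card_gt_0_iff)

lemma below_children:
  assumes "grown x" "u \<in> x"
  shows "real (below x u) = 1 + (\<Sum>i=1..nchild x u. real (below x (u @ [i])))"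
  using sum_subtree_children[OF assms, of "\<lambda>_. 1"] by (simp add: below_def)

lemma below_le_card:
  assumes "grown x" shows "below x u \<le> card x"
proof -
  have "(@) u ` subtree x u \<subseteq> x" using assms by (auto simp: subtree_grown)
  then have "card ((@) u ` subtree x u) \<le> card x" using grown_finite[OF assms] card_mono by blast
  then show ?thesis by (subst (asm) card_image) (auto simp: below_def inj_on_def)
qed

section \<open>Horizontal path length\<close>

text \<open>Equal to $|u|_1 - |u|$ on nodes, but written as a sum over the entries so that it is additive on
all lists.\<close>

definition hdepth :: "nat list \<Rightarrow> nat" where
  "hdepth u = (\<Sum>i\<leftarrow>u. i - 1)"

lemma hdepth_simps [simp]: "hdepth [] = 0" "hdepth (i # u) = (i - 1) + hdepth u"
  "hdepth (u @ v) = hdepth u + hdepth v"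
  by (auto simp: hdepth_def)

lemma hdepth_eq: "u \<in> nodes \<Longrightarrow> real (hdepth u) = real (sum_list u) - real (length u)"
  by (induction u) (auto simp: nodes_def of_nat_diff)

lemma HPL_eq_hdepth: "grown x \<Longrightarrow> HPL x = (\<Sum>u\<in>x. real (hdepth u))"
  unfolding HPL_def using grown_nodes[of x] hdepth_eq by (intro sum.cong) (auto simp: subset_iff)

text \<open>The horizontal depth of the next child of \<open>u\<close>; the chain grows by picking one of these places.\<close>

definition next_depth :: "nat list set \<Rightarrow> nat list \<Rightarrow> nat" where
  "next_depth x u = hdepth u + nchild x u"

lemma hdepth_new_node: "hdepth (new_node x p) = next_depth x p"
  by (simp add: new_node_def next_depth_def)

lemma HPL_grow: "grown x \<Longrightarrow> p \<in> x \<Longrightarrow> HPL (grow x p) = HPL x + real (next_depth x p)"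
  using HPL_eq_hdepth[of x] HPL_eq_hdepth[of "grow x p"] grown.step[of x p] new_node_notin[of x p]
    hdepth_new_node grown_finite[of x] by simp

text \<open>A node below the \<open>i\<close>-th child of \<open>u\<close> is shifted by \<open>i - 1\<close> with respect to that child.\<close>

lemma HPL_subtree:
  assumes "grown x" "u \<in> x"
  shows "HPL (subtree x u) =
    (\<Sum>i=1..nchild x u. real (i - 1) * real (below x (u @ [i])) + HPL (subtree x (u @ [i])))"
proof -
  have "HPL (subtree x (u @ [i])) = (\<Sum>v\<in>subtree x (u @ [i]). real (hdepth v))"
    if "i \<in> {1..nchild x u}" for i
    using that assms grown_child_iff[OF assms(1), of u i] grown_subtree[of x "u @ [i]"] HPL_eq_hdepth by auto
  then show ?thesis
    using HPL_eq_hdepth[OF grown_subtree[OF assms]] sum_subtree_children[OF assms, of "\<lambda>v. real (hdepth v)"]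
    by (simp add: sum.distrib sum_subtractf below_def algebra_simps)
qed

text \<open>The expected path length: the solution of the recurrence
\<open>mean_HPL (n + 1) - mean_HPL n = H\<^sub>n - 1\<close> with value 0 at 1.\<close>

definition mean_HPL :: "nat \<Rightarrow> real" where
  "mean_HPL n = real n * harm n - 2 * real n + 1"

text \<open>Defined as 0 outside the tree, which agrees with its value when \<open>u\<close> enters the tree as a leaf;
so the birth of \<open>u\<close> is no exception in the drift computation.\<close>

definition centered_HPL :: "nat list set \<Rightarrow> nat list \<Rightarrow> real" where
  "centered_HPL x u = (if u \<in> x then HPL (subtree x u) - mean_HPL (below x u) else 0)"

lemma mean_HPL_Suc: "mean_HPL (Suc n) - mean_HPL n = harm n - 1"
  by (simp add: mean_HPL_def harm_Suc field_simps)

lemma centered_HPL_singleton: "grown x \<Longrightarrow> subtree x u = {[]} \<Longrightarrow> centered_HPL x u = 0"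
  by (simp add: centered_HPL_def HPL_def below_def mean_HPL_def harm_expand)

lemma centered_HPL_grow_below:
  assumes "grown x" "u @ v \<in> x"
  shows "centered_HPL (grow x (u @ v)) u - centered_HPL x u = real (next_depth (subtree x u) v) - (harm (below x u) - 1)"
proof -
  have u: "u \<in> x" and v: "v \<in> subtree x u" and g: "grown (subtree x u)"
    using assms grown_prefix grown_subtree by (auto simp: subtree_grown)
  show ?thesis
    using u card_grow[OF g, of v] HPL_grow[OF g v] mean_HPL_Suc[of "below x u"]
    by (simp add: centered_HPL_def below_def subtree_grow_below[OF assms])
qed

lemma centered_HPL_grow_other:
  assumes "grown x" "p \<in> x" "\<not> prefix u p"
  shows "centered_HPL (grow x p) u - centered_HPL x u = 0"
proof (cases "u = new_node x p")
  case True
  then show ?thesis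
    using centered_HPL_singleton[OF grown.step[OF assms(1,2)] subtree_grow_new[OF assms(1,2)]]
      new_node_notin[OF assms(1)] by (simp add: centered_HPL_def)
next
  case False
  then show ?thesis using subtree_grow_other[OF assms] by (simp add: centered_HPL_def below_def)
qed

text \<open>The horizontal depths of the nodes and the numbers of their children are summed separately; each
node except the root is a child once.\<close>

lemma sum_next_depth: "grown x \<Longrightarrow> (\<Sum>u\<in>x. real (next_depth x u)) = HPL x + real (card x) - 1"
proof -
  assume g: "grown x"
  have "(\<Sum>u\<in>x. real (nchild x u)) = real (card x) - 1"
    using sum_nchild[OF g] grown_card_pos[OF g] by (simp flip: of_nat_sum add: of_nat_diff)
  then show ?thesis using HPL_eq_hdepth[OF g] by (simp add: next_depth_def sum.distrib)
qed

lemma sum_prefix: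
  fixes f :: "nat list \<Rightarrow> real"
  assumes "grown x" "\<And>p. p \<in> x \<Longrightarrow> \<not> prefix u p \<Longrightarrow> f p = 0"
  shows "(\<Sum>p\<in>x. f p) = (\<Sum>v\<in>subtree x u. f (u @ v))"
proof -
  have "(\<Sum>v\<in>subtree x u. f (u @ v)) = (\<Sum>p\<in>(@) u ` subtree x u. f p)"
    by (subst sum.reindex) (auto simp: inj_on_def)
  also have "\<dots> = (\<Sum>p\<in>x. f p)"
    using assms grown_finite[OF assms(1)]
    by (intro sum.mono_neutral_left) (auto simp: subtree_grown prefix_def)
  finally show ?thesis by simp
qed

text \<open>Only places of growth below \<open>u\<close> contribute, and there the sum is that of
\<open>next_depth - (H\<^sub>m - 1)\<close> over a tree with \<open>m\<close> nodes. The centering is chosen so that the result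
is again the centered path length: after division by the number of nodes it is a martingale.\<close>

lemma centered_HPL_drift:
  assumes "grown x"
  shows "(\<Sum>p\<in>x. centered_HPL (grow x p) u - centered_HPL x u) = centered_HPL x u"
proof (cases "u \<in> x")
  case True
  note g = grown_subtree[OF assms True]
  have "(\<Sum>p\<in>x. centered_HPL (grow x p) u - centered_HPL x u) =
      (\<Sum>v\<in>subtree x u. centered_HPL (grow x (u @ v)) u - centered_HPL x u)"
    using assms centered_HPL_grow_other by (intro sum_prefix) auto
  also have "\<dots> = (\<Sum>v\<in>subtree x u. real (next_depth (subtree x u) v) - (harm (below x u) - 1))"
    using assms centered_HPL_grow_below by (intro sum.cong refl) (auto simp: subtree_grown)
  also have "\<dots> = centered_HPL x u"
    using sum_next_depth[OF g] True
    by (simp add: sum.distrib sum_subtractf centered_HPL_def mean_HPL_def below_def algebra_simps)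
  finally show ?thesis .
next
  case False
  then have "\<not> prefix u p" if "p \<in> x" for p
    using that grown_prefix[OF assms] by (auto simp: prefix_def)
  then show ?thesis
    using assms False centered_HPL_grow_other[OF assms] by (simp add: centered_HPL_def[of x])
qed

section \<open>The path length below a frontier\<close>

text \<open>The nodes at which level \<open>k\<close> is crossed. The frontier of level 0 consists of the root alone.\<close>

definition frontier :: "nat \<Rightarrow> nat list set" where
  "frontier k = {w. k \<le> sum_list w \<and> (w = [] \<or> sum_list (butlast w) < k)}"

definition frontier_HPL :: "nat \<Rightarrow> nat list set \<Rightarrow> real" where
  "frontier_HPL k x = (\<Sum>w\<in>frontier k \<inter> x. centered_HPL x w)"

text \<open>The frontier is an antichain: a proper prefix of \<open>w'\<close> is a prefix of its parent, which is still
below level \<open>k\<close>.\<close>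

lemma frontier_unique:
  assumes "w \<in> frontier k" "w' \<in> frontier k" "prefix w p" "prefix w' p"
  shows "w = w'"
proof -
  have False if "strict_prefix w w'" "w \<in> frontier k" "w' \<in> frontier k" for w w'
  proof -
    have "w' \<noteq> []" using that by auto
    moreover have "prefix w (butlast w')"
      using that by (metis \<open>w' \<noteq> []\<close> append_butlast_last_id prefix_order.less_le prefix_snoc)
    then have "sum_list w \<le> sum_list (butlast w')" by (auto simp: prefix_def)
    ultimately show False using that(2,3) by (auto simp: frontier_def)
  qed
  then show ?thesis
    using assms by (metis prefix_same_cases prefix_order.le_less)
qed

lemma frontier_HPL_eq: "finite W \<Longrightarrow> x \<subseteq> W \<Longrightarrow> frontier_HPL k x = (\<Sum>w\<in>frontier k \<inter> W. centered_HPL x w)"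
  unfolding frontier_HPL_def by (intro sum.mono_neutral_left) (auto simp: centered_HPL_def)

lemma frontier_HPL_0: "grown x \<Longrightarrow> frontier_HPL 0 x = HPL x - mean_HPL (card x)"
proof -
  assume g: "grown x"
  have "frontier 0 \<inter> x = {[]}" using grown_root[OF g] by (auto simp: frontier_def)
  then show ?thesis using g grown_root[OF g] by (simp add: frontier_HPL_def centered_HPL_def subtree_Nil below_Nil)
qed

lemma frontier_HPL_small: "grown x \<Longrightarrow> card x \<le> k \<Longrightarrow> frontier_HPL k x = 0"
  unfolding frontier_HPL_def
  by (rule sum.neutral) (use grown_sum_list_less in \<open>fastforce simp: frontier_def\<close>)

text \<open>The drift of a single subtree is linear in its functional, so it can be summed over the
frontier. The sums run over one finite set containing all the grown trees, because the frontier
nodes of the tree change when it grows.\<close>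

lemma frontier_HPL_drift:
  assumes "grown x"
  shows "(\<Sum>p\<in>x. frontier_HPL k (grow x p) - frontier_HPL k x) = frontier_HPL k x"
proof -
  define W where "W = (\<Union>p\<in>x. grow x p)"
  have W: "finite W" "x \<subseteq> W" "\<And>p. p \<in> x \<Longrightarrow> grow x p \<subseteq> W"
    using grown_finite[OF assms] grown_root[OF assms] by (auto simp: W_def)
  have "(\<Sum>p\<in>x. frontier_HPL k (grow x p) - frontier_HPL k x) = (\<Sum>p\<in>x. \<Sum>w\<in>frontier k \<inter> W. centered_HPL (grow x p) w - centered_HPL x w)"
    using W by (intro sum.cong refl) (simp add: frontier_HPL_eq[of W] sum_subtractf)
  also have "\<dots> = (\<Sum>w\<in>frontier k \<inter> W. \<Sum>p\<in>x. centered_HPL (grow x p) w - centered_HPL x w)"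
    by (rule sum.swap)
  also have "\<dots> = frontier_HPL k x"
    using centered_HPL_drift[OF assms] W by (simp add: frontier_HPL_eq[of W])
  finally show ?thesis .
qed

lemma next_depth_subtree_le: "grown x \<Longrightarrow> next_depth (subtree x u) v \<le> next_depth x (u @ v)"
  by (simp add: next_depth_def nchild_subtree)

lemma harm_ge_1: "n \<ge> 1 \<Longrightarrow> harm n \<ge> (1::real)"
  using harm_mono[of 1 n] by (simp add: harm_expand)

text \<open>Growth at \<open>p\<close> changes at most one term, that of the frontier node above \<open>p\<close>. The bound does not
depend on \<open>k\<close>, since the horizontal depth within a subtree is smaller than in the whole tree.\<close>

lemma frontier_HPL_increment:
  assumes "grown x" "p \<in> x"
  shows "\<bar>frontier_HPL k (grow x p) - frontier_HPL k x\<bar> \<le> real (next_depth x p) + harm (card x)"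
proof -
  have fin: "finite (grow x p)" using grown_finite[OF assms(1)] by simp
  have "frontier_HPL k (grow x p) - frontier_HPL k x = (\<Sum>w\<in>frontier k \<inter> grow x p. centered_HPL (grow x p) w - centered_HPL x w)"
    using fin by (simp add: frontier_HPL_eq[of "grow x p" x] frontier_HPL_eq[of "grow x p" "grow x p"]
        subset_insertI sum_subtractf)
  also have "\<bar>\<dots>\<bar> \<le> real (next_depth x p) + harm (card x)"
  proof (cases "\<exists>w. w \<in> frontier k \<and> prefix w p")
    case True
    then obtain w v where w: "w \<in> frontier k" "p = w @ v" by (auto simp: prefix_def)
    have wx: "w \<in> x" using assms w grown_prefix by auto
    have "(\<Sum>w\<in>frontier k \<inter> grow x p. centered_HPL (grow x p) w - centered_HPL x w) =
        (\<Sum>w\<in>{w}. centered_HPL (grow x p) w - centered_HPL x w)"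
      using fin w wx frontier_unique[of _ k w p] centered_HPL_grow_other[OF assms]
      by (intro sum.mono_neutral_right) (auto simp: prefix_def)
    also have "\<dots> = real (next_depth (subtree x w) v) - (harm (below x w) - 1)"
      using centered_HPL_grow_below[of x w v] assms w by simp
    also have "\<bar>\<dots>\<bar> \<le> real (next_depth x p) + harm (card x)"
    proof -
      have "harm (below x w) \<ge> (1::real)" using below_pos_iff[OF assms(1), of w] wx by (intro harm_ge_1) simp
      moreover have "harm (below x w) \<le> (harm (card x) :: real)" using below_le_card[OF assms(1)] by (rule harm_mono)
      moreover have "real (next_depth (subtree x w) v) \<le> real (next_depth x p)"
        using next_depth_subtree_le[OF assms(1)] w by simp
      ultimately show ?thesis by linarith
    qed
    finally show ?thesis .
  next
    case False
    then have "(\<Sum>w\<in>frontier k \<inter> grow x p. centered_HPL (grow x p) w - centered_HPL x w) = 0"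
      using centered_HPL_grow_other[OF assms] by (intro sum.neutral) auto
    then show ?thesis by (simp add: harm_nonneg)
  qed
  finally show ?thesis .
qed


section \<open>One step of the Harris chain\<close>

lemma (in prob_space) expectation_finite:
  fixes f :: "'b \<Rightarrow> real"
  assumes F: "finite F" "AE \<omega> in M. Z \<omega> \<in> F"
    and ev: "\<And>z. z \<in> F \<Longrightarrow> {\<omega> \<in> space M. Z \<omega> = z} \<in> events"
    and meas: "(\<lambda>\<omega>. f (Z \<omega>)) \<in> borel_measurable M"
  shows "integrable M (\<lambda>\<omega>. f (Z \<omega>))"
    and "expectation (\<lambda>\<omega>. f (Z \<omega>)) = (\<Sum>z\<in>F. f z * prob {\<omega> \<in> space M. Z \<omega> = z})"
proof -
  let ?I = "\<lambda>z. indicator {\<omega> \<in> space M. Z \<omega> = z} :: 'a \<Rightarrow> real"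
  have int: "integrable M (\<lambda>\<omega>. \<Sum>z\<in>F. f z * ?I z \<omega>)"
    by (intro Bochner_Integration.integrable_sum integrable_mult_right integrable_real_indicator)
      (auto simp: emeasure_eq_measure ev)
  have eq: "AE \<omega> in M. f (Z \<omega>) = (\<Sum>z\<in>F. f z * ?I z \<omega>)"
    using F(2)
  proof (rule AE_mp, intro AE_I2 impI)
    fix \<omega> assume \<omega>: "\<omega> \<in> space M" "Z \<omega> \<in> F"
    have "(\<Sum>z\<in>F. f z * ?I z \<omega>) = (\<Sum>z\<in>F. if z = Z \<omega> then f z else 0)"
      using \<omega> by (intro sum.cong) (auto simp: indicator_def)
    then show "f (Z \<omega>) = (\<Sum>z\<in>F. f z * ?I z \<omega>)" using \<omega> F(1) by simp
  qed
  have eq': "AE \<omega> in M. (\<Sum>z\<in>F. f z * ?I z \<omega>) = f (Z \<omega>)" using eq by eventually_elim simp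
  show "integrable M (\<lambda>\<omega>. f (Z \<omega>))" by (rule integrable_cong_AE_imp[OF int meas eq'])
  have "expectation (\<lambda>\<omega>. f (Z \<omega>)) = expectation (\<lambda>\<omega>. \<Sum>z\<in>F. f z * ?I z \<omega>)"
    using int by (intro integral_cong_AE meas eq) auto
  also have "\<dots> = (\<Sum>z\<in>F. expectation (\<lambda>\<omega>. f z * ?I z \<omega>))"
    by (intro Bochner_Integration.integral_sum integrable_mult_right integrable_real_indicator)
      (auto simp: emeasure_eq_measure ev)
  also have "\<dots> = (\<Sum>z\<in>F. f z * prob {\<omega> \<in> space M. Z \<omega> = z})"
    using ev by (intro sum.cong refl) simp
  finally show "expectation (\<lambda>\<omega>. f (Z \<omega>)) = (\<Sum>z\<in>F. f z * prob {\<omega> \<in> space M. Z \<omega> = z})" .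
qed

lemma (in prob_space) prob_of_cond_prob:
  assumes Q: "{\<omega> \<in> space M. Q \<omega>} \<in> events"
    and c: "prob {\<omega> \<in> space M. Q \<omega>} > 0 \<Longrightarrow> cond_prob M P Q = c"
  shows "prob {\<omega> \<in> space M. Q \<omega> \<and> P \<omega>} = c * prob {\<omega> \<in> space M. Q \<omega>}"
proof (cases "prob {\<omega> \<in> space M. Q \<omega>} > 0")
  case True
  have "{\<omega> \<in> space M. P \<omega> \<and> Q \<omega>} = {\<omega> \<in> space M. Q \<omega> \<and> P \<omega>}" by blast
  then show ?thesis using c[OF True] True by (simp add: cond_prob_def nonzero_divide_eq_eq)
next
  case False
  have "prob {\<omega> \<in> space M. Q \<omega> \<and> P \<omega>} \<le> prob {\<omega> \<in> space M. Q \<omega>}"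
    using Q by (intro finite_measure_mono) auto
  with False show ?thesis by (simp add: zero_less_measure_iff measure_le_0_iff)
qed

locale harris_process = prob_space M for M :: "'a measure" +
  fixes X :: "nat \<Rightarrow> 'a \<Rightarrow> nat list set"
  assumes chain: "harris_chain M X"
begin

lemma X_measurable: "n \<ge> 1 \<Longrightarrow> X n \<in> measurable M (count_space {x. harris_tree x})"
  using chain by (auto simp: harris_chain_def markov_chain_def)

lemma measurable_of_tree:
  assumes "n \<ge> 1" "\<And>x. f x \<in> space N"
  shows "(\<lambda>\<omega>. f (X n \<omega>)) \<in> measurable M N"
  using assms(2) by (intro measurable_compose[OF X_measurable[OF assms(1)]]) auto

lemma measurable_of_two_trees:
  assumes "a \<ge> 1" "n \<ge> 1" "\<And>s x. f s x \<in> space N"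
  shows "(\<lambda>\<omega>. f (X a \<omega>) (X n \<omega>)) \<in> measurable M N"
  by (rule measurable_compose_countable'[OF _ X_measurable[OF assms(1)] countable_harris_tree])
    (rule measurable_of_tree, use assms in auto)

lemma measurable_of_three_trees:
  assumes "a \<ge> 1" "n \<ge> 1" "m \<ge> 1" "\<And>s x y. f s x y \<in> space N"
  shows "(\<lambda>\<omega>. f (X a \<omega>) (X n \<omega>) (X m \<omega>)) \<in> measurable M N"
  by (rule measurable_compose_countable'[OF _ X_measurable[OF assms(1)] countable_harris_tree])
    (rule measurable_of_two_trees, use assms in auto)

lemma event_tree:
  assumes "n \<ge> 1" shows "{\<omega> \<in> space M. P (X n \<omega>)} \<in> events"
  using measurable_of_tree[OF assms, of P "count_space UNIV"] by (simp add: pred_def)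

lemma event_two_trees:
  assumes "a \<ge> 1" "n \<ge> 1" shows "{\<omega> \<in> space M. P (X a \<omega>) (X n \<omega>)} \<in> events"
  using measurable_of_two_trees[OF assms, of P "count_space UNIV"] by (simp add: pred_def)

lemma event_three_trees:
  assumes "a \<ge> 1" "n \<ge> 1" "m \<ge> 1"
  shows "{\<omega> \<in> space M. P (X a \<omega>) (X n \<omega>) (X m \<omega>)} \<in> events"
  using measurable_of_three_trees[OF assms, of P "count_space UNIV"] by (simp add: pred_def)

lemma AE_start: "AE \<omega> in M. X 1 \<omega> = {[]}"
  using chain by (simp add: harris_chain_def)

lemma path_event: "{\<omega> \<in> space M. \<forall>k\<in>{1..n}. X k \<omega> = z k} \<in> events"
  by (intro sets.sets_Collect_finite_All event_tree) auto

lemma cond_step: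
  assumes "n \<ge> 1" "x \<in> grown_trees n" "p \<in> x" "prob {\<omega> \<in> space M. X n \<omega> = x} > 0"
  shows "cond_prob M (\<lambda>\<omega>. X (Suc n) \<omega> = grow x p) (\<lambda>\<omega>. X n \<omega> = x) = 1 / real n"
proof -
  have "x \<in> harris_trees n" "grow x p \<in> harris_trees (Suc n)"
    using assms grow_in_grown_trees grown_trees_subset_harris_trees by blast+
  moreover have "x \<subseteq> grow x p" by blast
  ultimately show ?thesis using chain assms(1,4) unfolding harris_chain_def by simp
qed

lemma prob_step:
  assumes "n \<ge> 1" "x \<in> grown_trees n" "p \<in> x"
  shows "prob {\<omega> \<in> space M. X n \<omega> = x \<and> X (Suc n) \<omega> = grow x p} = prob {\<omega> \<in> space M. X n \<omega> = x} / real n"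
  using prob_of_cond_prob[OF event_tree[OF assms(1)] cond_step[OF assms]] by simp

text \<open>The \<open>n\<close> trees \<open>grow x p\<close> are distinct and each of them has conditional probability \<open>1 / n\<close>, so
they exhaust the law of the next step.\<close>

lemma AE_grows_from:
  assumes "n \<ge> 1" "x \<in> grown_trees n"
  shows "AE \<omega> in M. X n \<omega> = x \<longrightarrow> X (Suc n) \<omega> \<in> grow x ` x"
proof -
  have g: "grown x" "card x = n" using assms by (auto simp: grown_trees_def)
  define A where "A = {\<omega> \<in> space M. X n \<omega> = x}"
  define E where "E = (\<lambda>p. {\<omega> \<in> space M. X n \<omega> = x \<and> X (Suc n) \<omega> = grow x p})"
  have A: "A \<in> events" unfolding A_def using event_tree assms by simp
  have E: "E p \<in> events" for p
    unfolding E_def using event_two_trees[of n "Suc n" "\<lambda>s y. s = x \<and> y = grow x p"] assms by simp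
  have "prob (\<Union>p\<in>x. E p) = (\<Sum>p\<in>x. prob (E p))"
    using E grown_finite[OF g(1)] inj_on_grow[OF g(1)]
    by (intro finite_measure_finite_Union) (auto simp: disjoint_family_on_def E_def inj_on_def)
  also have "\<dots> = (\<Sum>p\<in>x. prob A / real n)"
    using prob_step[OF assms] by (intro sum.cong) (auto simp: E_def A_def)
  also have "\<dots> = prob A" using g assms(1) by simp
  finally have eq: "prob (\<Union>p\<in>x. E p) = prob A" .
  have sub: "(\<Union>p\<in>x. E p) \<subseteq> A" by (auto simp: E_def A_def)
  have U: "(\<Union>p\<in>x. E p) \<in> events" using E grown_finite[OF g(1)] by auto
  have "prob (A - (\<Union>p\<in>x. E p)) = 0" using finite_measure_Diff[OF A U sub] eq by simp
  then have "A - (\<Union>p\<in>x. E p) \<in> null_sets M"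
    using A U by (intro null_setsI) (auto simp: emeasure_eq_measure)
  then show ?thesis
    by (rule AE_I') (auto simp: A_def E_def)
qed

lemma AE_grown_trees:
  assumes "n \<ge> 1"
  shows "AE \<omega> in M. X n \<omega> \<in> grown_trees n"
  using assms
proof (induction n rule: dec_induct)
  case base
  show ?case using AE_start grown_trees_one by simp
next
  case (step n)
  have "AE \<omega> in M. \<forall>x\<in>grown_trees n. X n \<omega> = x \<longrightarrow> X (Suc n) \<omega> \<in> grow x ` x"
    using AE_grows_from[of n] step.hyps finite_grown_trees by (intro AE_finite_allI) auto
  with step.IH show ?case
  proof eventually_elim
    case (elim \<omega>)
    then obtain p where "p \<in> X n \<omega>" "X (Suc n) \<omega> = grow (X n \<omega>) p" by blast
    then show ?case using elim grow_in_grown_trees by metis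
  qed
qed

lemma AE_step:
  assumes "n \<ge> 1"
  shows "AE \<omega> in M. X n \<omega> \<in> grown_trees n \<and> X (Suc n) \<omega> \<in> grow (X n \<omega>) ` X n \<omega>"
proof -
  have "AE \<omega> in M. \<forall>x\<in>grown_trees n. X n \<omega> = x \<longrightarrow> X (Suc n) \<omega> \<in> grow x ` x"
    using AE_grows_from[of n] assms finite_grown_trees by (intro AE_finite_allI) auto
  with AE_grown_trees[OF assms] show ?thesis by eventually_elim blast
qed

lemma path_step:
  assumes "n \<ge> 1" "z n \<in> grown_trees n" "p \<in> z n"
  shows "prob {\<omega> \<in> space M. (\<forall>k\<in>{1..n}. X k \<omega> = z k) \<and> X (Suc n) \<omega> = grow (z n) p}
    = prob {\<omega> \<in> space M. \<forall>k\<in>{1..n}. X k \<omega> = z k} / real n"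
proof -
  let ?H = "\<lambda>\<omega>. \<forall>k\<in>{1..n}. X k \<omega> = z k"
  have "cond_prob M (\<lambda>\<omega>. X (Suc n) \<omega> = grow (z n) p) (\<lambda>\<omega>. ?H \<omega>) = 1 / real n"
    if pos: "prob {\<omega> \<in> space M. ?H \<omega>} > 0"
  proof -
    have "prob {\<omega> \<in> space M. ?H \<omega>} \<le> prob {\<omega> \<in> space M. X n \<omega> = z n}"
      using assms event_tree by (intro finite_measure_mono) auto
    with pos have pos_n: "prob {\<omega> \<in> space M. X n \<omega> = z n} > 0" by simp
    have "harris_tree (grow (z n) p)"
      using assms grown.step[of "z n" p] grown_harris_tree by (simp add: grown_trees_def)
    then have "cond_prob M (\<lambda>\<omega>. X (Suc n) \<omega> = grow (z n) p) (\<lambda>\<omega>. ?H \<omega>)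
        = cond_prob M (\<lambda>\<omega>. X (Suc n) \<omega> = grow (z n) p) (\<lambda>\<omega>. X n \<omega> = z n)"
      using chain pos assms(1) unfolding harris_chain_def markov_chain_def by blast
    from trans[OF this cond_step[OF assms pos_n]] show ?thesis .
  qed
  from prob_of_cond_prob[OF path_event this] show ?thesis by simp
qed

text \<open>The Markov property is stated for complete histories. Summing it over the finitely many
histories with given states at times \<open>a\<close> and \<open>n\<close> gives the law of the next step given just these
two states. The state at the earlier time \<open>a\<close> matters, because a tree does not determine its
history.\<close>

lemma joint_step:
  assumes "1 \<le> a" "a \<le> n" "x \<in> grown_trees n" "p \<in> x"
  shows "prob {\<omega> \<in> space M. X a \<omega> = s \<and> X n \<omega> = x \<and> X (Suc n) \<omega> = grow x p}
    = prob {\<omega> \<in> space M. X a \<omega> = s \<and> X n \<omega> = x} / real n"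
proof -
  let ?A = "\<lambda>Q. {\<omega> \<in> space M. X a \<omega> = s \<and> X n \<omega> = x \<and> Q \<omega>}"
  define paths where "paths = {z \<in> PiE {1..n} grown_trees. z a = s \<and> z n = x}"
  define E where "E = (\<lambda>z. {\<omega> \<in> space M. \<forall>k\<in>{1..n}. X k \<omega> = z k})"
  have fin: "finite paths" unfolding paths_def using finite_grown_trees
    by (intro finite_subset[OF _ finite_PiE[of "{1..n}" grown_trees]]) auto
  have E: "E z \<in> events" for z unfolding E_def by (rule path_event)
  have AE_path: "AE \<omega> in M. \<forall>k\<in>{1..n}. X k \<omega> \<in> grown_trees k"
    using AE_grown_trees by (intro AE_finite_allI) auto
  have split: "prob (?A Q) = (\<Sum>z\<in>paths. prob (E z \<inter> {\<omega> \<in> space M. Q \<omega>}))"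
    if Q: "{\<omega> \<in> space M. Q \<omega>} \<in> events" for Q
  proof -
    have m: "(?A Q) \<in> events"
    proof -
      have "{\<omega> \<in> space M. X a \<omega> = s \<and> X n \<omega> = x} \<inter> {\<omega> \<in> space M. Q \<omega>} \<in> events"
        using event_two_trees[of a n "\<lambda>s' y. s' = s \<and> y = x"] assms Q by auto
      then show ?thesis by (rule back_subst[of "\<lambda>A. A \<in> events"]) auto
    qed
    have "prob (?A Q) = prob (\<Union>z\<in>paths. E z \<inter> {\<omega> \<in> space M. Q \<omega>})"
    proof (rule finite_measure_eq_AE)
      show "AE \<omega> in M. \<omega> \<in> (?A Q) \<longleftrightarrow>
          \<omega> \<in> (\<Union>z\<in>paths. E z \<inter> {\<omega> \<in> space M. Q \<omega>})"
        using AE_path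
      proof (rule AE_mp, intro AE_I2 impI)
        fix \<omega> assume \<omega>: "\<omega> \<in> space M" "\<forall>k\<in>{1..n}. X k \<omega> \<in> grown_trees k"
        define z where "z = restrict (\<lambda>k. X k \<omega>) {1..n}"
        have "z \<in> paths \<and> \<omega> \<in> E z" if "X a \<omega> = s" "X n \<omega> = x"
          using that \<omega> assms by (auto simp: z_def paths_def E_def)
        moreover have "X a \<omega> = s \<and> X n \<omega> = x" if "z' \<in> paths" "\<omega> \<in> E z'" for z'
          using that assms by (auto simp: paths_def E_def)
        ultimately show "\<omega> \<in> (?A Q) \<longleftrightarrow>
          \<omega> \<in> (\<Union>z\<in>paths. E z \<inter> {\<omega> \<in> space M. Q \<omega>})" using \<omega>(1) by blast
      qed
    next
      show "(\<Union>z\<in>paths. E z \<inter> {\<omega> \<in> space M. Q \<omega>}) \<in> events"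
        using fin E Q by (intro sets.finite_UN) auto
    qed (fact m)
    also have "\<dots> = (\<Sum>z\<in>paths. prob (E z \<inter> {\<omega> \<in> space M. Q \<omega>}))"
    proof (rule finite_measure_finite_Union[OF fin])
      show "disjoint_family_on (\<lambda>z. E z \<inter> {\<omega> \<in> space M. Q \<omega>}) paths"
        unfolding disjoint_family_on_def
      proof (intro ballI impI)
        fix z z' assume z: "z \<in> paths" "z' \<in> paths" "z \<noteq> z'"
        have "z = z'" if "\<omega> \<in> E z" "\<omega> \<in> E z'" for \<omega>
          using z(1,2) that unfolding paths_def E_def by (intro PiE_ext[of z "{1..n}" grown_trees]) auto
        then show "E z \<inter> {\<omega> \<in> space M. Q \<omega>} \<inter> (E z' \<inter> {\<omega> \<in> space M. Q \<omega>}) = {}" using z(3) by blast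
      qed
    qed (use E Q in auto)
    finally show ?thesis .
  qed
  have "prob {\<omega> \<in> space M. X a \<omega> = s \<and> X n \<omega> = x \<and> X (Suc n) \<omega> = grow x p} =
      (\<Sum>z\<in>paths. prob (E z \<inter> {\<omega> \<in> space M. X (Suc n) \<omega> = grow x p}))"
    using event_tree[of "Suc n"] by (intro split) auto
  also have "\<dots> = (\<Sum>z\<in>paths. prob (E z) / real n)"
  proof (intro sum.cong refl)
    fix z assume "z \<in> paths"
    then have "z n = x" by (simp add: paths_def)
    moreover have "E z \<inter> {\<omega> \<in> space M. X (Suc n) \<omega> = grow x p} =
        {\<omega> \<in> space M. (\<forall>k\<in>{1..n}. X k \<omega> = z k) \<and> X (Suc n) \<omega> = grow x p}"
      by (auto simp: E_def)
    ultimately show "prob (E z \<inter> {\<omega> \<in> space M. X (Suc n) \<omega> = grow x p}) = prob (E z) / real n"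
      using path_step[of n z p] assms by (simp add: E_def)
  qed
  also have "\<dots> = (\<Sum>z\<in>paths. prob (E z \<inter> {\<omega> \<in> space M. True})) / real n"
    using E by (simp add: sum_divide_distrib)
  also have "\<dots> = prob {\<omega> \<in> space M. X a \<omega> = s \<and> X n \<omega> = x} / real n"
    by (subst split[symmetric]) auto
  finally show ?thesis .
qed

lemma expectation_pair:
  fixes f :: "nat list set \<Rightarrow> nat list set \<Rightarrow> real"
  assumes "a \<ge> 1" "n \<ge> 1"
  shows "integrable M (\<lambda>\<omega>. f (X a \<omega>) (X n \<omega>))"
    and "expectation (\<lambda>\<omega>. f (X a \<omega>) (X n \<omega>)) =
      (\<Sum>(s, x)\<in>grown_trees a \<times> grown_trees n. f s x * prob {\<omega> \<in> space M. X a \<omega> = s \<and> X n \<omega> = x})"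
proof -
  let ?Z = "\<lambda>\<omega>. (X a \<omega>, X n \<omega>)" and ?f = "\<lambda>(s, x). f s x"
  have AE: "AE \<omega> in M. ?Z \<omega> \<in> grown_trees a \<times> grown_trees n"
    using AE_grown_trees[OF assms(1)] AE_grown_trees[OF assms(2)] by eventually_elim simp
  have ev: "{\<omega> \<in> space M. ?Z \<omega> = z} \<in> events" for z
    using event_two_trees[OF assms, of "\<lambda>s x. (s, x) = z"] by simp
  have m: "(\<lambda>\<omega>. ?f (?Z \<omega>)) \<in> borel_measurable M"
    using measurable_of_two_trees[OF assms, of f borel] by simp
  note E = expectation_finite[OF finite_cartesian_product[OF finite_grown_trees finite_grown_trees] AE ev m]
  show "integrable M (\<lambda>\<omega>. f (X a \<omega>) (X n \<omega>))" using E(1) by simp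
  show "expectation (\<lambda>\<omega>. f (X a \<omega>) (X n \<omega>)) =
      (\<Sum>(s, x)\<in>grown_trees a \<times> grown_trees n. f s x * prob {\<omega> \<in> space M. X a \<omega> = s \<and> X n \<omega> = x})"
    using E(2) by (simp add: case_prod_unfold prod_eq_iff)
qed

lemma integrable_of_tree: "n \<ge> 1 \<Longrightarrow> integrable M (\<lambda>\<omega>. f (X n \<omega>) :: real)"
  using expectation_pair(1)[of n n "\<lambda>_. f"] by simp

text \<open>This takes the place of conditional expectations: every use of the martingale property below
concerns a function of the trees at no more than three times.\<close>

lemma expectation_step:
  fixes f :: "nat list set \<Rightarrow> nat list set \<Rightarrow> nat list set \<Rightarrow> real"
  assumes "1 \<le> a" "a \<le> n"
  shows "integrable M (\<lambda>\<omega>. f (X a \<omega>) (X n \<omega>) (X (Suc n) \<omega>))"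
    and "expectation (\<lambda>\<omega>. f (X a \<omega>) (X n \<omega>) (X (Suc n) \<omega>)) =
      expectation (\<lambda>\<omega>. (\<Sum>p\<in>X n \<omega>. f (X a \<omega>) (X n \<omega>) (grow (X n \<omega>) p)) / real n)"
proof -
  let ?Z = "\<lambda>\<omega>. ((X a \<omega>, X n \<omega>), X (Suc n) \<omega>)" and ?f = "\<lambda>((s, x), y). f s x y"
  let ?P = "grown_trees a \<times> grown_trees n"
  let ?F = "SIGMA (s, x):?P. grow x ` x"
  have a: "a \<ge> 1" and n: "n \<ge> 1" and S: "Suc n \<ge> 1" using assms by auto
  have fin: "finite x" "inj_on (grow x) x" if "x \<in> grown_trees n" for x
    using that grown_finite inj_on_grow by (auto simp: grown_trees_def)
  have F: "finite ?F" using finite_grown_trees fin by (intro finite_SigmaI) auto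
  have AE: "AE \<omega> in M. ?Z \<omega> \<in> ?F"
    using AE_grown_trees[OF a] AE_step[OF n] by eventually_elim auto
  have ev: "{\<omega> \<in> space M. ?Z \<omega> = z} \<in> events" for z
    using event_three_trees[OF a n S, of "\<lambda>s x y. ((s, x), y) = z"] by simp
  have m: "(\<lambda>\<omega>. ?f (?Z \<omega>)) \<in> borel_measurable M"
    using measurable_of_three_trees[OF a n S, of f borel] by simp
  note E = expectation_finite[OF F AE ev m]
  show "integrable M (\<lambda>\<omega>. f (X a \<omega>) (X n \<omega>) (X (Suc n) \<omega>))" using E(1) by simp
  have "expectation (\<lambda>\<omega>. f (X a \<omega>) (X n \<omega>) (X (Suc n) \<omega>)) =
      (\<Sum>z\<in>?F. ?f z * prob {\<omega> \<in> space M. ?Z \<omega> = z})" using E(2) by simp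
  also have "\<dots> = (\<Sum>sx\<in>?P. \<Sum>y\<in>grow (snd sx) ` snd sx. ?f (sx, y) * prob {\<omega> \<in> space M. ?Z \<omega> = (sx, y)})"
    using finite_grown_trees fin by (subst sum.Sigma) (auto simp: case_prod_unfold prod_eq_iff)
  also have "\<dots> = (\<Sum>sx\<in>?P. (\<Sum>p\<in>snd sx. f (fst sx) (snd sx) (grow (snd sx) p)) / real n *
      prob {\<omega> \<in> space M. X a \<omega> = fst sx \<and> X n \<omega> = snd sx})"
  proof (intro sum.cong refl)
    fix sx assume "sx \<in> ?P"
    then obtain s x where sx: "sx = (s, x)" "x \<in> grown_trees n" by auto
    have "(\<Sum>y\<in>grow x ` x. f s x y * prob {\<omega> \<in> space M. ?Z \<omega> = ((s, x), y)}) =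
      (\<Sum>p\<in>x. f s x (grow x p) * (prob {\<omega> \<in> space M. X a \<omega> = s \<and> X n \<omega> = x} / real n))"
      using joint_step[OF assms sx(2)] fin[OF sx(2)] by (subst sum.reindex) (auto simp: prod_eq_iff intro!: sum.cong)
    then show "(\<Sum>y\<in>grow (snd sx) ` snd sx. ?f (sx, y) * prob {\<omega> \<in> space M. ?Z \<omega> = (sx, y)}) =
      (\<Sum>p\<in>snd sx. f (fst sx) (snd sx) (grow (snd sx) p)) / real n *
      prob {\<omega> \<in> space M. X a \<omega> = fst sx \<and> X n \<omega> = snd sx}"
      by (simp add: sx sum_divide_distrib sum_distrib_right)
  qed
  also have "\<dots> = expectation (\<lambda>\<omega>. (\<Sum>p\<in>X n \<omega>. f (X a \<omega>) (X n \<omega>) (grow (X n \<omega>) p)) / real n)"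
    using expectation_pair(2)[OF a n, of "\<lambda>s x. (\<Sum>p\<in>x. f s x (grow x p)) / real n"]
    by (simp add: case_prod_unfold)
  finally show "expectation (\<lambda>\<omega>. f (X a \<omega>) (X n \<omega>) (X (Suc n) \<omega>)) =
      expectation (\<lambda>\<omega>. (\<Sum>p\<in>X n \<omega>. f (X a \<omega>) (X n \<omega>) (grow (X n \<omega>) p)) / real n)" .
qed

lemma expectation_drift:
  fixes f :: "nat list set \<Rightarrow> real"
  assumes "n \<ge> 1" "\<And>x. x \<in> grown_trees n \<Longrightarrow> (\<Sum>p\<in>x. f (grow x p) - f x) = c * f x"
  shows "expectation (\<lambda>\<omega>. f (X (Suc n) \<omega>)) = (1 + c / real n) * expectation (\<lambda>\<omega>. f (X n \<omega>))"
proof -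
  have "expectation (\<lambda>\<omega>. f (X (Suc n) \<omega>)) =
      expectation (\<lambda>\<omega>. (\<Sum>p\<in>X n \<omega>. f (grow (X n \<omega>) p)) / real n)"
    using expectation_step(2)[of n n "\<lambda>_ _. f"] assms(1) by simp
  also have "\<dots> = expectation (\<lambda>\<omega>. (1 + c / real n) * f (X n \<omega>))"
  proof (rule integral_cong_AE)
    show "AE \<omega> in M. (\<Sum>p\<in>X n \<omega>. f (grow (X n \<omega>) p)) / real n = (1 + c / real n) * f (X n \<omega>)"
      using AE_grown_trees[OF assms(1)]
    proof eventually_elim
      case (elim \<omega>)
      have "real (card (X n \<omega>)) = real n" using elim by (simp add: grown_trees_def)
      then show ?case using assms(2)[OF elim] assms(1)
        by (simp add: sum_subtractf field_simps)
    qed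
  qed (use measurable_of_tree[OF assms(1), of _ borel] in auto)
  also have "\<dots> = (1 + c / real n) * expectation (\<lambda>\<omega>. f (X n \<omega>))" by simp
  finally show ?thesis .
qed

end


section \<open>Moments of the martingales\<close>

text \<open>From the second order on, the products in the binomial expansion lie in absolute value between
\<open>s ^ (2 * m - 2) * d\<^sup>2\<close> and \<open>d ^ (2 * m)\<close>. The first-order term is kept exactly, since it
vanishes in the mean for a martingale increment.\<close>

lemma power_add_le:
  fixes s d :: real
  assumes "m \<ge> 1"
  shows "(s + d) ^ (2 * m) \<le> s ^ (2 * m) + real (2 * m) * s ^ (2 * m - 1) * d
    + 4 ^ m * (s ^ (2 * m - 2) * d\<^sup>2 + d ^ (2 * m))"
proof -
  define B where "B = s ^ (2 * m - 2) * d\<^sup>2 + d ^ (2 * m)"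
  have nonneg: "s ^ (2 * m - 2) * d\<^sup>2 \<ge> 0" "d ^ (2 * m) \<ge> 0"
    using zero_le_even_power[of "2 * m - 2" s] by simp_all
  have bound: "d ^ j * s ^ (2 * m - j) \<le> B" if j: "2 \<le> j" "j \<le> 2 * m" for j
  proof -
    have abs: "d ^ j * s ^ (2 * m - j) \<le> \<bar>d\<bar> ^ j * \<bar>s\<bar> ^ (2 * m - j)"
      by (metis abs_ge_self abs_mult power_abs)
    show ?thesis
    proof (cases "\<bar>s\<bar> \<le> \<bar>d\<bar>")
      case True
      then have "\<bar>d\<bar> ^ j * \<bar>s\<bar> ^ (2 * m - j) \<le> \<bar>d\<bar> ^ j * \<bar>d\<bar> ^ (2 * m - j)"
        by (intro mult_left_mono power_mono) auto
      also have "\<dots> = d ^ (2 * m)" using j by (simp flip: power_add add: power_even_abs)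
      finally show ?thesis using abs nonneg by (simp add: B_def)
    next
      case False
      have "\<bar>d\<bar> ^ j * \<bar>s\<bar> ^ (2 * m - j) = \<bar>d\<bar> ^ 2 * (\<bar>d\<bar> ^ (j - 2) * \<bar>s\<bar> ^ (2 * m - j))"
        using j(1) by (metis le_add_diff_inverse mult.assoc power_add)
      also have "\<dots> \<le> \<bar>d\<bar> ^ 2 * (\<bar>s\<bar> ^ (j - 2) * \<bar>s\<bar> ^ (2 * m - j))"
        using False by (intro mult_left_mono mult_right_mono power_mono) auto
      also have "\<dots> = s ^ (2 * m - 2) * d\<^sup>2"
        using j by (simp flip: power_add add: power_even_abs mult.commute)
      finally show ?thesis using abs nonneg unfolding B_def by linarith
    qed
  qed
  have "(s + d) ^ (2 * m) = (\<Sum>j\<le>2 * m. real (2 * m choose j) * d ^ j * s ^ (2 * m - j))"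
    by (subst add.commute) (rule binomial_ring)
  also have "\<dots> = (\<Sum>j\<in>{0, 1} \<union> {2..2 * m}. real (2 * m choose j) * d ^ j * s ^ (2 * m - j))"
    using assms by (intro sum.cong) auto
  also have "\<dots> = s ^ (2 * m) + real (2 * m) * s ^ (2 * m - 1) * d
      + (\<Sum>j\<in>{2..2 * m}. real (2 * m choose j) * d ^ j * s ^ (2 * m - j))"
    by (subst sum.union_disjoint) auto
  also have "(\<Sum>j\<in>{2..2 * m}. real (2 * m choose j) * d ^ j * s ^ (2 * m - j)) \<le>
      (\<Sum>j\<in>{2..2 * m}. real (2 * m choose j) * B)"
    using bound by (intro sum_mono) (auto simp: mult.assoc intro: mult_left_mono)
  also have "\<dots> \<le> (\<Sum>j\<le>2 * m. real (2 * m choose j) * B)"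
    using nonneg by (intro sum_mono2) (auto simp: B_def)
  also have "\<dots> = 4 ^ m * B"
    using choose_row_sum[of "2 * m"]
    by (simp flip: sum_distrib_right of_nat_sum add: power_mult)
  finally show ?thesis by (simp add: B_def)
qed

text \<open>One step in the growth of an even moment of a martingale. The mixed term \<open>s ^ (2 * m - 2) * d\<^sup>2\<close>
is split by Young's inequality with a free weight \<open>l\<close>, so that the first part multiplies the old
moment by \<open>1 + O(l)\<close>; for a summable sequence of weights the product of these factors remains
bounded.\<close>

lemma mean_even_power_shift_le:
  fixes d :: "'b \<Rightarrow> real"
  assumes "finite x" "x \<noteq> {}" "(\<Sum>p\<in>x. d p) = 0" "0 < l" "l \<le> 1" "m \<ge> 1"
  shows "(\<Sum>p\<in>x. (s + d p) ^ (2 * m)) / real (card x) \<le>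
    (1 + 4 ^ m * l) * s ^ (2 * m) + 2 * 4 ^ m * (l / l ^ m) * ((\<Sum>p\<in>x. d p ^ (2 * m)) / real (card x))"
proof -
  define n where "n = real (card x)"
  have n: "n > 0" using assms by (simp add: n_def card_gt_0_iff)
  have each: "(s + d p) ^ (2 * m) \<le> (1 + 4 ^ m * l) * s ^ (2 * m) + real (2 * m) * s ^ (2 * m - 1) * d p
      + 2 * 4 ^ m * (l / l ^ m) * d p ^ (2 * m)" for p
  proof -
    define e where "e = (d p)\<^sup>2 / l"
    have e: "e \<ge> 0" "e ^ m = d p ^ (2 * m) / l ^ m"
      using assms(4) by (auto simp: e_def power_divide power_mult)
    have sp: "s ^ (2 * m - 2) = (s\<^sup>2) ^ (m - 1)" "s ^ (2 * m) = (s\<^sup>2) ^ m"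
      by (simp_all flip: power_mult add: diff_mult_distrib2)
    have split: "y ^ (m - 1) * y = y ^ m" for y :: real
      using assms(6) by (cases m) auto
    have young: "(s\<^sup>2) ^ (m - 1) * e \<le> (s\<^sup>2) ^ m + e ^ m"
    proof (cases "e \<le> s\<^sup>2")
      case True
      then have "(s\<^sup>2) ^ (m - 1) * e \<le> (s\<^sup>2) ^ (m - 1) * s\<^sup>2" by (intro mult_left_mono) auto
      then show ?thesis using split[of "s\<^sup>2"] zero_le_power[OF e(1), of m] by linarith
    next
      case False
      then have "(s\<^sup>2) ^ (m - 1) * e \<le> e ^ (m - 1) * e" using e(1) by (intro mult_right_mono power_mono) auto
      then show ?thesis using split[of e] by (simp add: add_increasing)
    qed
    have "s ^ (2 * m - 2) * (d p)\<^sup>2 = l * ((s\<^sup>2) ^ (m - 1) * e)"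
      using assms(4) by (simp add: e_def sp)
    also have "\<dots> \<le> l * ((s\<^sup>2) ^ m + e ^ m)" using assms(4) young by (intro mult_left_mono) auto
    also have "\<dots> = l * s ^ (2 * m) + (l / l ^ m) * d p ^ (2 * m)"
      by (simp only: e sp distrib_left times_divide_eq_left times_divide_eq_right)
    finally have A: "s ^ (2 * m - 2) * (d p)\<^sup>2 \<le> l * s ^ (2 * m) + (l / l ^ m) * d p ^ (2 * m)" .
    have "l ^ m \<le> l" using power_decreasing[of 1 m l] assms by simp
    then have "1 \<le> l / l ^ m" using assms(4) by simp
    from mult_right_mono[OF this, of "d p ^ (2 * m)"]
    have B: "d p ^ (2 * m) \<le> (l / l ^ m) * d p ^ (2 * m)" by (simp add: power_mult)
    have "4 ^ m * (s ^ (2 * m - 2) * (d p)\<^sup>2 + d p ^ (2 * m)) \<le>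
        4 ^ m * (l * s ^ (2 * m) + (l / l ^ m) * d p ^ (2 * m) + (l / l ^ m) * d p ^ (2 * m))"
      using add_mono[OF A B] by (intro mult_left_mono) auto
    then show ?thesis using power_add_le[OF assms(6), of s "d p"] by (simp add: algebra_simps)
  qed
  have "(\<Sum>p\<in>x. (s + d p) ^ (2 * m)) \<le> (\<Sum>p\<in>x. (1 + 4 ^ m * l) * s ^ (2 * m)
      + real (2 * m) * s ^ (2 * m - 1) * d p + 2 * 4 ^ m * (l / l ^ m) * d p ^ (2 * m))"
    using each by (intro sum_mono)
  also have "\<dots> = n * ((1 + 4 ^ m * l) * s ^ (2 * m)) + 2 * 4 ^ m * (l / l ^ m) * (\<Sum>p\<in>x. d p ^ (2 * m))"
    using assms(3)
    by (simp add: sum.distrib n_def sum_distrib_left[symmetric] sum_divide_distrib[symmetric])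
  finally have "(\<Sum>p\<in>x. (s + d p) ^ (2 * m)) / n \<le>
      (n * ((1 + 4 ^ m * l) * s ^ (2 * m)) + 2 * 4 ^ m * (l / l ^ m) * (\<Sum>p\<in>x. d p ^ (2 * m))) / n"
    using n by (intro divide_right_mono) auto
  also have "\<dots> = (1 + 4 ^ m * l) * s ^ (2 * m) + 2 * 4 ^ m * (l / l ^ m) * ((\<Sum>p\<in>x. d p ^ (2 * m)) / n)"
    using n by (simp add: add_divide_distrib)
  finally show ?thesis by (simp add: n_def)
qed

lemma even_power_add_le:
  fixes y z :: real
  shows "(y + z) ^ (2 * m) \<le> 4 ^ m * (y ^ (2 * m) + z ^ (2 * m))"
proof -
  have "(y + z) ^ (2 * m) = \<bar>y + z\<bar> ^ (2 * m)" by (simp add: power_even_abs)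
  also have "\<dots> \<le> (2 * max \<bar>y\<bar> \<bar>z\<bar>) ^ (2 * m)" by (intro power_mono) auto
  also have "\<dots> = 4 ^ m * (max \<bar>y\<bar> \<bar>z\<bar>) ^ (2 * m)" by (simp add: power_mult_distrib power_mult)
  also have "(max \<bar>y\<bar> \<bar>z\<bar>) ^ (2 * m) \<le> \<bar>y\<bar> ^ (2 * m) + \<bar>z\<bar> ^ (2 * m)"
    by (auto simp: max_def)
  finally show ?thesis by (simp add: power_even_abs)
qed

text \<open>Convexity bounds the power of the mean by the mean of the powers.\<close>

lemma sum_centered_power_le:
  fixes d :: "'b \<Rightarrow> real"
  assumes "finite x" "x \<noteq> {}" "m \<ge> 1"
  defines "c \<equiv> (\<Sum>p\<in>x. d p) / real (card x)"
  shows "(\<Sum>p\<in>x. (d p - c) ^ (2 * m)) \<le> 2 * 4 ^ m * (\<Sum>p\<in>x. d p ^ (2 * m))"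
proof -
  define n where "n = real (card x)"
  have n: "n > 0" using assms by (simp add: n_def card_gt_0_iff)
  have "(\<lambda>y::real. y ^ (2 * m)) (\<Sum>p\<in>x. (1 / n) *\<^sub>R d p) \<le> (\<Sum>p\<in>x. (1 / n) * (d p) ^ (2 * m))"
    by (rule convex_on_sum[OF assms(1,2) convex_power_even])
      (use n in \<open>auto simp: n_def\<close>)
  then have jensen: "n * c ^ (2 * m) \<le> (\<Sum>p\<in>x. d p ^ (2 * m))"
    using n by (simp add: c_def n_def[symmetric] field_simps flip: sum_divide_distrib sum_distrib_left)
  have two: "(y - z) ^ (2 * m) \<le> 4 ^ m * (y ^ (2 * m) + z ^ (2 * m))" for y z :: real
    using even_power_add_le[of y "- z" m] by simp
  have "(\<Sum>p\<in>x. (d p - c) ^ (2 * m)) \<le> (\<Sum>p\<in>x. 4 ^ m * (d p ^ (2 * m) + c ^ (2 * m)))"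
    using two by (intro sum_mono)
  also have "\<dots> = 4 ^ m * ((\<Sum>p\<in>x. d p ^ (2 * m)) + n * c ^ (2 * m))"
    by (simp add: n_def sum.distrib flip: sum_distrib_left)
  also have "\<dots> \<le> 4 ^ m * ((\<Sum>p\<in>x. d p ^ (2 * m)) + (\<Sum>p\<in>x. d p ^ (2 * m)))"
    using jensen by (intro mult_left_mono) auto
  finally show ?thesis by simp
qed

lemma power_le_fact_exp: "(t::real) \<ge> 0 \<Longrightarrow> t ^ p \<le> fact p * exp t"
proof -
  assume t: "t \<ge> 0"
  have "(\<Sum>i\<in>{p}. t ^ i /\<^sub>R fact i) \<le> (\<Sum>i. t ^ i /\<^sub>R fact i)"
    using t by (intro sum_le_suminf summable_exp_generic) auto
  then have "t ^ p / fact p \<le> exp t" by (simp add: exp_def divide_inverse mult.commute)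
  then show ?thesis by (simp add: field_simps)
qed

lemma harm_le_ln: "n \<ge> 1 \<Longrightarrow> harm n \<le> 1 + ln (real n)"
proof -
  assume "n \<ge> 1"
  then obtain k where k: "n = Suc k" by (cases n) auto
  have "harm (Suc k) - ln (real (Suc k)) \<le> harm (Suc 0) - ln (real (Suc 0))"
    using decseqD[OF decseq_harm_diff_ln, of 0 k] by simp
  moreover have "harm (Suc 0) = (1 :: real)" by (simp add: harm_def)
  ultimately show ?thesis by (simp add: k)
qed

text \<open>A power is dominated by \<open>2 powr (e + H\<^sub>n)\<close>, and \<open>2 powr H\<^sub>n \<le> 2 * n\<close>. In this form its mean over
the tree is known exactly.\<close>

lemma depth_harm_power_le:
  assumes "n \<ge> 1"
  shows "(real e + harm n) ^ p \<le> fact p / ln 2 ^ p * (2 * real n) * 2 ^ e"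
proof -
  define t where "t = real e + harm n"
  have t: "t \<ge> 0" by (simp add: t_def harm_nonneg)
  have "2 powr harm n \<le> 2 powr (1 + ln (real n))"
    using harm_le_ln[OF assms] by (intro powr_mono) auto
  also have "\<dots> = 2 * exp (ln 2 * ln (real n))" by (simp add: powr_add) (simp add: powr_def mult.commute)
  also have "ln 2 * ln (real n) \<le> 1 * ln (real n)"
    using assms ln_2_less_1 by (intro mult_right_mono) auto
  then have "2 * exp (ln 2 * ln (real n)) \<le> 2 * exp (ln (real n))" by simp
  finally have h: "2 powr harm n \<le> 2 * real n" using assms by simp
  have "(t * ln 2) ^ p \<le> fact p * exp (t * ln 2)"
    using t by (intro power_le_fact_exp) auto
  then have "t ^ p \<le> fact p / ln 2 ^ p * 2 powr t"
    by (simp add: power_mult_distrib powr_def field_simps)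
  also have "2 powr t = 2 ^ e * 2 powr harm n" by (simp add: t_def powr_add powr_realpow)
  also have "fact p / ln 2 ^ p * (2 ^ e * 2 powr harm n) \<le> fact p / ln 2 ^ p * (2 ^ e * (2 * real n))"
    using h by (intro mult_left_mono) auto
  finally show ?thesis by (simp add: t_def mult_ac)
qed

text \<open>The generating function of the depths of the places of growth at 2.\<close>

definition depth_gen :: "nat list set \<Rightarrow> real" where
  "depth_gen x = (\<Sum>p\<in>x. 2 ^ next_depth x p)"

lemma next_depth_grow:
  assumes "grown x" "p \<in> x"
  shows "next_depth (grow x p) u = next_depth x u + (if u = p then 1 else 0)"
  by (simp add: next_depth_def nchild_grow[OF assms])

text \<open>Growth at \<open>p\<close> replaces one place of growth by two: the first child of the new node, at the same
horizontal depth, and the next sibling of the new node, one step deeper.\<close>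

lemma depth_gen_drift:
  assumes "grown x"
  shows "(\<Sum>p\<in>x. depth_gen (grow x p) - depth_gen x) = 2 * depth_gen x"
proof -
  have "depth_gen (grow x p) - depth_gen x = 2 * 2 ^ next_depth x p" if p: "p \<in> x" for p
  proof -
    have new: "next_depth (grow x p) (new_node x p) = next_depth x p"
      using nchild_notin[OF assms new_node_notin[OF assms]] new_node_neq[of x p]
      by (simp add: next_depth_grow[OF assms p]) (simp add: next_depth_def hdepth_new_node)
    have "(\<Sum>u\<in>x. (2::real) ^ next_depth (grow x p) u) = (\<Sum>u\<in>x. 2 ^ next_depth x u + (if u = p then 2 ^ next_depth x p else 0))"
      by (intro sum.cong) (auto simp: next_depth_grow[OF assms p])
    also have "\<dots> = depth_gen x + 2 ^ next_depth x p"
      using p grown_finite[OF assms] by (simp add: sum.distrib depth_gen_def)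
    finally show ?thesis
      using new new_node_notin[OF assms] grown_finite[OF assms] by (simp add: depth_gen_def[of "grow x p"])
  qed
  then show ?thesis by (simp add: depth_gen_def sum_distrib_left)
qed

text \<open>Of order \<open>n powr (- 3 / 2)\<close>, with sums that telescope. These are the weights for the martingale
increments.\<close>

definition sqrt_gap :: "nat \<Rightarrow> real" where
  "sqrt_gap n = 1 / sqrt (real n) - 1 / sqrt (real (Suc n))"

lemma sqrt_gap_lower:
  assumes "n \<ge> 1"
  shows "sqrt_gap n \<ge> 1 / (2 * real (Suc n) * sqrt (real (Suc n)))"
proof -
  have aux: "1 / (2 * (b * b) * b) \<le> 1 / a - 1 / b" if ab: "a > 0" "a \<le> b" "b * b - a * a = 1" for a b :: real
  proof -
    have "(b - a) * (b + a) = 1" using ab by (simp add: algebra_simps)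
    then have "b - a = 1 / (b + a)" using ab by (simp add: nonzero_eq_divide_eq)
    then have "1 / a - 1 / b = 1 / (b + a) / (a * b)" using ab by (simp add: diff_frac_eq)
    also have "\<dots> = 1 / (a * b * (b + a))" by (simp add: mult.commute)
    also have "\<dots> \<ge> 1 / (b * b * (b + b))"
      using ab by (intro divide_left_mono mult_mono mult_pos_pos) auto
    finally show ?thesis by (simp add: algebra_simps)
  qed
  show ?thesis
    using aux[of "sqrt (real n)" "sqrt (real (Suc n))"] assms by (simp add: sqrt_gap_def)
qed

context harris_process
begin

lemma expectation_depth_gen: "n \<ge> 1 \<Longrightarrow> expectation (\<lambda>\<omega>. depth_gen (X n \<omega>)) = real n * real (Suc n) / 2"
proof (induction n rule: dec_induct)
  case base
  have "expectation (\<lambda>\<omega>. depth_gen (X 1 \<omega>)) = expectation (\<lambda>\<omega>. 1)"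
  proof (rule integral_cong_AE)
    show "AE \<omega> in M. depth_gen (X 1 \<omega>) = 1"
      using AE_start by eventually_elim (simp add: depth_gen_def next_depth_def nchild_def)
    show "(\<lambda>\<omega>. depth_gen (X 1 \<omega>)) \<in> borel_measurable M" by (rule measurable_of_tree) auto
  qed simp
  then show ?case by (simp add: prob_space)
next
  case (step n)
  have "expectation (\<lambda>\<omega>. depth_gen (X (Suc n) \<omega>)) = (1 + 2 / real n) * expectation (\<lambda>\<omega>. depth_gen (X n \<omega>))"
    using step.hyps depth_gen_drift by (intro expectation_drift) (auto simp: grown_trees_def)
  also have "\<dots> = (1 + 2 / real n) * (real n * real (Suc n) / 2)" using step.IH by simp
  also have "\<dots> = (real n + 2) * real (Suc n) / 2" using step.hyps by (simp add: distrib_right)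
  finally show ?case by (simp add: mult.commute)
qed

text \<open>A martingale in the time \<open>n\<close>, for each fixed level \<open>k\<close>; the level 0 is that of the root.\<close>

definition martingale :: "nat \<Rightarrow> nat \<Rightarrow> 'a \<Rightarrow> real" where
  "martingale k n \<omega> = frontier_HPL k (X n \<omega>) / real n"

text \<open>The increment at \<open>p\<close> is that of \<open>frontier_HPL k\<close>, centered at its mean and divided by \<open>n + 1\<close>.
Its moment is compared with that of \<open>next_depth + H\<^sub>n\<close>, and then with \<open>depth_gen\<close>.\<close>

lemma increment_moment:
  fixes k :: nat
  assumes "n \<ge> 1" "m \<ge> 1"
  defines "D \<equiv> \<lambda>x p. frontier_HPL k (grow x p) / real (Suc n) - frontier_HPL k x / real n"
  shows "expectation (\<lambda>\<omega>. (\<Sum>p\<in>X n \<omega>. D (X n \<omega>) p ^ (2 * m)) / real n) \<le>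
    2 * 4 ^ m * (fact (2 * m) / ln 2 ^ (2 * m)) * real (Suc n) ^ 2 / real (Suc n) ^ (2 * m)"
proof -
  define c where "c = fact (2 * m) / ln (2::real) ^ (2 * m)"
  define N where "N = real (Suc n)"
  have c: "c \<ge> 0" by (simp add: c_def)
  have point: "(\<Sum>p\<in>x. D x p ^ (2 * m)) / real n \<le> 2 * 4 ^ m * c * 2 / N ^ (2 * m) * depth_gen x"
    if "x \<in> grown_trees n" for x
  proof -
    have x: "grown x" "card x = n" "finite x" "x \<noteq> {}"
      using that grown_finite grown_root by (auto simp: grown_trees_def)
    define d where "d = (\<lambda>p. frontier_HPL k (grow x p) - frontier_HPL k x)"
    have mean: "(\<Sum>p\<in>x. d p) / real (card x) = frontier_HPL k x / real n"
      using frontier_HPL_drift[OF x(1), of k] x(2) by (simp add: d_def)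
    have "D x p = (d p - frontier_HPL k x / real n) / N" for p
      using assms(1) by (simp add: D_def d_def N_def field_simps)
    then have "(\<Sum>p\<in>x. D x p ^ (2 * m)) = (\<Sum>p\<in>x. (d p - frontier_HPL k x / real n) ^ (2 * m)) / N ^ (2 * m)"
      by (simp add: power_divide sum_divide_distrib)
    also have "\<dots> \<le> (2 * 4 ^ m * (\<Sum>p\<in>x. d p ^ (2 * m))) / N ^ (2 * m)"
      using sum_centered_power_le[OF x(3,4) assms(2), of d] unfolding mean
      by (intro divide_right_mono) (auto simp: N_def)
    also have "(\<Sum>p\<in>x. d p ^ (2 * m)) \<le> (\<Sum>p\<in>x. c * (2 * real n) * 2 ^ next_depth x p)"
    proof (intro sum_mono)
      fix p assume p: "p \<in> x"
      have "d p ^ (2 * m) = \<bar>d p\<bar> ^ (2 * m)" by (simp add: power_even_abs)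
      also have "\<dots> \<le> (real (next_depth x p) + harm n) ^ (2 * m)"
        using frontier_HPL_increment[OF x(1) p, of k] x(2) by (intro power_mono) (auto simp: d_def)
      also have "\<dots> \<le> c * (2 * real n) * 2 ^ next_depth x p"
        using depth_harm_power_le[OF assms(1)] by (simp add: c_def)
      finally show "d p ^ (2 * m) \<le> c * (2 * real n) * 2 ^ next_depth x p" .
    qed
    also have "\<dots> = c * (2 * real n) * depth_gen x" by (simp add: depth_gen_def sum_distrib_left)
    finally have "(\<Sum>p\<in>x. D x p ^ (2 * m)) \<le> 2 * 4 ^ m * (c * (2 * real n) * depth_gen x) / N ^ (2 * m)"
      by (simp add: divide_right_mono N_def)
    then have "(\<Sum>p\<in>x. D x p ^ (2 * m)) / real n \<le> 2 * 4 ^ m * (c * (2 * real n) * depth_gen x) / N ^ (2 * m) / real n"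
      by (intro divide_right_mono) auto
    also have "\<dots> = 2 * 4 ^ m * c * 2 / N ^ (2 * m) * depth_gen x" using assms(1) by simp
    finally show ?thesis .
  qed
  have "expectation (\<lambda>\<omega>. (\<Sum>p\<in>X n \<omega>. D (X n \<omega>) p ^ (2 * m)) / real n) \<le>
      expectation (\<lambda>\<omega>. 2 * 4 ^ m * c * 2 / N ^ (2 * m) * depth_gen (X n \<omega>))"
    using AE_grown_trees[OF assms(1)] point
    by (intro integral_mono_AE integrable_of_tree[OF assms(1)]) (auto elim: eventually_mono)
  also have "\<dots> = 2 * 4 ^ m * c * 2 / N ^ (2 * m) * (real n * N / 2)"
    using expectation_depth_gen[OF assms(1)] by (simp add: N_def)
  also have "\<dots> = 2 * 4 ^ m * c * (real n * N) / N ^ (2 * m)" by simp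
  also have "\<dots> \<le> 2 * 4 ^ m * c * (N * N) / N ^ (2 * m)"
    using c by (intro divide_right_mono mult_left_mono mult_right_mono) (auto simp: N_def)
  finally show ?thesis by (simp add: c_def N_def power2_eq_square)
qed

lemma martingale_moment_step:
  assumes "1 \<le> a" "a \<le> n" "m \<ge> 1" "0 < l" "l \<le> 1"
  shows "expectation (\<lambda>\<omega>. (martingale k (Suc n) \<omega> - martingale k a \<omega>) ^ (2 * m)) \<le>
    (1 + 4 ^ m * l) * expectation (\<lambda>\<omega>. (martingale k n \<omega> - martingale k a \<omega>) ^ (2 * m)) +
    2 * 4 ^ m * (l / l ^ m) *
      (2 * 4 ^ m * (fact (2 * m) / ln 2 ^ (2 * m)) * real (Suc n) ^ 2 / real (Suc n) ^ (2 * m))"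
proof -
  have n: "n \<ge> 1" using assms by simp
  define D where "D = (\<lambda>x p. frontier_HPL k (grow x p) / real (Suc n) - frontier_HPL k x / real n)"
  define V where "V = (\<lambda>x. (\<Sum>p\<in>x. D x p ^ (2 * m)) / real n)"
  define S where "S = (\<lambda>s x. frontier_HPL k x / real n - frontier_HPL k s / real a)"
  let ?T = "\<lambda>\<omega> p. (frontier_HPL k (grow (X n \<omega>) p) / real (Suc n) - frontier_HPL k (X a \<omega>) / real a) ^ (2 * m)"
  have "expectation (\<lambda>\<omega>. (martingale k (Suc n) \<omega> - martingale k a \<omega>) ^ (2 * m)) =
      expectation (\<lambda>\<omega>. (\<Sum>p\<in>X n \<omega>. ?T \<omega> p) / real n)"
    unfolding martingale_def
    using expectation_step(2)[OF assms(1,2), of "\<lambda>s x y. (frontier_HPL k y / real (Suc n) - frontier_HPL k s / real a) ^ (2 * m)"] .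
  also have "\<dots> \<le> expectation (\<lambda>\<omega>. (1 + 4 ^ m * l) * S (X a \<omega>) (X n \<omega>) ^ (2 * m) + 2 * 4 ^ m * (l / l ^ m) * V (X n \<omega>))"
  proof (rule integral_mono_AE)
    show "AE \<omega> in M. (\<Sum>p\<in>X n \<omega>. ?T \<omega> p) / real n
      \<le> (1 + 4 ^ m * l) * S (X a \<omega>) (X n \<omega>) ^ (2 * m) + 2 * 4 ^ m * (l / l ^ m) * V (X n \<omega>)"
      using AE_grown_trees[OF n]
    proof eventually_elim
      case (elim \<omega>)
      define x s where "x = X n \<omega>" and "s = X a \<omega>"
      have x: "grown x" "card x = n" "finite x" "x \<noteq> {}"
        using elim grown_finite grown_root by (auto simp: x_def grown_trees_def)
      have D: "frontier_HPL k (grow x p) / real (Suc n) - frontier_HPL k s / real a = S s x + D x p" for p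
        by (simp add: S_def D_def)
      have "(\<Sum>p\<in>x. frontier_HPL k (grow x p)) = (1 + real n) * frontier_HPL k x"
        using frontier_HPL_drift[OF x(1), of k] x(2) by (simp add: sum_subtractf algebra_simps)
      then have "(\<Sum>p\<in>x. D x p) = 0"
        using n x(2) by (simp add: D_def sum_subtractf flip: sum_divide_distrib)
      from mean_even_power_shift_le[OF x(3,4) this assms(4,5,3), of "S s x"]
      show ?case unfolding x_def[symmetric] s_def[symmetric] D V_def x(2) .
    qed
  next
    show "integrable M (\<lambda>\<omega>. (\<Sum>p\<in>X n \<omega>. ?T \<omega> p) / real n)"
      using expectation_pair(1)[OF assms(1) n, of "\<lambda>s x. (\<Sum>p\<in>x. (frontier_HPL k (grow x p) / real (Suc n) - frontier_HPL k s / real a) ^ (2 * m)) / real n"] .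
    show "integrable M (\<lambda>\<omega>. (1 + 4 ^ m * l) * S (X a \<omega>) (X n \<omega>) ^ (2 * m) + 2 * 4 ^ m * (l / l ^ m) * V (X n \<omega>))"
      using expectation_pair(1)[OF assms(1) n, of "\<lambda>s x. (1 + 4 ^ m * l) * S s x ^ (2 * m) + 2 * 4 ^ m * (l / l ^ m) * V x"] .
  qed
  also have "\<dots> = (1 + 4 ^ m * l) * expectation (\<lambda>\<omega>. S (X a \<omega>) (X n \<omega>) ^ (2 * m)) +
      2 * 4 ^ m * (l / l ^ m) * expectation (\<lambda>\<omega>. V (X n \<omega>))"
    using expectation_pair(1)[OF assms(1) n, of "\<lambda>s x. S s x ^ (2 * m)"] integrable_of_tree[OF n, of V]
    by (subst Bochner_Integration.integral_add) auto
  also have "\<dots> \<le> (1 + 4 ^ m * l) * expectation (\<lambda>\<omega>. S (X a \<omega>) (X n \<omega>) ^ (2 * m)) +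
    2 * 4 ^ m * (l / l ^ m) *
      (2 * 4 ^ m * (fact (2 * m) / ln 2 ^ (2 * m)) * real (Suc n) ^ 2 / real (Suc n) ^ (2 * m))"
    using increment_moment[OF n assms(3), of k] assms(4)
    by (intro add_left_mono mult_left_mono) (auto simp: V_def D_def)
  finally show ?thesis by (simp add: martingale_def S_def)
qed

proposition martingale_moment:
  assumes "q \<ge> 2"
  obtains K where "K \<ge> 0" "\<And>k a n. 1 \<le> a \<Longrightarrow> a \<le> n \<Longrightarrow>
    expectation (\<lambda>\<omega>. (martingale k n \<omega> - martingale k a \<omega>) ^ (4 * q)) \<le> K / real a ^ q"
proof -
  define m where "m = 2 * q"
  have m: "m \<ge> 1" "2 * m = 4 * q" using assms by (auto simp: m_def)
  define C where "C = (4::real) ^ m"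
  define c where "c = 2 * C * (fact (2 * m) / ln (2::real) ^ (2 * m))"
  have C: "C > 0" "c \<ge> 0" by (auto simp: C_def c_def)
  define B where "B = (\<lambda>a. 2 * c * 2 ^ m / real a ^ q)"
  \<comment> \<open>Adding \<open>B a\<close> makes the recursion for the moments homogeneous, with factors \<open>1 + C * l\<close>.\<close>
  have main: "expectation (\<lambda>\<omega>. (martingale k n \<omega> - martingale k a \<omega>) ^ (2 * m)) + B a \<le>
      B a * exp (C * (\<Sum>i=a..<n. sqrt (real a) * sqrt_gap i))" if a: "1 \<le> a" "a \<le> n" for k a n
    using a(2)
  proof (induction n rule: dec_induct)
    case base
    show ?case using m by (simp add: zero_power)
  next
    case (step n)
    define l where "l = sqrt (real a) * sqrt_gap n"
    define t where "t = real (Suc n)"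
    have t: "t \<ge> 1" by (simp add: t_def)
    have n: "n \<ge> 1" using step a by simp
    have B: "B a \<ge> 0" using C by (simp add: B_def)
    have g: "sqrt_gap n \<ge> 1 / (2 * t * sqrt t)" using sqrt_gap_lower[OF n] by (simp add: t_def)
    moreover have "1 / (2 * t * sqrt t) > 0" using t by simp
    ultimately have gpos: "sqrt_gap n > 0" by linarith
    have l: "l > 0" using gpos a by (simp add: l_def)
    have "sqrt (real a) * sqrt_gap n \<le> sqrt (real a) * (1 / sqrt (real n))"
      by (intro mult_left_mono) (auto simp: sqrt_gap_def)
    also have "\<dots> \<le> 1" using step n by simp
    finally have l1: "l \<le> 1" by (simp add: l_def)
    \<comment> \<open>Comparison of the powers of \<open>t = n + 1\<close>: \<open>2 + 3 * q \<le> 4 * q\<close>.\<close>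
    have "1 / (4 ^ q * t ^ (3 * q)) = (1 / (2 * t * sqrt t)) ^ m"
    proof -
      have sq: "(2 * t * sqrt t) ^ 2 = 4 * t ^ 3"
        using t by (simp add: power_mult_distrib) (simp add: eval_nat_numeral)
      then show ?thesis unfolding m_def power_mult power_divide sq by (simp add: power_mult_distrib)
    qed
    also have "\<dots> \<le> sqrt_gap n ^ m" using g t by (intro power_mono) auto
    finally have gm: "1 / (4 ^ q * t ^ (3 * q)) \<le> sqrt_gap n ^ m" .
    have "c * t ^ 2 / t ^ (2 * m) \<le> c * 4 ^ q * sqrt_gap n ^ m"
    proof -
      have "t ^ 2 * t ^ (3 * q) \<le> t ^ (2 * m)"
        using t assms unfolding m(2) power_add[symmetric] by (intro power_increasing) auto
      then have "t ^ 2 / t ^ (2 * m) \<le> 1 / t ^ (3 * q)" using t by (simp add: field_simps)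
      also have "\<dots> = 4 ^ q * (1 / (4 ^ q * t ^ (3 * q)))" by simp
      also have "\<dots> \<le> 4 ^ q * sqrt_gap n ^ m" using gm by (intro mult_left_mono) auto
      finally show ?thesis using C(2) by (simp add: mult_left_mono mult.assoc flip: times_divide_eq_right)
    qed
    then have "2 * C * (l / l ^ m) * (c * t ^ 2 / t ^ (2 * m)) \<le> 2 * C * (l / l ^ m) * (c * 4 ^ q * sqrt_gap n ^ m)"
      using l C by (intro mult_left_mono) auto
    also have "\<dots> = C * l * B a"
    proof -
      have "l ^ m = real a ^ q * sqrt_gap n ^ m"
        by (simp add: l_def power_mult_distrib m_def power_mult)
      moreover have "(4::real) ^ q = 2 ^ m" by (simp add: m_def power_mult)
      ultimately show ?thesis using gpos a by (simp add: B_def field_simps)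
    qed
    finally have tail: "2 * C * (l / l ^ m) * (c * t ^ 2 / t ^ (2 * m)) \<le> C * l * B a" .
    define A where "A = (\<lambda>j. expectation (\<lambda>\<omega>. (martingale k j \<omega> - martingale k a \<omega>) ^ (2 * m)))"
    have "A (Suc n) \<le> (1 + C * l) * A n + 2 * C * (l / l ^ m) * (c * t ^ 2 / t ^ (2 * m))"
      using martingale_moment_step[OF a(1) step.hyps(1) m(1) l l1, of k]
      by (simp add: A_def C_def c_def t_def)
    then have "A (Suc n) + B a \<le> (1 + C * l) * (A n + B a)"
      using tail by (simp add: algebra_simps)
    also have "\<dots> \<le> exp (C * l) * (A n + B a)"
    proof (intro mult_right_mono)
      show "A n + B a \<ge> 0" unfolding A_def using B
        by (intro add_nonneg_nonneg integral_nonneg_AE) (auto simp: power_mult)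
    qed (rule exp_ge_add_one_self)
    also have "\<dots> \<le> exp (C * l) * (B a * exp (C * (\<Sum>i=a..<n. sqrt (real a) * sqrt_gap i)))"
      using step.IH by (intro mult_left_mono) (auto simp: A_def)
    also have "\<dots> = B a * exp (C * (\<Sum>i=a..<Suc n. sqrt (real a) * sqrt_gap i))"
      using step.hyps by (simp add: l_def exp_add[symmetric] algebra_simps)
    finally show ?case by (simp add: A_def)
  qed
  have tele: "(\<Sum>i=a..<n. sqrt (real a) * sqrt_gap i) \<le> 1" if "1 \<le> a" "a \<le> n" for a n
  proof -
    have "(\<Sum>i=a..<n. sqrt_gap i) = 1 / sqrt (real a) - 1 / sqrt (real n)"
      using that(2) sum_Suc_diff'[of a n "\<lambda>i. - 1 / sqrt (real i)"] by (simp add: sqrt_gap_def)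
    then have "sqrt (real a) * (\<Sum>i=a..<n. sqrt_gap i) \<le> sqrt (real a) * (1 / sqrt (real a))"
      by (intro mult_left_mono) auto
    then show ?thesis using that(1) by (simp add: sum_distrib_left)
  qed
  show ?thesis
  proof (rule that[of "2 * c * 2 ^ m * exp C"])
    show "0 \<le> 2 * c * 2 ^ m * exp C" using C by simp
    fix k a n :: nat assume a: "1 \<le> a" "a \<le> n"
    have "expectation (\<lambda>\<omega>. (martingale k n \<omega> - martingale k a \<omega>) ^ (4 * q)) \<le>
        B a * exp (C * (\<Sum>i=a..<n. sqrt (real a) * sqrt_gap i)) - B a"
      using main[OF a, of k] m(2) by simp
    also have "\<dots> \<le> B a * exp (C * (\<Sum>i=a..<n. sqrt (real a) * sqrt_gap i))" using C by (simp add: B_def)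
    also have "\<dots> \<le> B a * exp (C * 1)"
      using tele[OF a] C by (intro mult_left_mono) (auto simp: B_def)
    finally show "expectation (\<lambda>\<omega>. (martingale k n \<omega> - martingale k a \<omega>) ^ (4 * q)) \<le> 2 * c * 2 ^ m * exp C / real a ^ q"
      by (simp add: B_def)
  qed
qed

end


section \<open>Geometric decay of the siblings\<close>

definition later :: "nat list set \<Rightarrow> nat list \<Rightarrow> nat \<Rightarrow> nat" where
  "later x u i = card {p \<in> x. \<exists>j>i. prefix (u @ [j]) p}"

lemma below_eq_card:
  assumes "grown x" shows "below x u = card {p \<in> x. prefix u p}"
proof -
  have "(@) u ` subtree x u = {p \<in> x. prefix u p}"
    using assms by (auto simp: subtree_grown prefix_def)
  moreover have "inj_on ((@) u) (subtree x u)" by (auto simp: inj_on_def)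
  ultimately show ?thesis unfolding below_def using card_image by fastforce
qed

lemma prefix_sibling: "prefix (u @ [i]) p \<Longrightarrow> prefix (u @ [j]) p \<Longrightarrow> i = j"
  by (auto simp: prefix_def)

lemma later_rec:
  assumes "grown x"
  shows "later x u i = below x (u @ [Suc i]) + later x u (Suc i)"
proof -
  have "{p \<in> x. \<exists>j>i. prefix (u @ [j]) p} =
      {p \<in> x. prefix (u @ [Suc i]) p} \<union> {p \<in> x. \<exists>j>Suc i. prefix (u @ [j]) p}"
    by (auto dest: Suc_lessI intro: Suc_lessD)
  moreover have "{p \<in> x. prefix (u @ [Suc i]) p} \<inter> {p \<in> x. \<exists>j>Suc i. prefix (u @ [j]) p} = {}"
    using prefix_sibling by fastforce
  ultimately show ?thesis
    using grown_finite[OF assms] by (simp add: later_def below_eq_card[OF assms] card_Un_disjoint)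
qed

lemma later_zero:
  assumes "grown x" "u @ [Suc i] \<notin> x"
  shows "later x u i = 0"
proof -
  have "\<not> prefix (u @ [j]) p" if "p \<in> x" "j > i" for p j
  proof
    assume "prefix (u @ [j]) p"
    then have "u @ [j] \<in> x" using that grown_prefix[OF assms(1)] by (auto simp: prefix_def)
    then show False using assms that grown_child_iff[OF assms(1), of u] by auto
  qed
  then have "{p \<in> x. \<exists>j>i. prefix (u @ [j]) p} = {}" by blast
  then show ?thesis by (simp only: later_def card.empty)
qed

lemma later_le_card: "grown x \<Longrightarrow> later x u i \<le> card x"
  using grown_finite by (auto simp: later_def intro: card_mono)

lemma below_rec:
  assumes "grown x"
  shows "below x u = (if u \<in> x then 1 else 0) + later x u 0"
proof (cases "u \<in> x")
  case True
  have "{p \<in> x. prefix u p} = insert u {p \<in> x. \<exists>j>0. prefix (u @ [j]) p}"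
  proof (intro equalityI subsetI)
    fix p assume p: "p \<in> {p \<in> x. prefix u p}"
    then obtain v where v: "p = u @ v" by (auto simp: prefix_def)
    show "p \<in> insert u {p \<in> x. \<exists>j>0. prefix (u @ [j]) p}"
    proof (cases v)
      case (Cons j w)
      then have "u @ [j] \<in> x" using p v grown_prefix[OF assms, of "u @ [j]" w] by simp
      then have "j > 0" using grown_child_iff[OF assms] by force
      then show ?thesis using p v Cons by auto
    qed (use v in simp)
  qed (use True in \<open>auto simp: prefix_def\<close>)
  moreover have "u \<notin> {p \<in> x. \<exists>j>0. prefix (u @ [j]) p}" by (auto simp: prefix_def)
  ultimately show ?thesis
    using True grown_finite[OF assms] by (simp add: below_eq_card[OF assms] later_def)
next
  case False
  then have "u @ [Suc 0] \<notin> x" using grown_child_iff[OF assms, of u "Suc 0"] by simp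
  then have "later x u 0 = 0" by (rule later_zero[OF assms])
  moreover have "\<not> below x u > 0" using below_pos_iff[OF assms, of u] False by simp
  ultimately show ?thesis using False by simp
qed

lemma below_sum_later:
  assumes "grown x"
  shows "below x u = (if u \<in> x then 1 else 0) + (\<Sum>i<l. below x (u @ [Suc i])) + later x u l"
proof (induction l)
  case 0
  then show ?case using below_rec[OF assms, of u] by simp
next
  case (Suc l)
  then show ?case using later_rec[OF assms, of u l] by simp
qed

lemma below_child_le: "grown x \<Longrightarrow> below x (u @ [i]) \<le> below x u"
  using grown_finite by (auto simp: below_eq_card prefix_def intro!: card_mono)

text \<open>The subtree at the next child \<open>i + 1\<close> of \<open>u\<close> grows at each of its nodes; the subtrees at the
later children grow at each of their nodes and at \<open>u\<close>. Counting \<open>u\<close> on the later side, both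
sides start with one place of growth when child \<open>i + 1\<close> is born, and then form a fair Polya urn;
this is the difference of its colours.\<close>

definition sibling_lead :: "nat list \<Rightarrow> nat \<Rightarrow> nat list set \<Rightarrow> real" where
  "sibling_lead u i x = (if u @ [Suc i] \<in> x then real (below x (u @ [Suc i])) - real (later x u (Suc i)) - 1 else 0)"

text \<open>Each side grows at a rate proportional to its number of places, so the difference has a linear
drift. At the birth of the child it is \<open>1 - 0 - 1 = 0\<close>.\<close>

lemma sibling_lead_drift:
  assumes "grown x"
  shows "(\<Sum>p\<in>x. sibling_lead u i (grow x p) - sibling_lead u i x) = sibling_lead u i x"
proof (cases "u @ [Suc i] \<in> x")
  case True
  have fin: "finite x" using grown_finite assms by simp
  have u: "u \<in> x" "Suc i \<le> nchild x u" using True grown_child_iff[OF assms, of u "Suc i"] by auto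
  have new: "prefix (u @ [j]) (new_node x p) \<longleftrightarrow> prefix (u @ [j]) p \<or> u = p \<and> j = Suc (nchild x p)" for j p
    by (auto simp: new_node_def prefix_snoc)
  have each: "sibling_lead u i (grow x p) - sibling_lead u i x =
      (if prefix (u @ [Suc i]) p then 1 else 0) - (if \<exists>j>Suc i. prefix (u @ [j]) p then 1 else 0) - (if p = u then 1 else 0)"
    if p: "p \<in> x" for p
  proof -
    note g = grown.step[OF assms p]
    have notin: "new_node x p \<notin> x" by (rule new_node_notin[OF assms])
    have a: "{q \<in> grow x p. prefix (u @ [Suc i]) q} =
        (if prefix (u @ [Suc i]) p then insert (new_node x p) else id) {q \<in> x. prefix (u @ [Suc i]) q}"
      using new[of "Suc i" p] u by auto
    have b: "{q \<in> grow x p. \<exists>j>Suc i. prefix (u @ [j]) q} =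
        (if (\<exists>j>Suc i. prefix (u @ [j]) p) \<or> p = u then insert (new_node x p) else id) {q \<in> x. \<exists>j>Suc i. prefix (u @ [j]) q}"
      using new[of _ p] u by auto
    \<comment> \<open>The node \<open>u\<close> counts for the later children, but is not one of their descendants.\<close>
    have c: "\<not> (\<exists>j>Suc i. prefix (u @ [j]) u)" by (auto simp: prefix_def)
    have a': "below (grow x p) (u @ [Suc i]) = below x (u @ [Suc i]) + (if prefix (u @ [Suc i]) p then 1 else 0)"
      unfolding below_eq_card[OF assms] below_eq_card[OF g] a using fin notin by simp
    have b': "later (grow x p) u (Suc i) = later x u (Suc i) +
        (if (\<exists>j>Suc i. prefix (u @ [j]) p) then 1 else 0) + (if p = u then 1 else 0)"
      unfolding later_def b using fin notin c by auto
    show ?thesis using True by (auto simp: sibling_lead_def a' b')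
  qed
  have "(\<Sum>p\<in>x. sibling_lead u i (grow x p) - sibling_lead u i x) =
      (\<Sum>p\<in>x. if prefix (u @ [Suc i]) p then 1 else 0) - (\<Sum>p\<in>x. if \<exists>j>Suc i. prefix (u @ [j]) p then 1 else 0)
      - (\<Sum>p\<in>x. if p = u then 1 else 0)"
    by (simp add: each sum_subtractf)
  also have "\<dots> = sibling_lead u i x"
    using fin u True by (simp add: sum.If_cases sibling_lead_def below_eq_card[OF assms] later_def Int_def)
  finally show ?thesis .
next
  case False
  have "sibling_lead u i (grow x p) = 0" if p: "p \<in> x" for p
  proof (cases "u @ [Suc i] \<in> grow x p")
    case True
    note g = grown.step[OF assms p]
    have eq: "u @ [Suc i] = new_node x p" using True False by simp
    then have "u = p" "i = nchild x p" by (auto simp: new_node_def)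
    then have "u @ [Suc (Suc i)] \<notin> grow x p"
      using grown_child_iff[OF g, of u "Suc (Suc i)"] nchild_grow[OF assms p, of u] by simp
    then have "later (grow x p) u (Suc i) = 0" by (rule later_zero[OF g])
    moreover have "below (grow x p) (u @ [Suc i]) = 1"
      by (simp add: eq below_def subtree_grow_new[OF assms p])
    ultimately show ?thesis by (simp add: sibling_lead_def)
  qed (simp add: sibling_lead_def)
  then show ?thesis using False by (simp add: sibling_lead_def)
qed

lemma sibling_lead_le:
  assumes "grown x" shows "sibling_lead u i x \<le> real (below x (u @ [Suc i])) - real (later x u (Suc i))"
proof (cases "u @ [Suc i] \<in> x")
  case False
  then have "later x u (Suc i) = 0" using later_zero[OF assms False] later_rec[OF assms, of u i] by simp
  then show ?thesis using False by (simp add: sibling_lead_def)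
qed (simp add: sibling_lead_def)

context harris_process
begin

lemma AE_grown: "n \<ge> 1 \<Longrightarrow> AE \<omega> in M. grown (X n \<omega>) \<and> card (X n \<omega>) = n"
  using AE_grown_trees[of n] by (auto simp: grown_trees_def)

lemma expectation_sibling_lead: "n \<ge> 1 \<Longrightarrow> expectation (\<lambda>\<omega>. sibling_lead u i (X n \<omega>)) = 0"
proof (induction n rule: dec_induct)
  case base
  have "expectation (\<lambda>\<omega>. sibling_lead u i (X 1 \<omega>)) = expectation (\<lambda>\<omega>. 0)"
  proof (rule integral_cong_AE)
    show "AE \<omega> in M. sibling_lead u i (X 1 \<omega>) = 0"
      using AE_start by eventually_elim (simp add: sibling_lead_def)
    show "(\<lambda>\<omega>. sibling_lead u i (X 1 \<omega>)) \<in> borel_measurable M" by (rule measurable_of_tree) auto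
  qed simp
  then show ?case by simp
next
  case (step n)
  have "expectation (\<lambda>\<omega>. sibling_lead u i (X (Suc n) \<omega>)) = (1 + 1 / real n) * expectation (\<lambda>\<omega>. sibling_lead u i (X n \<omega>))"
    using step.hyps sibling_lead_drift by (intro expectation_drift) (auto simp: grown_trees_def)
  then show ?case using step by simp
qed

text \<open>As the urn is fair, the later children get in the mean at most half of what is left after the
\<open>i\<close>-th child.\<close>

lemma expectation_later: "n \<ge> 1 \<Longrightarrow> expectation (\<lambda>\<omega>. real (later (X n \<omega>) u i) / real n) \<le> 1 / 2 ^ i"
proof (induction i)
  case 0
  have "expectation (\<lambda>\<omega>. real (later (X n \<omega>) u 0) / real n) \<le> expectation (\<lambda>\<omega>. 1)"
  proof (rule integral_mono_AE)
    show "integrable M (\<lambda>\<omega>. real (later (X n \<omega>) u 0) / real n)" using 0 by (intro integrable_of_tree)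
    show "AE \<omega> in M. real (later (X n \<omega>) u 0) / real n \<le> 1"
      using AE_grown[OF 0] by eventually_elim (use 0 later_le_card in fastforce)
  qed simp
  then show ?case by (simp add: prob_space)
next
  case (Suc i)
  have int: "integrable M (\<lambda>\<omega>. f (X n \<omega>) :: real)" for f using Suc.prems by (rule integrable_of_tree)
  have "0 \<le> expectation (\<lambda>\<omega>. real (below (X n \<omega>) (u @ [Suc i])) - real (later (X n \<omega>) u (Suc i)))"
    unfolding expectation_sibling_lead[OF Suc.prems, of u i, symmetric]
    using AE_grown[OF Suc.prems] sibling_lead_le by (intro integral_mono_AE int) (auto elim!: eventually_mono)
  then have "expectation (\<lambda>\<omega>. real (later (X n \<omega>) u (Suc i))) \<le> expectation (\<lambda>\<omega>. real (below (X n \<omega>) (u @ [Suc i])))"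
    using int[of "\<lambda>x. real (below x (u @ [Suc i]))"] int[of "\<lambda>x. real (later x u (Suc i))"]
    by simp
  moreover have "expectation (\<lambda>\<omega>. real (later (X n \<omega>) u i)) =
      expectation (\<lambda>\<omega>. real (below (X n \<omega>) (u @ [Suc i])) + real (later (X n \<omega>) u (Suc i)))"
  proof (rule integral_cong_AE)
    show "AE \<omega> in M. real (later (X n \<omega>) u i) =
        real (below (X n \<omega>) (u @ [Suc i])) + real (later (X n \<omega>) u (Suc i))"
      using AE_grown[OF Suc.prems]
    proof eventually_elim
      case (elim \<omega>)
      then show ?case using later_rec[of "X n \<omega>" u i] by simp
    qed
  qed (use int[of "\<lambda>x. real (later x u i)"] int[of "\<lambda>x. real (below x (u @ [Suc i])) + real (later x u (Suc i))"] in auto)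
  ultimately have "2 * expectation (\<lambda>\<omega>. real (later (X n \<omega>) u (Suc i))) \<le> expectation (\<lambda>\<omega>. real (later (X n \<omega>) u i))"
    using int[of "\<lambda>x. real (below x (u @ [Suc i]))"] int[of "\<lambda>x. real (later x u (Suc i))"]
    by simp
  then have "2 * (expectation (\<lambda>\<omega>. real (later (X n \<omega>) u (Suc i))) / real n) \<le>
      expectation (\<lambda>\<omega>. real (later (X n \<omega>) u i)) / real n"
    by (simp add: divide_right_mono)
  then show ?case using Suc by simp
qed

end

section \<open>Path length as a sum of tolls\<close>

text \<open>The contribution of the pair of \<open>u\<close> and its child \<open>i + 1\<close> to the centered path length,
normalized by the number of nodes. The first term comes from the horizontal step of size \<open>i\<close>,
the second one from the difference of the means, and the third one from the constant 1 in
\<open>mean_HPL\<close>.\<close>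

definition toll :: "nat list \<Rightarrow> nat \<Rightarrow> nat list set \<Rightarrow> real" where
  "toll u i x = (real i * real (below x (u @ [Suc i]))
     - real (below x (u @ [Suc i])) * (harm (below x u) - harm (below x (u @ [Suc i])))
     + (if u @ [Suc i] \<in> x then 1 else 0)) / real (card x)"

text \<open>What remains of the centering at \<open>u\<close> itself. It is of order \<open>ln n / n\<close>.\<close>

definition toll_error :: "nat list \<Rightarrow> nat list set \<Rightarrow> real" where
  "toll_error u x = (if u \<in> x then (1 - harm (below x u)) / real (card x) else 0)"

definition level :: "nat \<Rightarrow> nat list set" where
  "level k = {u. u \<in> nodes \<and> sum_list u \<le> k}"

lemma toll_outside:
  assumes "grown x" "u @ [Suc i] \<notin> x" shows "toll u i x = 0"
  using below_pos_iff[OF assms(1), of "u @ [Suc i]"] assms(2) by (simp add: toll_def)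

lemma toll_finite_support:
  assumes "grown x" "i \<ge> nchild x u"
  shows "toll u i x = 0"
  using assms grown_child_iff[OF assms(1), of u "Suc i"] by (intro toll_outside) auto

text \<open>The path length and the size of a subtree decompose over the children. In the difference of the
centerings the sizes cancel, because the subtrees of the children fill the one at \<open>u\<close> up to the
node \<open>u\<close>.\<close>

lemma centered_HPL_split:
  assumes "grown x" "u \<in> x"
  shows "(centered_HPL x u - (\<Sum>i=1..nchild x u. centered_HPL x (u @ [i]))) / real (card x) =
    (\<Sum>i<nchild x u. toll u i x) + toll_error u x"
proof -
  define c where "c = nchild x u"
  define L where "L = real (below x u)"
  define H where "H = (harm (below x u) :: real)"
  define a where "a = (\<lambda>i. real (below x (u @ [i])))"
  define h where "h = (\<lambda>i. harm (below x (u @ [i])) :: real)"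
  have child: "u @ [i] \<in> x" if "i \<in> {1..c}" for i
    using that assms grown_child_iff[OF assms(1), of u i] by (simp add: c_def)
  have L: "L = 1 + (\<Sum>i=1..c. a i)" using below_children[OF assms] by (simp add: L_def a_def c_def)
  have "(\<Sum>i=1..c. centered_HPL x (u @ [i])) = (\<Sum>i=1..c. HPL (subtree x (u @ [i])) - (a i * h i - 2 * a i + 1))"
    using child by (intro sum.cong) (auto simp: centered_HPL_def mean_HPL_def a_def h_def)
  moreover have "centered_HPL x u = (\<Sum>i=1..c. real (i - 1) * a i + HPL (subtree x (u @ [i]))) - (L * H - 2 * L + 1)"
    using HPL_subtree[OF assms] assms(2) by (simp add: centered_HPL_def mean_HPL_def a_def c_def L_def H_def)
  ultimately have "centered_HPL x u - (\<Sum>i=1..c. centered_HPL x (u @ [i])) =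
      (\<Sum>i=1..c. real (i - 1) * a i + a i * h i - 2 * a i + 1) - (L * H - 2 * L + 1)"
    by (simp add: sum.distrib sum_subtractf)
  also have "\<dots> = (\<Sum>i=1..c. real (i - 1) * a i - a i * (H - h i) + 1) + (1 - H)"
    unfolding L by (simp add: sum.distrib sum_subtractf sum_distrib_left[symmetric] sum_distrib_right[symmetric] algebra_simps)
  also have "(\<Sum>i=1..c. real (i - 1) * a i - a i * (H - h i) + 1) =
      (\<Sum>i<c. real i * a (Suc i) - a (Suc i) * (H - h (Suc i)) + 1)"
    by (rule sum.reindex_bij_witness[of _ Suc "\<lambda>i. i - 1"]) auto
  finally have "centered_HPL x u - (\<Sum>i=1..c. centered_HPL x (u @ [i])) =
      (\<Sum>i<c. real i * a (Suc i) - a (Suc i) * (H - h (Suc i)) + 1) + (1 - H)" .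
  moreover have "(\<Sum>i<c. toll u i x) = (\<Sum>i<c. real i * a (Suc i) - a (Suc i) * (H - h (Suc i)) + 1) / real (card x)"
    using child by (auto simp: toll_def a_def h_def H_def sum_divide_distrib intro!: sum.cong)
  ultimately show ?thesis
    using assms(2) by (simp add: toll_error_def c_def[symmetric] H_def[symmetric] add_divide_distrib)
qed

text \<open>The nodes up to level \<open>k\<close> together with the frontier of level \<open>k + 1\<close> are exactly the root and
the children of the nodes up to level \<open>k\<close>.\<close>

lemma centered_HPL_telescope:
  assumes "grown x"
  shows "frontier_HPL 0 x - frontier_HPL (Suc k) x =
    (\<Sum>u\<in>level k \<inter> x. centered_HPL x u - (\<Sum>i=1..nchild x u. centered_HPL x (u @ [i])))"
proof -
  have fin: "finite x" using grown_finite assms by simp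
  define A where "A = level k \<inter> x"
  define B where "B = frontier (Suc k) \<inter> x"
  define T where "T = (\<lambda>u. (\<lambda>i. u @ [i]) ` {1..nchild x u})"
  have nodes: "x \<subseteq> nodes" using grown_nodes[OF assms] .
  have "A \<union> B = insert [] (\<Union>u\<in>A. T u)"
  proof (intro equalityI subsetI)
    fix w assume w: "w \<in> A \<union> B"
    then have wx: "w \<in> x" by (auto simp: A_def B_def)
    show "w \<in> insert [] (\<Union>u\<in>A. T u)"
    proof (cases w rule: rev_cases)
      case (snoc u i)
      then have "sum_list u \<le> k" using w by (auto simp: A_def B_def level_def frontier_def)
      moreover have "u \<in> x" "i \<in> {1..nchild x u}" using wx snoc grown_child_iff[OF assms, of u i] by auto
      ultimately have "u \<in> A" "w \<in> T u" using snoc nodes by (auto simp: A_def level_def T_def)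
      then show ?thesis by blast
    qed simp
  next
    fix w assume "w \<in> insert [] (\<Union>u\<in>A. T u)"
    then consider "w = []" | u i where "w = u @ [i]" "u \<in> A" "i \<in> {1..nchild x u}" by (auto simp: T_def)
    then show "w \<in> A \<union> B"
    proof cases
      case 1
      then show ?thesis using grown_root[OF assms] by (auto simp: A_def level_def nodes_def)
    next
      case 2
      then have "w \<in> x" using grown_child_iff[OF assms, of u i] by (auto simp: A_def)
      then show ?thesis using 2 nodes by (auto simp: A_def B_def level_def frontier_def)
    qed
  qed
  moreover have "A \<inter> B = {}" by (auto simp: A_def B_def level_def frontier_def)
  moreover have finAB: "finite A" "finite B" using fin by (auto simp: A_def B_def)
  ultimately have "(\<Sum>w\<in>A. centered_HPL x w) + (\<Sum>w\<in>B. centered_HPL x w) = (\<Sum>w\<in>insert [] (\<Union>u\<in>A. T u). centered_HPL x w)"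
    by (simp flip: sum.union_disjoint)
  also have "\<dots> = centered_HPL x [] + (\<Sum>w\<in>(\<Union>u\<in>A. T u). centered_HPL x w)"
    using finAB by (subst sum.insert) (auto simp: T_def)
  also have "(\<Sum>w\<in>(\<Union>u\<in>A. T u). centered_HPL x w) = (\<Sum>u\<in>A. \<Sum>w\<in>T u. centered_HPL x w)"
    using finAB by (intro sum.UNION_disjoint) (auto simp: T_def)
  also have "\<dots> = (\<Sum>u\<in>A. \<Sum>i=1..nchild x u. centered_HPL x (u @ [i]))"
    unfolding T_def by (intro sum.cong refl trans[OF sum.reindex]) (auto simp: inj_on_def)
  finally have "frontier_HPL (Suc k) x + (\<Sum>w\<in>A. centered_HPL x w) = centered_HPL x [] + (\<Sum>u\<in>A. \<Sum>i=1..nchild x u. centered_HPL x (u @ [i]))"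
    by (simp add: frontier_HPL_def B_def)
  moreover have "centered_HPL x [] = frontier_HPL 0 x"
    using grown_root[OF assms] by (simp add: frontier_HPL_0[OF assms] centered_HPL_def subtree_Nil[OF assms] below_Nil[OF assms])
  ultimately show ?thesis by (simp add: sum_subtractf A_def)
qed

lemma finite_level: "finite (level k)"
  unfolding level_def by (rule finite_partial_sum_index)

proposition frontier_HPL_toll:
  assumes "grown x"
  shows "(frontier_HPL 0 x - frontier_HPL (Suc k) x) / real (card x) = (\<Sum>u\<in>level k. (\<Sum>i. toll u i x) + toll_error u x)"
proof -
  have series: "(\<Sum>i. toll u i x) = (\<Sum>i<nchild x u. toll u i x)" for u
    using toll_finite_support[OF assms] by (intro suminf_finite) auto
  have out: "(\<Sum>i. toll u i x) + toll_error u x = 0" if "u \<notin> x" for u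
    using that nchild_notin[OF assms that] by (simp add: series toll_error_def)
  have "(frontier_HPL 0 x - frontier_HPL (Suc k) x) / real (card x) =
      (\<Sum>u\<in>level k \<inter> x. (\<Sum>i<nchild x u. toll u i x) + toll_error u x)"
    unfolding centered_HPL_telescope[OF assms] sum_divide_distrib
    using centered_HPL_split[OF assms] by (intro sum.cong) auto
  also have "\<dots> = (\<Sum>u\<in>level k. (\<Sum>i. toll u i x) + toll_error u x)"
    using finite_level out by (intro sum.mono_neutral_cong_left) (auto simp: series)
  finally show ?thesis .
qed

lemma harm_diff_le:
  assumes "1 \<le> a" "a \<le> n"
  shows "harm n - harm a \<le> ln (real n / real a)"
proof -
  obtain a' n' where s: "a = Suc a'" "n = Suc n'" using assms by (cases a; cases n) auto
  have "harm (Suc n') - ln (real (Suc n')) \<le> harm (Suc a') - ln (real (Suc a'))"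
    using decseqD[OF decseq_harm_diff_ln, of a' n'] assms s by simp
  then show ?thesis using assms by (simp add: s ln_div)
qed

text \<open>The difference of harmonic numbers is at most \<open>ln (1 / f)\<close>, where \<open>f\<close> is the fraction of the
nodes that lie below the child, and \<open>f * ln (1 / f) \<le> 2 * sqrt f\<close>. The square root keeps the
geometric decay in \<open>i\<close>.\<close>

lemma toll_bound:
  fixes x u i
  assumes "grown x"
  defines "f \<equiv> real (below x (u @ [Suc i])) / real (card x)"
  shows "\<bar>toll u i x\<bar> \<le> (real i + 1) * f + 2 * sqrt f"
proof (cases "u @ [Suc i] \<in> x")
  case True
  define a where "a = below x (u @ [Suc i])"
  define n where "n = card x"
  have a: "a \<ge> 1" using True below_pos_iff[OF assms(1), of "u @ [Suc i]"] by (simp add: a_def)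
  have n: "a \<le> below x u" "below x u \<le> n"
    using below_child_le[OF assms(1)] below_le_card[OF assms(1)] by (auto simp: a_def n_def)
  have f: "f = real a / real n" "f > 0" "f \<le> 1" using a n by (auto simp: f_def a_def n_def)
  define d where "d = (harm (below x u) - harm a :: real)"
  have d0: "d \<ge> 0" using harm_mono[OF n(1)] by (simp add: d_def)
  have "d \<le> harm n - harm a" using harm_mono[OF n(2)] by (simp add: d_def)
  also have "\<dots> \<le> ln (real n / real a)" using a n by (intro harm_diff_le) auto
  also have "\<dots> = 2 * ln (sqrt (1 / f))" using a n by (simp add: f ln_sqrt)
  also have "\<dots> \<le> 2 * (sqrt (1 / f) - 1)" using f(2) by (intro mult_left_mono ln_le_minus_one) auto
  also have "\<dots> \<le> 2 * sqrt (1 / f)" by simp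
  finally have d1: "d \<le> 2 * sqrt (1 / f)" .
  have "f * d \<le> f * (2 * sqrt (1 / f))" using d1 f(2) by (intro mult_left_mono) auto
  also have "\<dots> = 2 * (f / sqrt f)" by (simp add: real_sqrt_divide)
  also have "\<dots> = 2 * sqrt f" using f(2) by (simp add: real_div_sqrt)
  finally have fd: "f * d \<le> 2 * sqrt f" .
  have one: "1 / real n \<le> f" using a by (simp add: f divide_right_mono)
  have "toll u i x = real i * f - f * d + 1 / real n"
    using True by (simp add: toll_def f a_def n_def d_def diff_divide_distrib add_divide_distrib)
  moreover have "real i * f \<ge> 0" "f * d \<ge> 0" using f d0 by auto
  moreover have "1 / real n \<ge> 0" "sqrt f \<ge> 0" using f(2) by auto
  moreover have "(real i + 1) * f = real i * f + f" by (simp add: algebra_simps)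
  ultimately show ?thesis using one fd unfolding abs_le_iff by linarith
next
  case False
  then show ?thesis using toll_outside[OF assms(1)] by (simp add: f_def)
qed

lemma toll_error_bound:
  assumes "grown x"
  shows "\<bar>toll_error u x\<bar> \<le> (1 + harm (card x)) / real (card x)"
proof (cases "u \<in> x")
  case True
  have "harm (below x u) \<le> (harm (card x) :: real)" by (rule harm_mono[OF below_le_card[OF assms]])
  moreover have "harm (below x u) \<ge> (0::real)" by (rule harm_nonneg)
  ultimately have "\<bar>1 - harm (below x u) :: real\<bar> \<le> 1 + harm (card x)" by linarith
  then show ?thesis using True by (simp add: toll_error_def divide_right_mono)
qed (simp add: toll_error_def harm_nonneg)


section \<open>Limits in mean\<close>

lemma (in prob_space) bounded_L1_limit:
  fixes f :: "nat \<Rightarrow> 'a \<Rightarrow> real"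
  assumes meas: "\<And>n. f n \<in> borel_measurable M" "g \<in> borel_measurable M"
    and lim: "AE \<omega> in M. (\<lambda>n. f n \<omega>) \<longlonglongrightarrow> g \<omega>"
    and bound: "\<And>n. AE \<omega> in M. \<bar>f n \<omega>\<bar> \<le> B"
    and mean: "\<And>n. expectation (\<lambda>\<omega>. \<bar>f n \<omega>\<bar>) \<le> c"
  shows "integrable M g" "(\<lambda>n. expectation (\<lambda>\<omega>. \<bar>f n \<omega> - g \<omega>\<bar>)) \<longlonglongrightarrow> 0"
    "expectation (\<lambda>\<omega>. \<bar>g \<omega>\<bar>) \<le> c"
proof -
  let ?d = "\<lambda>n \<omega>. \<bar>f n \<omega> - g \<omega>\<bar>"
  have fint: "integrable M (f n)" for n
    using bound[of n] meas(1) by (intro integrable_const_bound[where B=B]) auto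
  have "AE \<omega> in M. \<forall>n. \<bar>f n \<omega>\<bar> \<le> B" using bound by (simp add: AE_all_countable)
  with lim have gb: "AE \<omega> in M. \<bar>g \<omega>\<bar> \<le> B"
  proof eventually_elim
    case (elim \<omega>)
    then have "(\<lambda>n. \<bar>f n \<omega>\<bar>) \<longlonglongrightarrow> \<bar>g \<omega>\<bar>" by (intro tendsto_rabs)
    then show ?case by (rule LIMSEQ_le_const2) (use elim in auto)
  qed
  show gint: "integrable M g"
    using gb meas(2) by (intro integrable_const_bound[where B=B]) auto
  have "(\<lambda>n. expectation (\<lambda>\<omega>. ?d n \<omega>)) \<longlonglongrightarrow> expectation (\<lambda>\<omega>. 0)"
  proof (rule integral_dominated_convergence[where w="\<lambda>_. 2 * B"])
    show "AE \<omega> in M. (\<lambda>n. ?d n \<omega>) \<longlonglongrightarrow> 0"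
      using lim
    proof eventually_elim
      case (elim \<omega>)
      then show ?case by (simp add: LIM_zero tendsto_rabs_zero)
    qed
    fix n
    show "AE \<omega> in M. norm (?d n \<omega>) \<le> 2 * B" using bound[of n] gb by eventually_elim auto
  qed (use meas in auto)
  then show L: "(\<lambda>n. expectation (\<lambda>\<omega>. ?d n \<omega>)) \<longlonglongrightarrow> 0" by simp
  have le: "expectation (\<lambda>\<omega>. \<bar>g \<omega>\<bar>) \<le> expectation (\<lambda>\<omega>. ?d n \<omega>) + c" for n
  proof -
    have "expectation (\<lambda>\<omega>. \<bar>g \<omega>\<bar>) \<le> expectation (\<lambda>\<omega>. ?d n \<omega> + \<bar>f n \<omega>\<bar>)"
      using fint[of n] gint by (intro integral_mono) auto
    also have "\<dots> = expectation (\<lambda>\<omega>. ?d n \<omega>) + expectation (\<lambda>\<omega>. \<bar>f n \<omega>\<bar>)"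
      using fint[of n] gint by (intro Bochner_Integration.integral_add) auto
    finally show ?thesis using mean[of n] by simp
  qed
  have "(\<lambda>n. expectation (\<lambda>\<omega>. ?d n \<omega>) + c) \<longlonglongrightarrow> 0 + c" by (intro tendsto_add L tendsto_const)
  then have "(\<lambda>n. expectation (\<lambda>\<omega>. ?d n \<omega>) + c) \<longlonglongrightarrow> c" by simp
  then show "expectation (\<lambda>\<omega>. \<bar>g \<omega>\<bar>) \<le> c" by (rule LIMSEQ_le_const) (use le in auto)
qed

text \<open>The expectation of the sum of the absolute values is finite, by monotone convergence.\<close>

lemma (in prob_space) AE_summable_norm:
  fixes f :: "nat \<Rightarrow> 'a \<Rightarrow> real"
  assumes int: "\<And>i. integrable M (f i)" and le: "\<And>i. expectation (\<lambda>\<omega>. \<bar>f i \<omega>\<bar>) \<le> c i" and c: "summable c"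
  shows "AE \<omega> in M. summable (\<lambda>i. \<bar>f i \<omega>\<bar>)"
proof -
  have nonneg: "expectation (\<lambda>\<omega>. \<bar>f i \<omega>\<bar>) \<ge> 0" for i by (intro integral_nonneg_AE) auto
  have sum: "summable (\<lambda>i. expectation (\<lambda>\<omega>. \<bar>f i \<omega>\<bar>))"
    using nonneg le by (intro summable_comparison_test'[OF c, of 0]) auto
  have "(\<integral>\<^sup>+\<omega>. (\<Sum>i. ennreal \<bar>f i \<omega>\<bar>) \<partial>M) = (\<Sum>i. \<integral>\<^sup>+\<omega>. ennreal \<bar>f i \<omega>\<bar> \<partial>M)"
    using int by (intro nn_integral_suminf) auto
  also have "\<dots> = (\<Sum>i. ennreal (expectation (\<lambda>\<omega>. \<bar>f i \<omega>\<bar>)))"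
    using int by (intro arg_cong[where f=suminf] ext nn_integral_eq_integral) auto
  also have "\<dots> \<noteq> \<infinity>" using ennreal_suminf_neq_top[OF sum nonneg] by simp
  finally have "AE \<omega> in M. (\<Sum>i. ennreal \<bar>f i \<omega>\<bar>) \<noteq> \<infinity>"
    using int by (intro nn_integral_noteq_infinite) auto
  then show ?thesis
    by eventually_elim (intro summable_suminf_not_top, auto)
qed

lemma (in prob_space) expectation_suminf_le:
  fixes f :: "nat \<Rightarrow> 'a \<Rightarrow> real"
  assumes int: "\<And>i. integrable M (f i)" and le: "\<And>i. expectation (\<lambda>\<omega>. \<bar>f i \<omega>\<bar>) \<le> c i" and c: "summable c"
  shows "integrable M (\<lambda>\<omega>. \<Sum>i. f i \<omega>)"
    and "expectation (\<lambda>\<omega>. \<bar>\<Sum>i. f i \<omega>\<bar>) \<le> (\<Sum>i. expectation (\<lambda>\<omega>. \<bar>f i \<omega>\<bar>))"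
proof -
  note AE = AE_summable_norm[OF int le c]
  have nonneg: "expectation (\<lambda>\<omega>. \<bar>f i \<omega>\<bar>) \<ge> 0" for i by (intro integral_nonneg_AE) auto
  have sum: "summable (\<lambda>i. expectation (\<lambda>\<omega>. \<bar>f i \<omega>\<bar>))"
    using nonneg le by (intro summable_comparison_test'[OF c, of 0]) auto
  show I: "integrable M (\<lambda>\<omega>. \<Sum>i. f i \<omega>)"
    using int AE sum by (intro integrable_suminf) auto
  have J: "integrable M (\<lambda>\<omega>. \<Sum>i. \<bar>f i \<omega>\<bar>)"
    using int AE sum by (intro integrable_suminf) auto
  have "expectation (\<lambda>\<omega>. \<bar>\<Sum>i. f i \<omega>\<bar>) \<le> expectation (\<lambda>\<omega>. \<Sum>i. \<bar>f i \<omega>\<bar>)"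
    using I J AE by (intro integral_mono_AE) (auto elim!: eventually_mono intro: summable_rabs)
  also have "\<dots> = (\<Sum>i. expectation (\<lambda>\<omega>. \<bar>f i \<omega>\<bar>))"
    using int AE sum by (intro integral_suminf) auto
  finally show "expectation (\<lambda>\<omega>. \<bar>\<Sum>i. f i \<omega>\<bar>) \<le> (\<Sum>i. expectation (\<lambda>\<omega>. \<bar>f i \<omega>\<bar>))" .
qed

section \<open>The limits of the tolls\<close>

lemma Suc_le_sqrt2_power: "real i + 1 \<le> 3 * sqrt 2 ^ i"
proof -
  have s: "sqrt 2 \<ge> (7 / 5 :: real)" by (rule real_le_rsqrt) (simp add: power2_eq_square)
  have "1 + real i * (sqrt 2 - 1) \<le> (1 + (sqrt 2 - 1)) ^ i" using s by (intro Bernoulli_inequality) auto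
  moreover have "real i * (2 / 5) \<le> real i * (sqrt 2 - 1)" using s by (intro mult_left_mono) auto
  ultimately show ?thesis by simp
qed

text \<open>If \<open>a n\<close> is asymptotically a positive fraction of \<open>n\<close> then it tends to infinity, and harmonic
numbers become logarithms.\<close>

lemma harm_asymp:
  fixes a :: "nat \<Rightarrow> nat"
  assumes "(\<lambda>n. real (a n) / real n) \<longlonglongrightarrow> m" "m > 0"
  shows "(\<lambda>n. harm (a n) - ln (real (a n))) \<longlonglongrightarrow> euler_mascheroni"
    and "eventually (\<lambda>n. a n \<ge> 1) sequentially"
proof -
  have "filterlim (\<lambda>n. real (a n) / real n * real n) at_top sequentially"
    by (rule filterlim_tendsto_pos_mult_at_top[OF assms filterlim_real_sequentially])
  moreover have "eventually (\<lambda>n. real (a n) / real n * real n = real (a n)) sequentially"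
    using eventually_gt_at_top[of 0] by eventually_elim simp
  ultimately have top: "filterlim (\<lambda>n. real (a n)) at_top sequentially"
    by (rule filterlim_cong[THEN iffD1, rotated -1, OF _ refl refl])
  have at: "filterlim a at_top sequentially"
    unfolding filterlim_at_top
  proof
    fix Z :: nat
    have "eventually (\<lambda>n. real Z \<le> real (a n)) sequentially" using top unfolding filterlim_at_top by blast
    then show "eventually (\<lambda>n. Z \<le> a n) sequentially" by eventually_elim simp
  qed
  show "(\<lambda>n. harm (a n) - ln (real (a n))) \<longlonglongrightarrow> euler_mascheroni"
    by (rule filterlim_compose[OF euler_mascheroni_LIMSEQ at])
  show "eventually (\<lambda>n. a n \<ge> 1) sequentially" using at unfolding filterlim_at_top by blast
qed

locale harris_limit_process = harris_process M X for M :: "'a measure" and X +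
  fixes Xinf :: "'a \<Rightarrow> ext_node measure"
  assumes limit: "harris_limit M X Xinf"
begin

definition mass :: "nat list \<Rightarrow> 'a \<Rightarrow> real" where
  "mass u \<omega> = measure (Xinf \<omega>) (cyl u)"

text \<open>The logarithmic term comes from \<open>H\<^sub>b - H\<^sub>a\<close> for the sizes \<open>b\<close> and \<open>a\<close> of the subtrees at \<open>u\<close> and
at its child, which tends to the logarithm of the quotient of the masses.\<close>

definition toll_limit :: "nat list \<Rightarrow> nat \<Rightarrow> 'a \<Rightarrow> real" where
  "toll_limit u i \<omega> = real i * mass (u @ [Suc i]) \<omega>
     + mass u \<omega> * (rho (Xinf \<omega>) u (Suc i) * ln (rho (Xinf \<omega>) u (Suc i)))"

definition regular :: "'a \<Rightarrow> bool" where
  "regular \<omega> \<longleftrightarrow> (\<forall>n\<ge>1. grown (X n \<omega>) \<and> card (X n \<omega>) = n) \<and>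
     (\<forall>u\<in>nodes. (\<lambda>n. real (below (X n \<omega>) u) / real n) \<longlonglongrightarrow> mass u \<omega>)"

lemma AE_regular: "AE \<omega> in M. regular \<omega>"
proof -
  have "AE \<omega> in M. \<forall>n. n \<ge> 1 \<longrightarrow> grown (X n \<omega>) \<and> card (X n \<omega>) = n"
    unfolding AE_all_countable using AE_grown by (auto intro: AE_impI)
  moreover have "AE \<omega> in M. \<forall>u\<in>nodes. (\<lambda>n. real (below (X n \<omega>) u) / real n) \<longlonglongrightarrow> mass u \<omega>"
    using limit by (simp add: harris_limit_def mass_def below_def)
  ultimately show ?thesis by eventually_elim (simp add: regular_def)
qed

lemma mass_measurable: "u \<in> nodes \<Longrightarrow> mass u \<in> borel_measurable M"
proof -
  assume "u \<in> nodes"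
  then have "cyl u \<in> sets ext_node_algebra"
    unfolding ext_node_algebra_def by (subst sets_measure_of) (auto simp: cyl_def)
  moreover have "Xinf \<in> measurable M (prob_algebra ext_node_algebra)"
    using limit by (simp add: harris_limit_def)
  ultimately show ?thesis
    unfolding mass_def by (rule measurable_compose[OF _ measurable_measure_prob_algebra, rotated])
qed

lemma child_node: "u \<in> nodes \<Longrightarrow> u @ [Suc i] \<in> nodes"
  by (simp add: nodes_def)

lemma rho_mass: "rho (Xinf \<omega>) u i = mass (u @ [i]) \<omega> / mass u \<omega>"
  by (simp add: rho_def mass_def)

lemma toll_limit_measurable: "u \<in> nodes \<Longrightarrow> toll_limit u i \<in> borel_measurable M"
  unfolding toll_limit_def rho_mass
  using mass_measurable[of u] mass_measurable[OF child_node[of u i]] by measurable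

lemma measurable_of_tree_Suc: "(\<lambda>\<omega>. f (X (Suc n) \<omega>) :: real) \<in> borel_measurable M"
  by (rule measurable_of_tree) auto

lemma mass_nonneg: "mass u \<omega> \<ge> 0"
  by (simp add: mass_def)

lemma regular_mass_le: "regular \<omega> \<Longrightarrow> u \<in> nodes \<Longrightarrow> mass (u @ [Suc i]) \<omega> \<le> mass u \<omega>"
proof (rule LIMSEQ_le)
  assume g: "regular \<omega>" and u: "u \<in> nodes"
  show "(\<lambda>n. real (below (X n \<omega>) (u @ [Suc i])) / real n) \<longlonglongrightarrow> mass (u @ [Suc i]) \<omega>"
    "(\<lambda>n. real (below (X n \<omega>) u) / real n) \<longlonglongrightarrow> mass u \<omega>"
    using g u child_node by (auto simp: regular_def)
  show "\<exists>N. \<forall>n\<ge>N. real (below (X n \<omega>) (u @ [Suc i])) / real n \<le> real (below (X n \<omega>) u) / real n"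
    using g below_child_le by (intro exI[of _ 1] allI impI divide_right_mono) (auto simp: regular_def)
qed

text \<open>If the child has positive mass then the constant of Euler and Mascheroni cancels in \<open>H\<^sub>b - H\<^sub>a\<close>.
Without mass, the toll and its limit vanish by \<open>toll_bound\<close>.\<close>

lemma toll_tendsto:
  assumes g: "regular \<omega>" and u: "u \<in> nodes"
  shows "(\<lambda>n. toll u i (X n \<omega>)) \<longlonglongrightarrow> toll_limit u i \<omega>"
proof -
  define a where "a = (\<lambda>n. below (X n \<omega>) (u @ [Suc i]))"
  define b where "b = (\<lambda>n. below (X n \<omega>) u)"
  define f where "f = (\<lambda>n. real (a n) / real n)"
  define m where "m = mass (u @ [Suc i]) \<omega>"
  have tree: "grown (X n \<omega>)" "card (X n \<omega>) = n" if "n \<ge> 1" for n using g that by (auto simp: regular_def)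
  have f: "f \<longlonglongrightarrow> m" using g child_node[OF u] by (simp add: regular_def f_def a_def m_def)
  have b: "(\<lambda>n. real (b n) / real n) \<longlonglongrightarrow> mass u \<omega>" using g u by (simp add: regular_def b_def)
  show ?thesis
  proof (cases "m = 0")
    case True
    have "(\<lambda>n. (real i + 1) * f n + 2 * sqrt (f n)) \<longlonglongrightarrow> (real i + 1) * m + 2 * sqrt m"
      by (intro tendsto_intros f)
    then have "(\<lambda>n. (real i + 1) * f n + 2 * sqrt (f n)) \<longlonglongrightarrow> 0" by (simp add: True)
    moreover have "eventually (\<lambda>n. norm (toll u i (X n \<omega>)) \<le> (real i + 1) * f n + 2 * sqrt (f n)) sequentially"
      using eventually_ge_at_top[of 1]
    proof eventually_elim
      case (elim n)
      show ?case using toll_bound[OF tree(1)[OF elim], of u i] tree(2)[OF elim] by (simp add: f_def a_def)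
    qed
    ultimately have "(\<lambda>n. toll u i (X n \<omega>)) \<longlonglongrightarrow> 0" by (rule Lim_null_comparison[rotated])
    then show ?thesis using True by (simp add: toll_limit_def m_def rho_mass)
  next
    case False
    then have m: "m > 0" using mass_nonneg[of "u @ [Suc i]" \<omega>] by (simp add: m_def)
    then have mu: "mass u \<omega> > 0" using regular_mass_le[OF g u, of i] by (simp add: m_def)
    note A = harm_asymp[OF f[unfolded f_def] m] and B = harm_asymp[OF b mu]
    let ?t = "\<lambda>n. real i * f n - f n * ((harm (b n) - ln (real (b n))) - (harm (a n) - ln (real (a n)))
        + ln ((real (b n) / real n) / f n))"
    let ?L = "real i * m - m * ((euler_mascheroni - euler_mascheroni) + ln (mass u \<omega> / m))"
    have "(\<lambda>n. ?t n) \<longlonglongrightarrow>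
        ?L"
      by (intro tendsto_intros f A B b) (use m mu in auto)
    moreover have "(\<lambda>n. (if u @ [Suc i] \<in> X n \<omega> then 1 else 0) / real n) \<longlonglongrightarrow> 0"
      by (rule Lim_null_comparison[OF _ lim_1_over_n]) auto
    ultimately have "(\<lambda>n. ?t n + (if u @ [Suc i] \<in> X n \<omega> then 1 else 0) / real n) \<longlonglongrightarrow>
        ?L + 0"
      by (rule tendsto_add)
    moreover have "eventually (\<lambda>n. ?t n + (if u @ [Suc i] \<in> X n \<omega> then 1 else 0) / real n = toll u i (X n \<omega>)) sequentially"
      using A(2) B(2) eventually_ge_at_top[of 1]
    proof eventually_elim
      case (elim n)
      have "ln ((real (b n) / real n) / f n) = ln (real (b n)) - ln (real (a n))"
        using elim by (simp add: f_def ln_div)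
      then show ?case using tree(2)[OF elim(3)]
        by (simp add: toll_def a_def b_def f_def diff_divide_distrib add_divide_distrib)
    qed
    ultimately have "(\<lambda>n. toll u i (X n \<omega>)) \<longlonglongrightarrow>
        ?L + 0"
      by (rule Lim_transform_eventually)
    moreover have "?L + 0 = toll_limit u i \<omega>"
      using m mu by (simp add: toll_limit_def rho_mass m_def[symmetric] ln_div algebra_simps)
    ultimately show ?thesis by simp
  qed
qed

lemma child_fraction_le:
  assumes "regular \<omega>" "n \<ge> 1"
  shows "real (below (X n \<omega>) (u @ [Suc i])) / real n \<le> real (later (X n \<omega>) u i) / real n"
  using assms later_rec[of "X n \<omega>" u i] by (intro divide_right_mono) (auto simp: regular_def)

lemma fraction_le_1: "regular \<omega> \<Longrightarrow> n \<ge> 1 \<Longrightarrow> real (below (X n \<omega>) u) / real n \<le> 1"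
  using below_le_card[of "X n \<omega>" u] by (auto simp: regular_def)

lemma expectation_child:
  assumes "n \<ge> 1"
  shows "expectation (\<lambda>\<omega>. real (below (X n \<omega>) (u @ [Suc i])) / real n) \<le> 1 / 2 ^ i"
proof -
  have "expectation (\<lambda>\<omega>. real (below (X n \<omega>) (u @ [Suc i])) / real n) \<le> expectation (\<lambda>\<omega>. real (later (X n \<omega>) u i) / real n)"
    using AE_regular child_fraction_le assms by (intro integral_mono_AE integrable_of_tree) (auto elim!: eventually_mono)
  then show ?thesis using expectation_later[OF assms, of u i] by simp
qed

text \<open>The fraction of nodes below child \<open>i + 1\<close> has mean at most \<open>1 / 2 ^ i\<close>, hence its square root
has mean at most \<open>(1 / sqrt 2) ^ i\<close>.\<close>

lemma expectation_toll:
  assumes n: "n \<ge> 1"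
  shows "expectation (\<lambda>\<omega>. \<bar>toll u i (X n \<omega>)\<bar>) \<le> 5 * (1 / sqrt 2) ^ i"
proof -
  define t where "t = sqrt 2 ^ i"
  have t: "t > 0" "t * t = 2 ^ i" by (simp_all add: t_def flip: power_mult_distrib)
  define F where "F = (\<lambda>x. real (below x (u @ [Suc i])) / real n)"
  have "expectation (\<lambda>\<omega>. \<bar>toll u i (X n \<omega>)\<bar>) \<le> expectation (\<lambda>\<omega>. ((real i + 1) + t) * F (X n \<omega>) + 1 / t)"
  proof (intro integral_mono_AE integrable_of_tree[OF n])
    show "AE \<omega> in M. \<bar>toll u i (X n \<omega>)\<bar> \<le> ((real i + 1) + t) * F (X n \<omega>) + 1 / t"
      using AE_regular
    proof eventually_elim
      case (elim \<omega>)
      define f where "f = F (X n \<omega>)"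
      have f: "f \<ge> 0" by (simp add: f_def F_def)
      have tree: "grown (X n \<omega>)" "card (X n \<omega>) = n" using elim n by (auto simp: regular_def)
      \<comment> \<open>Linearize the square root: \<open>t\<close> balances the two sides for \<open>f\<close> of order \<open>1 / t\<^sup>2 = 1 / 2 ^ i\<close>.\<close>
      have "0 \<le> (t * sqrt f - 1)\<^sup>2 / t" using t by simp
      also have "\<dots> = (t * t * f - 2 * t * sqrt f + 1) / t"
        using f by (simp add: power2_diff power_mult_distrib power2_eq_square algebra_simps)
      also have "\<dots> = t * f - 2 * sqrt f + 1 / t"
        using t(1) by (simp add: add_divide_distrib diff_divide_distrib)
      finally have "2 * sqrt f \<le> t * f + 1 / t" by simp
      moreover have "\<bar>toll u i (X n \<omega>)\<bar> \<le> (real i + 1) * f + 2 * sqrt f"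
        using toll_bound[OF tree(1), of u i] tree(2) by (simp add: f_def F_def)
      moreover have "((real i + 1) + t) * f = (real i + 1) * f + t * f" by (simp add: algebra_simps)
      ultimately show ?case unfolding f_def[symmetric] by linarith
    qed
  qed
  also have "\<dots> = ((real i + 1) + t) * expectation (\<lambda>\<omega>. F (X n \<omega>)) + 1 / t"
    using integrable_of_tree[OF n, of F] by (simp add: prob_space)
  also have "\<dots> \<le> ((real i + 1) + t) * (1 / (t * t)) + 1 / t"
    using expectation_child[OF n, of u i] t by (intro add_right_mono mult_left_mono) (auto simp: F_def)
  also have "\<dots> \<le> (3 * t + t) * (1 / (t * t)) + 1 / t"
    using Suc_le_sqrt2_power[of i] t by (intro add_right_mono mult_right_mono) (auto simp: t_def)
  also have "\<dots> = 5 * (1 / t)" using t by (simp add: field_simps)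
  finally show ?thesis by (simp add: t_def power_one_over)
qed

lemma toll_L1:
  assumes u: "u \<in> nodes"
  shows "integrable M (toll_limit u i)"
    and "(\<lambda>n. expectation (\<lambda>\<omega>. \<bar>toll u i (X (Suc n) \<omega>) - toll_limit u i \<omega>\<bar>)) \<longlonglongrightarrow> 0"
    and "expectation (\<lambda>\<omega>. \<bar>toll_limit u i \<omega>\<bar>) \<le> 5 * (1 / sqrt 2) ^ i"
proof -
  have lim: "AE \<omega> in M. (\<lambda>n. toll u i (X (Suc n) \<omega>)) \<longlonglongrightarrow> toll_limit u i \<omega>"
    using AE_regular by eventually_elim (rule LIMSEQ_Suc[OF toll_tendsto[OF _ u]])
  have bound: "AE \<omega> in M. \<bar>toll u i (X (Suc n) \<omega>)\<bar> \<le> (real i + 1) * 1 + 2 * sqrt 1" for n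
    using AE_regular
  proof eventually_elim
    case (elim \<omega>)
    define f where "f = real (below (X (Suc n) \<omega>) (u @ [Suc i])) / real (Suc n)"
    have "grown (X (Suc n) \<omega>)" "card (X (Suc n) \<omega>) = Suc n" using elim by (auto simp: regular_def)
    then have "\<bar>toll u i (X (Suc n) \<omega>)\<bar> \<le> (real i + 1) * f + 2 * sqrt f"
      using toll_bound[of "X (Suc n) \<omega>" u i] by (simp add: f_def)
    also have "\<dots> \<le> (real i + 1) * 1 + 2 * sqrt 1"
      using fraction_le_1[OF elim, of "Suc n" "u @ [Suc i]"]
      by (intro add_mono mult_left_mono real_sqrt_le_mono) (auto simp: f_def)
    finally show ?case .
  qed
  note L = bounded_L1_limit[OF measurable_of_tree_Suc toll_limit_measurable[OF u] lim bound expectation_toll]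
  show "integrable M (toll_limit u i)" using L(1) by simp
  show "(\<lambda>n. expectation (\<lambda>\<omega>. \<bar>toll u i (X (Suc n) \<omega>) - toll_limit u i \<omega>\<bar>)) \<longlonglongrightarrow> 0" using L(2) by simp
  show "expectation (\<lambda>\<omega>. \<bar>toll_limit u i \<omega>\<bar>) \<le> 5 * (1 / sqrt 2) ^ i" using L(3) by simp
qed

lemma summable_sqrt2: "summable (\<lambda>i. c * (1 / sqrt 2) ^ i :: real)"
  by (intro summable_mult summable_geometric) simp

lemma AE_summable_toll_limit: "u \<in> nodes \<Longrightarrow> AE \<omega> in M. summable (\<lambda>i. \<bar>toll_limit u i \<omega>\<bar>)"
  by (rule AE_summable_norm[OF toll_L1(1) toll_L1(3) summable_sqrt2])

definition toll_sum :: "nat \<Rightarrow> 'a \<Rightarrow> real" where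
  "toll_sum k \<omega> = (\<Sum>u\<in>level k. \<Sum>i. toll_limit u i \<omega>)"

lemma level_nodes: "u \<in> level k \<Longrightarrow> u \<in> nodes"
  by (simp add: level_def)

lemma integrable_toll_sum: "integrable M (toll_sum k)"
  unfolding toll_sum_def
  by (intro Bochner_Integration.integrable_sum expectation_suminf_le(1)[OF toll_L1(1) toll_L1(3) summable_sqrt2] level_nodes)

text \<open>For each \<open>u\<close> the sum over the children is exchanged with the limit by Tannery's theorem, applied
to the mean distances between the tolls and their limits; these are dominated by a geometric
sequence. Only finitely many \<open>u\<close> occur.\<close>

proposition frontier_HPL_toll_L1:
  "(\<lambda>n. expectation (\<lambda>\<omega>. \<bar>martingale 0 (Suc n) \<omega> - martingale (Suc k) (Suc n) \<omega> - toll_sum k \<omega>\<bar>)) \<longlonglongrightarrow> 0"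
proof -
  let ?d = "\<lambda>n \<omega>. \<bar>martingale 0 (Suc n) \<omega> - martingale (Suc k) (Suc n) \<omega> - toll_sum k \<omega>\<bar>"
  define D where "D = (\<lambda>u i n \<omega>. toll u i (X (Suc n) \<omega>) - toll_limit u i \<omega>)"
  define r where "r = (\<lambda>n. (1 + harm (Suc n)) / real (Suc n) :: real)"
  define E where "E = (\<lambda>u i n. expectation (\<lambda>\<omega>. \<bar>D u i n \<omega>\<bar>))"
  have tint: "integrable M (\<lambda>\<omega>. toll u i (X (Suc n) \<omega>))" for u i n by (rule integrable_of_tree) simp
  have Dint: "integrable M (D u i n)" if "u \<in> nodes" for u i n
    unfolding D_def using tint toll_L1(1)[OF that] by (rule Bochner_Integration.integrable_diff)
  have E_le: "E u i n \<le> 10 * (1 / sqrt 2) ^ i" if "u \<in> nodes" for u i n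
  proof -
    have "E u i n \<le> expectation (\<lambda>\<omega>. \<bar>toll u i (X (Suc n) \<omega>)\<bar> + \<bar>toll_limit u i \<omega>\<bar>)"
      unfolding E_def using Dint[OF that] tint toll_L1(1)[OF that] by (intro integral_mono) (auto simp: D_def)
    also have "\<dots> = expectation (\<lambda>\<omega>. \<bar>toll u i (X (Suc n) \<omega>)\<bar>) + expectation (\<lambda>\<omega>. \<bar>toll_limit u i \<omega>\<bar>)"
      using tint toll_L1(1)[OF that] by (intro Bochner_Integration.integral_add) auto
    finally show ?thesis using expectation_toll[of "Suc n" u i] toll_L1(3)[OF that, of i] by simp
  qed
  have E_nonneg: "E u i n \<ge> 0" for u i n unfolding E_def by (intro integral_nonneg_AE) auto
  have suminf: "integrable M (\<lambda>\<omega>. \<Sum>i. D u i n \<omega>)"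
    "expectation (\<lambda>\<omega>. \<bar>\<Sum>i. D u i n \<omega>\<bar>) \<le> (\<Sum>i. E u i n)" if "u \<in> nodes" for u n
    using expectation_suminf_le[OF Dint[OF that] E_le[OF that, unfolded E_def] summable_sqrt2]
    unfolding E_def by auto
  have point: "AE \<omega> in M. ?d n \<omega> \<le>
      (\<Sum>u\<in>level k. \<bar>\<Sum>i. D u i n \<omega>\<bar> + r n)" for n
  proof -
    have "AE \<omega> in M. \<forall>u\<in>level k. summable (\<lambda>i. \<bar>toll_limit u i \<omega>\<bar>)"
      using finite_level level_nodes AE_summable_toll_limit by (intro AE_finite_allI) auto
    with AE_regular show ?thesis
    proof eventually_elim
      case (elim \<omega>)
      define x where "x = X (Suc n) \<omega>"
      have x: "grown x" "card x = Suc n" using elim by (auto simp: regular_def x_def)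
      have split: "(\<Sum>i. D u i n \<omega>) = (\<Sum>i. toll u i x) - (\<Sum>i. toll_limit u i \<omega>)" if "u \<in> level k" for u
      proof -
        have "summable (\<lambda>i. toll u i x)"
          by (rule summable_finite[of "{..<nchild x u}"]) (auto intro: toll_finite_support[OF x(1)])
        moreover have "summable (\<lambda>i. toll_limit u i \<omega>)"
          using elim(2) that by (auto intro: summable_rabs_cancel)
        ultimately show ?thesis unfolding D_def x_def[symmetric] by (rule suminf_diff[symmetric])
      qed
      have "martingale 0 (Suc n) \<omega> - martingale (Suc k) (Suc n) \<omega> = (\<Sum>u\<in>level k. (\<Sum>i. toll u i x) + toll_error u x)"
        using frontier_HPL_toll[OF x(1), of k] x(2) by (simp add: martingale_def x_def diff_divide_distrib)
      then have "martingale 0 (Suc n) \<omega> - martingale (Suc k) (Suc n) \<omega> - toll_sum k \<omega> =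
          (\<Sum>u\<in>level k. (\<Sum>i. D u i n \<omega>) + toll_error u x)"
        by (simp add: toll_sum_def split sum.distrib sum_subtractf)
      also have "\<bar>\<dots>\<bar> \<le> (\<Sum>u\<in>level k. \<bar>(\<Sum>i. D u i n \<omega>) + toll_error u x\<bar>)" by (rule sum_abs)
      also have "\<dots> \<le> (\<Sum>u\<in>level k. \<bar>\<Sum>i. D u i n \<omega>\<bar> + r n)"
      proof (rule sum_mono)
        fix u
        show "\<bar>(\<Sum>i. D u i n \<omega>) + toll_error u x\<bar> \<le> \<bar>\<Sum>i. D u i n \<omega>\<bar> + r n"
          using toll_error_bound[OF x(1), of u] abs_triangle_ineq[of "\<Sum>i. D u i n \<omega>" "toll_error u x"]
          by (simp add: x(2) r_def)
      qed
      finally show ?case .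
    qed
  qed
  have le: "expectation (\<lambda>\<omega>. ?d n \<omega>) \<le>
      (\<Sum>u\<in>level k. (\<Sum>i. E u i n) + r n)" for n
  proof -
    have Rint: "integrable M (martingale j (Suc n))" for j unfolding martingale_def by (rule integrable_of_tree) simp
    have "expectation (\<lambda>\<omega>. ?d n \<omega>) \<le>
        expectation (\<lambda>\<omega>. \<Sum>u\<in>level k. \<bar>\<Sum>i. D u i n \<omega>\<bar> + r n)"
      using Rint integrable_toll_sum point[of n] suminf(1) level_nodes
      by (intro integral_mono_AE) auto
    also have "\<dots> = (\<Sum>u\<in>level k. expectation (\<lambda>\<omega>. \<bar>\<Sum>i. D u i n \<omega>\<bar> + r n))"
      using suminf(1) level_nodes by (intro Bochner_Integration.integral_sum) auto
    also have "\<dots> = (\<Sum>u\<in>level k. expectation (\<lambda>\<omega>. \<bar>\<Sum>i. D u i n \<omega>\<bar>) + r n)"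
      using suminf(1) level_nodes by (intro sum.cong refl) (simp add: prob_space)
    also have "\<dots> \<le> (\<Sum>u\<in>level k. (\<Sum>i. E u i n) + r n)"
      using suminf(2) level_nodes by (intro sum_mono add_right_mono) auto
    finally show ?thesis .
  qed
  have tannery: "(\<lambda>n. \<Sum>i. E u i n) \<longlonglongrightarrow> 0" if "u \<in> nodes" for u
  proof -
    have "(\<lambda>n. suminf (\<lambda>i. E u i n)) \<longlonglongrightarrow> suminf (\<lambda>i. 0)"
    proof (rule tannerys_theorem[THEN conjunct2, THEN conjunct2])
      show "(\<lambda>n. E u i n) \<longlonglongrightarrow> 0" for i using toll_L1(2)[OF that] by (simp add: E_def D_def)
      show "summable (\<lambda>i. 10 * (1 / sqrt 2) ^ i :: real)" by (rule summable_sqrt2)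
      show "\<forall>\<^sub>F (i, n) in at_top \<times>\<^sub>F sequentially. norm (E u i n) \<le> 10 * (1 / sqrt 2) ^ i"
        using E_le[OF that] E_nonneg by (intro always_eventually) auto
    qed simp
    then show ?thesis by simp
  qed
  have "r \<longlonglongrightarrow> 0"
  proof -
    have lim: "(\<lambda>n. (1 + (1 + ln (real (Suc n)))) / real (Suc n)) \<longlonglongrightarrow> 0" by real_asymp
    have "norm (r n) \<le> (1 + (1 + ln (real (Suc n)))) / real (Suc n)" for n
      using harm_le_ln[of "Suc n"] harm_nonneg[of "Suc n", where 'a=real]
      by (simp add: r_def divide_right_mono del: of_nat_Suc)
    then have "eventually (\<lambda>n. norm (r n) \<le> (1 + (1 + ln (real (Suc n)))) / real (Suc n)) sequentially"
      by (intro always_eventually allI)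
    then show ?thesis using lim by (rule Lim_null_comparison)
  qed
  then have "(\<lambda>n. \<Sum>u\<in>level k. (\<Sum>i. E u i n) + r n) \<longlonglongrightarrow> (\<Sum>u\<in>level k. 0 + 0)"
    using tannery level_nodes by (intro tendsto_sum tendsto_add) auto
  then have "(\<lambda>n. \<Sum>u\<in>level k. (\<Sum>i. E u i n) + r n) \<longlonglongrightarrow> 0" by simp
  then show ?thesis
  proof (rule Lim_null_comparison[rotated], intro always_eventually allI)
    fix n
    have "expectation (\<lambda>\<omega>. ?d n \<omega>) \<ge> 0"
      by (intro integral_nonneg_AE) auto
    then show "norm (expectation (\<lambda>\<omega>. ?d n \<omega>)) \<le>
        (\<Sum>u\<in>level k. (\<Sum>i. E u i n) + r n)"
      using le[of n] by simp
  qed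
qed

section \<open>Identification with the functionals of the limit measure\<close>

text \<open>No mass escapes to infinity: what the first \<open>l\<close> children of \<open>u\<close> leave has mean at most
\<open>1 / 2 ^ l\<close>.\<close>

lemma AE_mass_sums:
  assumes u: "u \<in> nodes"
  shows "AE \<omega> in M. (\<lambda>i. mass (u @ [Suc i]) \<omega>) sums mass u \<omega>"
proof -
  define tail where "tail = (\<lambda>l \<omega>. mass u \<omega> - (\<Sum>i<l. mass (u @ [Suc i]) \<omega>))"
  have meas: "tail l \<in> borel_measurable M" for l
    unfolding tail_def using mass_measurable u child_node by measurable
  have lim: "AE \<omega> in M. (\<lambda>n. real (later (X (Suc n) \<omega>) u l) / real (Suc n)) \<longlonglongrightarrow> tail l \<omega>" for l
    using AE_regular
  proof eventually_elim
    case (elim \<omega>)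
    have conv: "(\<lambda>n. real (below (X n \<omega>) v) / real n) \<longlonglongrightarrow> mass v \<omega>" if "v \<in> nodes" for v
      using elim that by (simp add: regular_def)
    have "(\<lambda>n. real (below (X n \<omega>) u) / real n - (if u \<in> X n \<omega> then 1 else 0) / real n
        - (\<Sum>i<l. real (below (X n \<omega>) (u @ [Suc i])) / real n)) \<longlonglongrightarrow> mass u \<omega> - 0 - (\<Sum>i<l. mass (u @ [Suc i]) \<omega>)"
    proof (intro tendsto_diff tendsto_sum conv u child_node)
      show "(\<lambda>n. (if u \<in> X n \<omega> then 1 else 0) / real n) \<longlonglongrightarrow> 0"
        by (rule Lim_null_comparison[OF _ lim_1_over_n]) auto
    qed
    moreover have "\<forall>\<^sub>F n in sequentially. real (below (X n \<omega>) u) / real n - (if u \<in> X n \<omega> then 1 else 0) / real n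
        - (\<Sum>i<l. real (below (X n \<omega>) (u @ [Suc i])) / real n) = real (later (X n \<omega>) u l) / real n"
      using eventually_ge_at_top[of 1]
    proof eventually_elim
      case (elim n)
      have "grown (X n \<omega>)" using \<open>regular \<omega>\<close> elim by (simp add: regular_def)
      from below_sum_later[OF this, of u l] show ?case
        by (simp add: add_divide_distrib flip: sum_divide_distrib)
    qed
    ultimately have "(\<lambda>n. real (later (X n \<omega>) u l) / real n) \<longlonglongrightarrow>
        mass u \<omega> - 0 - (\<Sum>i<l. mass (u @ [Suc i]) \<omega>)"
      by (rule Lim_transform_eventually)
    then have "(\<lambda>n. real (later (X n \<omega>) u l) / real n) \<longlonglongrightarrow> tail l \<omega>" by (simp add: tail_def)
    then show ?case by (rule LIMSEQ_Suc)
  qed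
  have bound: "AE \<omega> in M. \<bar>real (later (X (Suc n) \<omega>) u l) / real (Suc n)\<bar> \<le> 1" for n l
    using AE_regular
  proof eventually_elim
    case (elim \<omega>)
    then have "grown (X (Suc n) \<omega>)" "card (X (Suc n) \<omega>) = Suc n" by (auto simp: regular_def)
    then show ?case using later_le_card[of "X (Suc n) \<omega>" u l] by simp
  qed
  have mean: "expectation (\<lambda>\<omega>. \<bar>real (later (X (Suc n) \<omega>) u l) / real (Suc n)\<bar>) \<le> (1 / 2) ^ l" for n l
    using expectation_later[of "Suc n" u l] by (simp add: power_one_over)
  note L = bounded_L1_limit[OF measurable_of_tree_Suc meas lim bound mean]
  have "summable (\<lambda>l. (1 / 2 :: real) ^ l)" by (rule summable_geometric) simp
  from AE_summable_norm[OF L(1) L(3) this]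
  show ?thesis
  proof eventually_elim
    case (elim \<omega>)
    then have "(\<lambda>l. tail l \<omega>) \<longlonglongrightarrow> 0" using summable_LIMSEQ_zero tendsto_rabs_zero_iff by blast
    then have "(\<lambda>l. mass u \<omega> - tail l \<omega>) \<longlonglongrightarrow> mass u \<omega> - 0" by (intro tendsto_diff tendsto_const)
    then show ?case by (simp add: sums_def tail_def)
  qed
qed

lemma AE_summable_mass:
  assumes u: "u \<in> nodes"
  shows "AE \<omega> in M. summable (\<lambda>i. real i * mass (u @ [Suc i]) \<omega>)"
proof -
  have L: "integrable M (mass (u @ [Suc i]))" "expectation (\<lambda>\<omega>. \<bar>mass (u @ [Suc i]) \<omega>\<bar>) \<le> 1 / 2 ^ i" for i
  proof -
    have lim: "AE \<omega> in M. (\<lambda>n. real (below (X (Suc n) \<omega>) (u @ [Suc i])) / real (Suc n)) \<longlonglongrightarrow> mass (u @ [Suc i]) \<omega>"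
      using AE_regular by eventually_elim (rule LIMSEQ_Suc, use child_node[OF u] in \<open>simp add: regular_def\<close>)
    have bound: "AE \<omega> in M. \<bar>real (below (X (Suc n) \<omega>) (u @ [Suc i])) / real (Suc n)\<bar> \<le> 1" for n
      using AE_regular by eventually_elim (use fraction_le_1[of _ "Suc n" "u @ [Suc i]"] in auto)
    have mean: "expectation (\<lambda>\<omega>. \<bar>real (below (X (Suc n) \<omega>) (u @ [Suc i])) / real (Suc n)\<bar>) \<le> 1 / 2 ^ i" for n
      using expectation_child[of "Suc n" u i] by simp
    note L = bounded_L1_limit[OF measurable_of_tree_Suc mass_measurable[OF child_node[OF u]] lim bound mean]
    show "integrable M (mass (u @ [Suc i]))" "expectation (\<lambda>\<omega>. \<bar>mass (u @ [Suc i]) \<omega>\<bar>) \<le> 1 / 2 ^ i"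
      using L(1,3) by auto
  qed
  have "expectation (\<lambda>\<omega>. \<bar>real i * mass (u @ [Suc i]) \<omega>\<bar>) \<le> 3 * (1 / sqrt 2) ^ i" for i
  proof -
    have t: "sqrt 2 ^ i * sqrt 2 ^ i = (2::real) ^ i" "sqrt 2 ^ i > (0::real)" by (simp_all flip: power_mult_distrib)
    have "expectation (\<lambda>\<omega>. \<bar>real i * mass (u @ [Suc i]) \<omega>\<bar>) = real i * expectation (\<lambda>\<omega>. \<bar>mass (u @ [Suc i]) \<omega>\<bar>)"
      by (simp add: abs_mult)
    also have "\<dots> \<le> (3 * sqrt 2 ^ i) * (1 / 2 ^ i)"
      using L(2)[of i] Suc_le_sqrt2_power[of i] by (intro mult_mono) (auto intro: integral_nonneg_AE)
    also have "\<dots> = 3 * (1 / sqrt 2) ^ i" unfolding t(1)[symmetric] using t(2) by (simp add: field_simps)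
    finally show ?thesis .
  qed
  from AE_summable_norm[OF integrable_mult_right[OF L(1)] this summable_sqrt2]
  show ?thesis by eventually_elim (simp add: abs_mult mass_nonneg)
qed

text \<open>The two series of \<open>C_fun\<close> and \<open>D_fun\<close> are summable almost surely, so they can be computed in the
reals. The constants fit, \<open>1 - 2 = - 1\<close>, because the masses of the children add up to that of
\<open>u\<close> and so \<open>i\<close> can be replaced by \<open>i - 1\<close> in \<open>D_fun\<close>.\<close>

lemma AE_partial_sum:
  "AE \<omega> in M. \<exists>c d. partial_sum C_fun (Xinf \<omega>) k = ereal c \<and> partial_sum D_fun (Xinf \<omega>) k = ereal d
     \<and> c + d = toll_sum k \<omega>"
proof -
  have "AE \<omega> in M. \<forall>u\<in>level k. (\<lambda>i. mass (u @ [Suc i]) \<omega>) sums mass u \<omega> \<and>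
      summable (\<lambda>i. real i * mass (u @ [Suc i]) \<omega>) \<and> summable (\<lambda>i. \<bar>toll_limit u i \<omega>\<bar>)"
    using AE_mass_sums AE_summable_mass AE_summable_toll_limit level_nodes
    by (intro AE_finite_allI finite_level AE_conjI) auto
  then show ?thesis
  proof eventually_elim
    case (elim \<omega>)
    define s where "s = (\<lambda>u. rho (Xinf \<omega>) u)"
    define c where "c = (\<lambda>u. if mass u \<omega> = 0 then 0 else mass u \<omega> * (1 + (\<Sum>i. s u (Suc i) * ln (s u (Suc i)))))"
    define d where "d = (\<lambda>u. if mass u \<omega> = 0 then 0 else mass u \<omega> * (- 2 + (\<Sum>i. real (Suc i) * s u (Suc i))))"
    have each: "ereal (mass u \<omega>) * C_fun (s u) = ereal (c u) \<and> ereal (mass u \<omega>) * D_fun (s u) = ereal (d u)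
        \<and> c u + d u = (\<Sum>i. toll_limit u i \<omega>)" if u: "u \<in> level k" for u
    proof (cases "mass u \<omega> = 0")
      case True
      \<comment> \<open>All quotients are \<open>0 / 0 = 0\<close>, so both series vanish; only the factor \<open>mass u \<omega> = 0\<close> removes the constants 1 and -2.\<close>
      have "mass (u @ [Suc i]) \<omega> = 0" for i
      proof -
        have zero: "(\<lambda>i. mass (u @ [Suc i]) \<omega>) sums 0" using elim u True by auto
        show ?thesis
          using suminf_eq_zero_iff[OF sums_summable[OF zero] mass_nonneg] sums_unique[OF zero] by simp
      qed
      then show ?thesis using True
        by (simp add: c_def d_def toll_limit_def zero_ereal_def[symmetric])
    next
      case False
      define m where "m = mass u \<omega>"
      have m: "m \<noteq> 0" using False by (simp add: m_def)
      have s: "s u (Suc i) = mass (u @ [Suc i]) \<omega> / m" for i by (simp add: s_def rho_mass m_def)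
      have one: "(\<lambda>i. s u (Suc i)) sums 1"
        using sums_divide[of _ "mass u \<omega>" m] elim u m by (simp add: s m_def)
      have lin: "summable (\<lambda>i. real i * s u (Suc i))"
        using summable_divide[of "\<lambda>i. real i * mass (u @ [Suc i]) \<omega>" m] elim u by (simp add: s)
      have tl: "summable (\<lambda>i. toll_limit u i \<omega>)" using elim u by (auto intro: summable_rabs_cancel)
      have toll: "toll_limit u i \<omega> / m = real i * s u (Suc i) + s u (Suc i) * ln (s u (Suc i))" for i
        using m by (simp add: toll_limit_def s_def[symmetric] s m_def[symmetric] add_divide_distrib)
      \<comment> \<open>The entropy series is the difference of two summable ones.\<close>
      have "summable (\<lambda>i. toll_limit u i \<omega> / m - real i * s u (Suc i))"
        using summable_divide[OF tl] lin by (rule summable_diff)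
      then have entropy: "summable (\<lambda>i. s u (Suc i) * ln (s u (Suc i)))" by (simp add: toll)
      have lin': "(\<lambda>i. real (Suc i) * s u (Suc i)) sums ((\<Sum>i. real i * s u (Suc i)) + 1)"
        using sums_add[OF summable_sums[OF lin] one] by (simp add: algebra_simps)
      have "C_fun (s u) = ereal (1 + (\<Sum>i. s u (Suc i) * ln (s u (Suc i))))"
        unfolding C_fun_def
        unfolding sums_unique[OF sums_ereal[THEN iffD2, OF summable_sums[OF entropy]], symmetric]
        by (simp add: one_ereal_def)
      moreover have "D_fun (s u) = ereal (- 2 + (\<Sum>i. real (Suc i) * s u (Suc i)))"
      proof -
        have "(\<Sum>i. ereal (real (Suc i) * s u (Suc i))) = ereal (\<Sum>i. real (Suc i) * s u (Suc i))"
          using sums_unique[OF sums_ereal[THEN iffD2, OF summable_sums[OF sums_summable[OF lin']]]] by simp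
        moreover have "(- 2 :: ereal) = ereal (- 2)" by simp
        ultimately show ?thesis unfolding D_fun_def by (simp only: plus_ereal.simps)
      qed
      moreover have "c u + d u = (\<Sum>i. toll_limit u i \<omega>)"
      proof -
        have "(\<Sum>i. toll_limit u i \<omega>) / m = (\<Sum>i. real i * s u (Suc i) + s u (Suc i) * ln (s u (Suc i)))"
          using suminf_divide[OF tl, of m] by (simp add: toll)
        also have "\<dots> = (\<Sum>i. real i * s u (Suc i)) + (\<Sum>i. s u (Suc i) * ln (s u (Suc i)))"
          by (rule suminf_add[OF lin entropy, symmetric])
        also have "(\<Sum>i. real i * s u (Suc i)) = (\<Sum>i. real (Suc i) * s u (Suc i)) - 1"
          using sums_unique[OF lin'] by simp
        finally show ?thesis using m by (simp add: c_def d_def m_def[symmetric] field_simps)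
      qed
      ultimately show ?thesis using False by (simp add: c_def d_def)
    qed
    have "partial_sum C_fun (Xinf \<omega>) k = ereal (\<Sum>u\<in>level k. c u)"
      using each unfolding partial_sum_def level_def[symmetric] mass_def[symmetric] s_def[symmetric]
      by (simp add: sum_ereal[symmetric] del: sum_ereal)
    moreover have "partial_sum D_fun (Xinf \<omega>) k = ereal (\<Sum>u\<in>level k. d u)"
      using each unfolding partial_sum_def level_def[symmetric] mass_def[symmetric] s_def[symmetric]
      by (simp add: sum_ereal[symmetric] del: sum_ereal)
    moreover have "(\<Sum>u\<in>level k. c u) + (\<Sum>u\<in>level k. d u) = toll_sum k \<omega>"
      using each by (simp add: toll_sum_def flip: sum.distrib)
    ultimately show ?case by blast
  qed
qed

end


section \<open>Convergence of the normalized path length\<close>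

lemma abs_le_moment:
  fixes y t :: real
  assumes "t > 0" "m \<ge> 1"
  shows "\<bar>y\<bar> \<le> t + y ^ (2 * m) / t ^ (2 * m - 1)"
proof (cases "\<bar>y\<bar> \<le> t")
  case True
  have "y ^ (2 * m) / t ^ (2 * m - 1) \<ge> 0" using assms by simp
  then show ?thesis using True by linarith
next
  case False
  have "\<bar>y\<bar> * t ^ (2 * m - 1) \<le> \<bar>y\<bar> * \<bar>y\<bar> ^ (2 * m - 1)"
    using False assms by (intro mult_left_mono power_mono) auto
  also have "\<dots> = y ^ (2 * m)"
    using assms by (simp add: power_even_abs flip: power_Suc)
  finally have "\<bar>y\<bar> \<le> y ^ (2 * m) / t ^ (2 * m - 1)" using assms by (simp add: pos_le_divide_eq)
  then show ?thesis using assms by linarith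
qed

lemma powr_le_moment:
  fixes y t p :: real
  assumes "t > 0" "p > 0" "p \<le> real (2 * m)"
  shows "\<bar>y\<bar> powr p \<le> t powr p + t powr (p - real (2 * m)) * y ^ (2 * m)"
proof (cases "\<bar>y\<bar> \<le> t")
  case True
  then have "\<bar>y\<bar> powr p \<le> t powr p" using assms by (intro powr_mono2) auto
  then show ?thesis by (simp add: add_increasing2)
next
  case False
  then have y: "\<bar>y\<bar> > 0" using assms by linarith
  have "\<bar>y\<bar> powr p = \<bar>y\<bar> powr (p - real (2 * m)) * \<bar>y\<bar> powr real (2 * m)"
    by (simp flip: powr_add)
  also have "\<bar>y\<bar> powr real (2 * m) = \<bar>y\<bar> ^ (2 * m)" using y by (rule powr_realpow)
  also have "\<dots> = y ^ (2 * m)" by (simp add: power_even_abs)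
  also have "\<bar>y\<bar> powr (p - real (2 * m)) * y ^ (2 * m) \<le> t powr (p - real (2 * m)) * y ^ (2 * m)"
    using False assms by (intro mult_right_mono powr_mono2') auto
  finally show ?thesis by (simp add: add_increasing)
qed

lemma (in prob_space) expectation_abs_le_moment:
  fixes f :: "'a \<Rightarrow> real"
  assumes "integrable M f" "integrable M (\<lambda>\<omega>. f \<omega> ^ (2 * m))" "t > 0" "m \<ge> 1"
  shows "expectation (\<lambda>\<omega>. \<bar>f \<omega>\<bar>) \<le> t + expectation (\<lambda>\<omega>. f \<omega> ^ (2 * m)) / t ^ (2 * m - 1)"
proof -
  have "expectation (\<lambda>\<omega>. \<bar>f \<omega>\<bar>) \<le> expectation (\<lambda>\<omega>. t + f \<omega> ^ (2 * m) / t ^ (2 * m - 1))"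
    using assms by (intro integral_mono abs_le_moment) auto
  also have "\<dots> = t + expectation (\<lambda>\<omega>. f \<omega> ^ (2 * m)) / t ^ (2 * m - 1)"
    using assms(2) by (simp add: prob_space)
  finally show ?thesis .
qed

lemma (in prob_space) L2_imp_L1:
  fixes f :: "nat \<Rightarrow> 'a \<Rightarrow> real"
  assumes "\<And>n. integrable M (f n)" "\<And>n. integrable M (\<lambda>\<omega>. f n \<omega> ^ 2)"
    and lim: "(\<lambda>n. expectation (\<lambda>\<omega>. f n \<omega> ^ 2)) \<longlonglongrightarrow> 0"
  shows "(\<lambda>n. expectation (\<lambda>\<omega>. \<bar>f n \<omega>\<bar>)) \<longlonglongrightarrow> 0"
proof (rule LIMSEQ_I)
  fix e :: real assume e: "e > 0"
  then have "eventually (\<lambda>n. expectation (\<lambda>\<omega>. f n \<omega> ^ 2) < e / 2 * (e / 2)) sequentially"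
    using order_tendstoD(2)[OF lim, of "e / 2 * (e / 2)"] by simp
  then have "eventually (\<lambda>n. norm (expectation (\<lambda>\<omega>. \<bar>f n \<omega>\<bar>) - 0) < e) sequentially"
  proof eventually_elim
    case (elim n)
    have "expectation (\<lambda>\<omega>. f n \<omega> ^ 2) / (e / 2) < e / 2" using elim e by (simp add: divide_less_eq)
    moreover have "expectation (\<lambda>\<omega>. \<bar>f n \<omega>\<bar>) \<le> e / 2 + expectation (\<lambda>\<omega>. f n \<omega> ^ 2) / (e / 2)"
      using expectation_abs_le_moment[of "f n" 1 "e / 2"] assms(1,2) e by simp
    moreover have "expectation (\<lambda>\<omega>. \<bar>f n \<omega>\<bar>) \<ge> 0" by (intro integral_nonneg_AE) auto
    ultimately show ?case by simp
  qed
  then show "\<exists>N. \<forall>n\<ge>N. norm (expectation (\<lambda>\<omega>. \<bar>f n \<omega>\<bar>) - 0) < e"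
    by (simp add: eventually_sequentially)
qed

lemma (in prob_space) in_Lp_integrable:
  fixes Y :: "'a \<Rightarrow> real"
  assumes "in_Lp M 2 (\<lambda>\<omega>. ereal (Y \<omega>))"
  shows "Y \<in> borel_measurable M" "integrable M Y" "integrable M (\<lambda>\<omega>. Y \<omega> ^ 2)"
proof -
  have "(\<lambda>\<omega>. real_of_ereal (ereal (Y \<omega>))) \<in> borel_measurable M"
    using assms unfolding in_Lp_def by (intro borel_measurable_real_of_ereal) auto
  then show m: "Y \<in> borel_measurable M" by simp
  have "\<bar>y\<bar> powr 2 = y ^ 2" for y :: real by (cases "y = 0") (auto simp: powr_numeral)
  then show sq: "integrable M (\<lambda>\<omega>. Y \<omega> ^ 2)" using assms by (simp add: in_Lp_def)
  have "integrable M (\<lambda>\<omega>. 1 + Y \<omega> ^ 2)" using sq by simp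
  then show "integrable M Y"
  proof (rule Bochner_Integration.integrable_bound[OF _ m], intro AE_I2)
    fix \<omega>
    show "norm (Y \<omega>) \<le> norm (1 + (Y \<omega>)\<^sup>2)" using abs_le_moment[of 1 1 "Y \<omega>"] by simp
  qed
qed

context harris_limit_process
begin

lemma martingale_integrable: "n \<ge> 1 \<Longrightarrow> integrable M (martingale k n)"
  unfolding martingale_def by (rule integrable_of_tree)

lemma martingale_pow_integrable:
  "a \<ge> 1 \<Longrightarrow> n \<ge> 1 \<Longrightarrow> integrable M (\<lambda>\<omega>. (martingale k n \<omega> - martingale k a \<omega>) ^ j)"
  unfolding martingale_def by (rule expectation_pair(1)[of a n "\<lambda>s x. (frontier_HPL k x / real n - frontier_HPL k s / real a) ^ j"])

lemma martingale_start: "k \<ge> 1 \<Longrightarrow> AE \<omega> in M. martingale k k \<omega> = 0"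
  using AE_grown[of k] by (rule AE_mp) (auto simp: martingale_def frontier_HPL_small)

lemma martingale_first: "AE \<omega> in M. martingale 0 1 \<omega> = 0"
  using AE_start by eventually_elim (simp add: martingale_def frontier_HPL_0 grown.root HPL_def mean_HPL_def harm_expand)

text \<open>The martingale of level \<open>k + 1\<close> vanishes at time \<open>k + 1\<close>, and from there on it moves by an
amount that is small uniformly in time.\<close>

lemma martingale_tail_L1:
  assumes "e > 0"
  shows "\<exists>k0. \<forall>k\<ge>k0. \<forall>n\<ge>Suc k. expectation (\<lambda>\<omega>. \<bar>martingale (Suc k) n \<omega>\<bar>) \<le> e"
proof -
  obtain K where K: "K \<ge> 0" "\<And>k a n. 1 \<le> a \<Longrightarrow> a \<le> n \<Longrightarrow>
      expectation (\<lambda>\<omega>. (martingale k n \<omega> - martingale k a \<omega>) ^ (4 * 2)) \<le> K / real a ^ 2"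
    using martingale_moment[of 2] by auto
  define t where "t = e / 2"
  have t: "t > 0" using assms by (simp add: t_def)
  have "(\<lambda>k. 1 / real (Suc k) ^ 2) \<longlonglongrightarrow> 0" by real_asymp
  from tendsto_mult_right_zero[OF this, of "K / t ^ 7"]
  have "(\<lambda>k. K / real (Suc k) ^ 2 / t ^ 7) \<longlonglongrightarrow> 0" by (simp add: mult.commute)
  then have "eventually (\<lambda>k. K / real (Suc k) ^ 2 / t ^ 7 < t) sequentially"
    using t by (rule order_tendstoD(2))
  then obtain k0 where k0: "\<And>k. k \<ge> k0 \<Longrightarrow> K / real (Suc k) ^ 2 / t ^ 7 < t"
    by (auto simp: eventually_sequentially)
  have "expectation (\<lambda>\<omega>. \<bar>martingale (Suc k) n \<omega>\<bar>) \<le> e" if k: "k \<ge> k0" and n: "n \<ge> Suc k" for k n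
  proof -
    let ?f = "\<lambda>\<omega>. martingale (Suc k) n \<omega> - martingale (Suc k) (Suc k) \<omega>"
    have n1: "n \<ge> 1" using n by simp
    have "expectation (\<lambda>\<omega>. \<bar>martingale (Suc k) n \<omega>\<bar>) = expectation (\<lambda>\<omega>. \<bar>?f \<omega>\<bar>)"
      using martingale_start[of "Suc k"] martingale_integrable[OF n1, of "Suc k"] martingale_integrable[of "Suc k" "Suc k"]
      by (intro integral_cong_AE) auto
    also have "\<dots> \<le> t + expectation (\<lambda>\<omega>. ?f \<omega> ^ (2 * 4)) / t ^ (2 * 4 - 1)"
      using martingale_pow_integrable[of "Suc k" n "Suc k" 1] martingale_pow_integrable[of "Suc k" n "Suc k" 8] n1 t
      by (intro expectation_abs_le_moment) auto
    also have "\<dots> \<le> t + K / real (Suc k) ^ 2 / t ^ 7"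
      using divide_right_mono[OF K(2)[of "Suc k" n "Suc k"], of "t ^ 7"] n t by simp
    also have "\<dots> \<le> t + t" using k0[OF k] by simp
    also have "\<dots> = e" by (simp add: t_def)
    finally show ?thesis .
  qed
  then show ?thesis by blast
qed

definition HPL_norm :: "nat \<Rightarrow> 'a \<Rightarrow> real" where
  "HPL_norm n \<omega> = HPL (X n \<omega>) / real n - harm n + 2"

lemma HPL_norm_martingale: "regular \<omega> \<Longrightarrow> n \<ge> 1 \<Longrightarrow> HPL_norm n \<omega> = martingale 0 n \<omega> + 1 / real n"
  by (simp add: regular_def HPL_norm_def martingale_def frontier_HPL_0 mean_HPL_def field_simps)

text \<open>Here \<open>V\<close> stands for $Y_\infty + Z_\infty$; all that matters is that the partial sums of the
limit tolls converge to it in the mean.\<close>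

context
  fixes V :: "'a \<Rightarrow> real"
  assumes V: "integrable M V"
    and toll_sum_V: "(\<lambda>k. expectation (\<lambda>\<omega>. \<bar>toll_sum k \<omega> - V \<omega>\<bar>)) \<longlonglongrightarrow> 0"
begin

text \<open>Three sources of error: the martingale of the frontier at level \<open>k + 1\<close>, the convergence of the
tolls up to level \<open>k\<close>, and the tail of the limit series. The first and the last one are small
for a suitable \<open>k\<close>, the second one for this \<open>k\<close> and large \<open>n\<close>.\<close>

lemma root_martingale_L1: "(\<lambda>n. expectation (\<lambda>\<omega>. \<bar>martingale 0 (Suc n) \<omega> - V \<omega>\<bar>)) \<longlonglongrightarrow> 0"
proof (rule LIMSEQ_I)
  let ?d = "\<lambda>n \<omega>. \<bar>martingale 0 (Suc n) \<omega> - V \<omega>\<bar>"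
  fix e :: real assume e: "e > 0"
  obtain k0 where k0: "\<And>k n. k \<ge> k0 \<Longrightarrow> n \<ge> Suc k \<Longrightarrow> expectation (\<lambda>\<omega>. \<bar>martingale (Suc k) n \<omega>\<bar>) \<le> e / 4"
    using martingale_tail_L1[of "e / 4"] e by auto
  have "eventually (\<lambda>k. expectation (\<lambda>\<omega>. \<bar>toll_sum k \<omega> - V \<omega>\<bar>) < e / 4) sequentially"
    using order_tendstoD(2)[OF toll_sum_V, of "e / 4"] e by simp
  with eventually_ge_at_top[of k0]
  have "eventually (\<lambda>k. k \<ge> k0 \<and> expectation (\<lambda>\<omega>. \<bar>toll_sum k \<omega> - V \<omega>\<bar>) < e / 4) sequentially"
    by eventually_elim simp
  then obtain k where k: "k \<ge> k0" "expectation (\<lambda>\<omega>. \<bar>toll_sum k \<omega> - V \<omega>\<bar>) < e / 4"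
    using eventually_happens'[OF sequentially_bot] by blast
  have "eventually (\<lambda>n. expectation (\<lambda>\<omega>. \<bar>martingale 0 (Suc n) \<omega> - martingale (Suc k) (Suc n) \<omega> - toll_sum k \<omega>\<bar>) < e / 4) sequentially"
    using order_tendstoD(2)[OF frontier_HPL_toll_L1[of k], of "e / 4"] e by simp
  then have "eventually (\<lambda>n. norm (expectation (\<lambda>\<omega>. ?d n \<omega>) - 0) < e) sequentially"
    using eventually_ge_at_top[of k]
  proof eventually_elim
    case (elim n)
    let ?a = "\<lambda>\<omega>. \<bar>martingale 0 (Suc n) \<omega> - martingale (Suc k) (Suc n) \<omega> - toll_sum k \<omega>\<bar>"
    let ?b = "\<lambda>\<omega>. \<bar>martingale (Suc k) (Suc n) \<omega>\<bar>" and ?c = "\<lambda>\<omega>. \<bar>toll_sum k \<omega> - V \<omega>\<bar>"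
    have int: "integrable M ?a" "integrable M ?b" "integrable M ?c"
      using martingale_integrable[of "Suc n"] integrable_toll_sum V by auto
    have "expectation (\<lambda>\<omega>. ?d n \<omega>) \<le> expectation (\<lambda>\<omega>. ?a \<omega> + ?b \<omega> + ?c \<omega>)"
      using int martingale_integrable[of "Suc n"] V by (intro integral_mono) auto
    also have "\<dots> = expectation ?a + expectation ?b + expectation ?c" using int by simp
    also have "\<dots> < e" using elim(1) k0[OF k(1), of "Suc n"] elim(2) k(2) e by simp
    finally have "expectation (\<lambda>\<omega>. ?d n \<omega>) < e" .
    moreover have "expectation (\<lambda>\<omega>. ?d n \<omega>) \<ge> 0" by (intro integral_nonneg_AE) auto
    ultimately show ?case by simp
  qed
  then show "\<exists>N. \<forall>n\<ge>N. norm (expectation (\<lambda>\<omega>. ?d n \<omega>) - 0) < e"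
    by (simp add: eventually_sequentially)
qed

text \<open>Along a subsequence the martingale converges to \<open>V\<close> almost surely, so Fatou's lemma carries its
rate over to the limit.\<close>

proposition root_martingale_moment:
  assumes q: "q \<ge> 2"
  obtains K where "\<And>a. a \<ge> 1 \<Longrightarrow> integrable M (\<lambda>\<omega>. (V \<omega> - martingale 0 a \<omega>) ^ (4 * q))"
    "\<And>a. a \<ge> 1 \<Longrightarrow> expectation (\<lambda>\<omega>. (V \<omega> - martingale 0 a \<omega>) ^ (4 * q)) \<le> K / real a ^ q"
proof -
  obtain K where K: "K \<ge> 0" "\<And>k a n. 1 \<le> a \<Longrightarrow> a \<le> n \<Longrightarrow>
      expectation (\<lambda>\<omega>. (martingale k n \<omega> - martingale k a \<omega>) ^ (4 * q)) \<le> K / real a ^ q"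
    using martingale_moment[OF q] by blast
  have "\<exists>r. strict_mono r \<and> (AE \<omega> in M. (\<lambda>n. martingale 0 (Suc (r n)) \<omega> - V \<omega>) \<longlonglongrightarrow> 0)"
    using tendsto_L1_AE_subseq[of M "\<lambda>n \<omega>. martingale 0 (Suc n) \<omega> - V \<omega>"] martingale_integrable V root_martingale_L1 by simp
  then obtain r where r: "strict_mono r" "AE \<omega> in M. (\<lambda>n. martingale 0 (Suc (r n)) \<omega> - V \<omega>) \<longlonglongrightarrow> 0"
    by blast
  have main: "integrable M (\<lambda>\<omega>. (V \<omega> - martingale 0 a \<omega>) ^ (4 * q)) \<and>
      expectation (\<lambda>\<omega>. (V \<omega> - martingale 0 a \<omega>) ^ (4 * q)) \<le> K / real a ^ q" if a: "a \<ge> 1" for a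
  proof -
    let ?f = "\<lambda>n \<omega>. (martingale 0 (Suc (r n)) \<omega> - martingale 0 a \<omega>) ^ (4 * q)"
    let ?g = "\<lambda>\<omega>. (V \<omega> - martingale 0 a \<omega>) ^ (4 * q)"
    have even: "y ^ (4 * q) \<ge> 0" for y :: real by (simp add: zero_le_even_power)
    have fint: "integrable M (?f n)" for n using martingale_pow_integrable a by simp
    have gm: "?g \<in> borel_measurable M" using V martingale_integrable[OF a, of 0] by auto
    have lim: "AE \<omega> in M. (\<lambda>n. ?f n \<omega>) \<longlonglongrightarrow> ?g \<omega>"
      using r(2)
    proof eventually_elim
      case (elim \<omega>)
      then have "(\<lambda>n. martingale 0 (Suc (r n)) \<omega>) \<longlonglongrightarrow> V \<omega>" by (simp add: LIM_zero_iff)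
      then show ?case by (intro tendsto_intros)
    qed
    have "(\<integral>\<^sup>+\<omega>. ennreal (?g \<omega>) \<partial>M) = (\<integral>\<^sup>+\<omega>. liminf (\<lambda>n. ennreal (?f n \<omega>)) \<partial>M)"
    proof (rule nn_integral_cong_AE)
      show "AE \<omega> in M. ennreal (?g \<omega>) = liminf (\<lambda>n. ennreal (?f n \<omega>))"
        using lim
      proof eventually_elim
        case (elim \<omega>)
        have "(\<lambda>n. ennreal (?f n \<omega>)) \<longlonglongrightarrow> ennreal (?g \<omega>)"
          using elim by (rule tendsto_ennrealI)
        then show ?case by (simp add: lim_imp_Liminf)
      qed
    qed
    also have "\<dots> \<le> liminf (\<lambda>n. \<integral>\<^sup>+\<omega>. ennreal (?f n \<omega>) \<partial>M)"
      using fint by (intro nn_integral_liminf) auto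
    also have "\<dots> \<le> ennreal (K / real a ^ q)"
    proof (rule Liminf_le)
      show "\<forall>\<^sub>F n in sequentially. (\<integral>\<^sup>+\<omega>. ennreal (?f n \<omega>) \<partial>M) \<le> ennreal (K / real a ^ q)"
        using eventually_ge_at_top[of a]
      proof eventually_elim
        case (elim n)
        then have "a \<le> Suc (r n)" using seq_suble[OF r(1), of n] by simp
        then have "expectation (?f n) \<le> K / real a ^ q" using K(2)[OF a] by blast
        moreover have "(\<integral>\<^sup>+\<omega>. ennreal (?f n \<omega>) \<partial>M) = ennreal (expectation (?f n))"
          using fint even by (intro nn_integral_eq_integral) auto
        ultimately show ?case using ennreal_leI by simp
      qed
    qed simp
    finally have le: "(\<integral>\<^sup>+\<omega>. ennreal (?g \<omega>) \<partial>M) \<le> ennreal (K / real a ^ q)" .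
    have gi: "integrable M ?g"
    proof (rule integrableI_bounded[OF gm])
      show "(\<integral>\<^sup>+\<omega>. ennreal (norm (?g \<omega>)) \<partial>M) < \<infinity>"
        using le even by (simp add: order.strict_trans1 abs_of_nonneg)
    qed
    have "ennreal (expectation ?g) \<le> ennreal (K / real a ^ q)"
      using le nn_integral_eq_integral[OF gi] even by simp
    then show ?thesis using gi K(1) by (simp add: ennreal_le_iff)
  qed
  show ?thesis using that[of K] main by blast
qed

text \<open>The eighth moments of the distances to the limit are of order \<open>1 / n ^ 2\<close>. They are summable,
which replaces a maximal inequality.\<close>

lemma root_martingale_AE: "AE \<omega> in M. (\<lambda>n. martingale 0 n \<omega>) \<longlonglongrightarrow> V \<omega>"
proof -
  obtain K where int: "\<And>a. a \<ge> 1 \<Longrightarrow> integrable M (\<lambda>\<omega>. (V \<omega> - martingale 0 a \<omega>) ^ (4 * 2))"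
    and K: "\<And>a. a \<ge> 1 \<Longrightarrow> expectation (\<lambda>\<omega>. (V \<omega> - martingale 0 a \<omega>) ^ (4 * 2)) \<le> K / real a ^ 2"
    using root_martingale_moment[of 2] by auto
  have "summable (\<lambda>n. K * (1 / real (Suc n) ^ 2))"
    using inverse_power_summable[of 2, where 'a=real] summable_Suc_iff[of "\<lambda>n. inverse (real n ^ 2)"]
    by (intro summable_mult) (simp add: divide_inverse)
  moreover have "expectation (\<lambda>\<omega>. \<bar>(V \<omega> - martingale 0 (Suc n) \<omega>) ^ 8\<bar>) \<le> K * (1 / real (Suc n) ^ 2)" for n
    using K[of "Suc n"] by (simp add: power_even_abs abs_of_nonneg)
  ultimately have "AE \<omega> in M. summable (\<lambda>n. \<bar>(V \<omega> - martingale 0 (Suc n) \<omega>) ^ 8\<bar>)"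
    using int by (intro AE_summable_norm[where c="\<lambda>n. K * (1 / real (Suc n) ^ 2)"]) auto
  then show ?thesis
  proof eventually_elim
    case (elim \<omega>)
    have "(\<lambda>n. \<bar>(V \<omega> - martingale 0 (Suc n) \<omega>) ^ 8\<bar>) \<longlonglongrightarrow> 0" by (rule summable_LIMSEQ_zero[OF elim])
    then have "(\<lambda>n. root 8 \<bar>(V \<omega> - martingale 0 (Suc n) \<omega>) ^ 8\<bar>) \<longlonglongrightarrow> root 8 0" by (rule tendsto_real_root)
    moreover have "root 8 \<bar>y ^ 8\<bar> = \<bar>y\<bar>" for y :: real
      unfolding power_abs by (rule real_root_power_cancel) auto
    ultimately have "(\<lambda>n. \<bar>V \<omega> - martingale 0 (Suc n) \<omega>\<bar>) \<longlonglongrightarrow> 0" by (simp only: real_root_zero)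
    then have "(\<lambda>n. V \<omega> - (V \<omega> - martingale 0 (Suc n) \<omega>)) \<longlonglongrightarrow> V \<omega> - 0"
      by (intro tendsto_diff tendsto_const) (simp add: tendsto_rabs_zero_iff)
    then show ?case by (simp add: filterlim_sequentially_Suc[of "\<lambda>n. martingale 0 n \<omega>"])
  qed
qed

lemma HPL_norm_AE: "AE \<omega> in M. (\<lambda>n. HPL_norm n \<omega>) \<longlonglongrightarrow> V \<omega>"
  using root_martingale_AE AE_regular
proof eventually_elim
  case (elim \<omega>)
  have "(\<lambda>n. martingale 0 n \<omega> + 1 / real n) \<longlonglongrightarrow> V \<omega> + 0"
    by (intro tendsto_add elim(1) lim_1_over_n)
  then have "(\<lambda>n. martingale 0 n \<omega> + 1 / real n) \<longlonglongrightarrow> V \<omega>" by simp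
  moreover have "eventually (\<lambda>n. martingale 0 n \<omega> + 1 / real n = HPL_norm n \<omega>) sequentially"
    using eventually_ge_at_top[of 1] by eventually_elim (simp add: HPL_norm_martingale[OF elim(2)])
  ultimately show ?case by (rule Lim_transform_eventually)
qed

lemma HPL_norm_moment:
  assumes q: "q \<ge> 2"
  shows "integrable M (\<lambda>\<omega>. V \<omega> ^ (4 * q))"
    and "\<And>n. n \<ge> 1 \<Longrightarrow> integrable M (\<lambda>\<omega>. (HPL_norm n \<omega> - V \<omega>) ^ (4 * q))"
    and "(\<lambda>n. expectation (\<lambda>\<omega>. (HPL_norm n \<omega> - V \<omega>) ^ (4 * q))) \<longlonglongrightarrow> 0"
proof -
  let ?d = "\<lambda>n \<omega>. (HPL_norm n \<omega> - V \<omega>) ^ (4 * q)"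
  obtain K where int: "\<And>a. a \<ge> 1 \<Longrightarrow> integrable M (\<lambda>\<omega>. (V \<omega> - martingale 0 a \<omega>) ^ (4 * q))"
    and K: "\<And>a. a \<ge> 1 \<Longrightarrow> expectation (\<lambda>\<omega>. (V \<omega> - martingale 0 a \<omega>) ^ (4 * q)) \<le> K / real a ^ q"
    using root_martingale_moment[OF q] by blast
  have Vm: "V \<in> borel_measurable M" using V by auto
  show "integrable M (\<lambda>\<omega>. V \<omega> ^ (4 * q))"
    using martingale_first Vm by (intro integrable_cong_AE_imp[OF int[of 1]]) auto
  have Tm: "HPL_norm n \<in> borel_measurable M" if "n \<ge> 1" for n
    unfolding HPL_norm_def by (rule measurable_of_tree[OF that]) auto
  have two: "(y + z) ^ (4 * q) \<le> 2 ^ (4 * q) * (y ^ (4 * q) + z ^ (4 * q))" for y z :: real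
    using even_power_add_le[of y z "2 * q"] by (simp add: power_mult)
  define b where "b = (\<lambda>n \<omega>. 2 ^ (4 * q) * ((V \<omega> - martingale 0 n \<omega>) ^ (4 * q) + (1 / real n) ^ (4 * q)))"
  have bint: "integrable M (b n)" if "n \<ge> 1" for n
    unfolding b_def using int[OF that] by simp
  have le: "AE \<omega> in M. ?d n \<omega> \<le> b n \<omega>" if n: "n \<ge> 1" for n
    using AE_regular
  proof eventually_elim
    case (elim \<omega>)
    have eq: "HPL_norm n \<omega> - V \<omega> = - ((V \<omega> - martingale 0 n \<omega>) + - (1 / real n))"
      by (simp add: HPL_norm_martingale[OF elim n])
    have minus: "(- y) ^ (4 * q) = y ^ (4 * q)" for y :: real by simp
    have "?d n \<omega> = ((V \<omega> - martingale 0 n \<omega>) + - (1 / real n)) ^ (4 * q)"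
      unfolding eq by (rule minus)
    also have "\<dots> \<le> 2 ^ (4 * q) * ((V \<omega> - martingale 0 n \<omega>) ^ (4 * q) + (- (1 / real n)) ^ (4 * q))" by (rule two)
    finally show ?case by (simp add: b_def)
  qed
  have even: "y ^ (4 * q) \<ge> 0" for y :: real by (simp add: zero_le_even_power)
  show Tint: "integrable M (\<lambda>\<omega>. ?d n \<omega>)" if n: "n \<ge> 1" for n
  proof (rule Bochner_Integration.integrable_bound[OF bint[OF n]])
    show "AE \<omega> in M. norm (?d n \<omega>) \<le> norm (b n \<omega>)"
      using le[OF n] by eventually_elim (use even in \<open>auto simp: abs_of_nonneg\<close>)
  qed (use Tm[OF n] Vm in auto)
  have E: "expectation (\<lambda>\<omega>. ?d n \<omega>) \<le>
      2 ^ (4 * q) * (K / real n ^ q + (1 / real n) ^ (4 * q))" if n: "n \<ge> 1" for n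
  proof -
    have "expectation (\<lambda>\<omega>. ?d n \<omega>) \<le> expectation (b n)"
      by (intro integral_mono_AE Tint[OF n] bint[OF n] le[OF n])
    also have "\<dots> = 2 ^ (4 * q) * (expectation (\<lambda>\<omega>. (V \<omega> - martingale 0 n \<omega>) ^ (4 * q)) + (1 / real n) ^ (4 * q))"
      unfolding b_def using int[OF n] by (simp add: prob_space)
    also have "\<dots> \<le> 2 ^ (4 * q) * (K / real n ^ q + (1 / real n) ^ (4 * q))"
      using K[OF n] by (intro mult_left_mono add_right_mono) auto
    finally show ?thesis .
  qed
  have inv: "(\<lambda>n. (1 / real n) ^ j) \<longlonglongrightarrow> 0" if "j \<ge> 1" for j :: nat
    using that lim_1_over_n[where 'a=real] by simp
  have "(\<lambda>n. 2 ^ (4 * q) * (K * (1 / real n) ^ q + (1 / real n) ^ (4 * q))) \<longlonglongrightarrow> 2 ^ (4 * q) * (K * 0 + 0)"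
    using q by (intro tendsto_intros inv) auto
  then have "(\<lambda>n. 2 ^ (4 * q) * (K / real n ^ q + (1 / real n) ^ (4 * q))) \<longlonglongrightarrow> 0"
    by (simp add: power_one_over)
  moreover have "eventually (\<lambda>n. norm (expectation (\<lambda>\<omega>. ?d n \<omega>)) \<le>
      2 ^ (4 * q) * (K / real n ^ q + (1 / real n) ^ (4 * q))) sequentially"
    using eventually_ge_at_top[of 1]
  proof eventually_elim
    case (elim n)
    have "expectation (\<lambda>\<omega>. ?d n \<omega>) \<ge> 0" using even by (intro integral_nonneg_AE) auto
    then show ?case using E[OF elim] by simp
  qed
  ultimately show "(\<lambda>n. expectation (\<lambda>\<omega>. ?d n \<omega>)) \<longlonglongrightarrow> 0"
    by (rule Lim_null_comparison[rotated])
qed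

text \<open>An even moment of order \<open>4 * q \<ge> p\<close> dominates the power \<open>p\<close> above any threshold.\<close>

proposition HPL_norm_Lp:
  assumes p: "p > 0"
  shows "tendsto_Lp M p (\<lambda>n \<omega>. ereal (HPL_norm n \<omega>)) (\<lambda>\<omega>. ereal (V \<omega>))"
proof -
  define q where "q = nat \<lceil>p\<rceil> + 2"
  have q: "q \<ge> 2" "p \<le> real (2 * (2 * q))" using p by (auto simp: q_def) linarith
  have exp4: "4 * q = 2 * (2 * q)" by simp
  note moment = HPL_norm_moment[OF q(1), unfolded exp4]
  have Vm: "V \<in> borel_measurable M" using V by auto
  have Tm: "HPL_norm n \<in> borel_measurable M" if "n \<ge> 1" for n
    unfolding HPL_norm_def by (rule measurable_of_tree[OF that]) auto
  have pint: "integrable M (\<lambda>\<omega>. \<bar>f \<omega>\<bar> powr p)"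
    if "integrable M (\<lambda>\<omega>. f \<omega> ^ (2 * (2 * q)))" "f \<in> borel_measurable M" for f :: "'a \<Rightarrow> real"
  proof (rule Bochner_Integration.integrable_bound)
    show "integrable M (\<lambda>\<omega>. 1 + f \<omega> ^ (2 * (2 * q)))" using that by simp
    show "AE \<omega> in M. norm (\<bar>f \<omega>\<bar> powr p) \<le> norm (1 + f \<omega> ^ (2 * (2 * q)))"
      using powr_le_moment[OF zero_less_one p q(2)]
      by (intro AE_I2) (simp add: order_trans[OF _ abs_ge_self])
    show "(\<lambda>\<omega>. \<bar>f \<omega>\<bar> powr p) \<in> borel_measurable M" using that(2) by simp
  qed
  have lim: "(\<lambda>n. expectation (\<lambda>\<omega>. \<bar>HPL_norm n \<omega> - V \<omega>\<bar> powr p)) \<longlonglongrightarrow> 0"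
  proof (rule LIMSEQ_I)
    fix e :: real assume e: "e > 0"
    \<comment> \<open>The threshold for which the part below it contributes \<open>e / 2\<close>.\<close>
    define t where "t = (e / 2) powr (1 / p)"
    have t: "t > 0" "t powr p = e / 2" using e p by (auto simp: t_def powr_powr)
    define C where "C = t powr (p - real (2 * (2 * q)))"
    have "(\<lambda>n. C * expectation (\<lambda>\<omega>. (HPL_norm n \<omega> - V \<omega>) ^ (2 * (2 * q)))) \<longlonglongrightarrow> C * 0"
      by (intro tendsto_mult tendsto_const moment(3))
    then have "eventually (\<lambda>n. C * expectation (\<lambda>\<omega>. (HPL_norm n \<omega> - V \<omega>) ^ (2 * (2 * q))) < e / 2) sequentially"
      using e by (intro order_tendstoD(2)[where y="C * 0"]) auto
    then have "eventually (\<lambda>n. norm (expectation (\<lambda>\<omega>. \<bar>HPL_norm n \<omega> - V \<omega>\<bar> powr p) - 0) < e) sequentially"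
      using eventually_ge_at_top[of 1]
    proof eventually_elim
      case (elim n)
      have "expectation (\<lambda>\<omega>. \<bar>HPL_norm n \<omega> - V \<omega>\<bar> powr p) \<le>
          expectation (\<lambda>\<omega>. t powr p + C * (HPL_norm n \<omega> - V \<omega>) ^ (2 * (2 * q)))"
        unfolding C_def using moment(2)[OF elim(2)] Tm[OF elim(2)] Vm
        by (intro integral_mono powr_le_moment t p q(2) pint) auto
      also have "\<dots> = e / 2 + C * expectation (\<lambda>\<omega>. (HPL_norm n \<omega> - V \<omega>) ^ (2 * (2 * q)))"
        using moment(2)[OF elim(2)] by (simp add: prob_space t)
      finally have "expectation (\<lambda>\<omega>. \<bar>HPL_norm n \<omega> - V \<omega>\<bar> powr p) < e" using elim(1) by simp
      moreover have "expectation (\<lambda>\<omega>. \<bar>HPL_norm n \<omega> - V \<omega>\<bar> powr p) \<ge> 0" by (intro integral_nonneg_AE) auto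
      ultimately show ?case by simp
    qed
    then show "\<exists>N. \<forall>n\<ge>N. norm (expectation (\<lambda>\<omega>. \<bar>HPL_norm n \<omega> - V \<omega>\<bar> powr p) - 0) < e"
      by (simp add: eventually_sequentially)
  qed
  have "in_Lp M p (\<lambda>\<omega>. ereal (HPL_norm n \<omega>))" if n: "n \<ge> 1" for n
  proof -
    have "integrable M (\<lambda>\<omega>. \<bar>HPL_norm n \<omega>\<bar> powr p)"
      unfolding HPL_norm_def by (rule integrable_of_tree[OF n])
    then show ?thesis using Tm[OF n] by (simp add: in_Lp_def)
  qed
  moreover have "in_Lp M p (\<lambda>\<omega>. ereal (V \<omega>))"
    using pint[OF moment(1) Vm] Vm by (simp add: in_Lp_def)
  ultimately show ?thesis using lim by (simp add: tendsto_Lp_def)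
qed

end

text \<open>An almost surely finite extended-real partial sum can be replaced by its real value, and
convergence in \<open>L\<^sup>2\<close> implies convergence in \<open>L\<^sup>1\<close>.\<close>

lemma partial_sum_L1:
  fixes Y :: "'a \<Rightarrow> real"
  assumes "tendsto_Lp M 2 (\<lambda>k \<omega>. partial_sum F (Xinf \<omega>) k) (\<lambda>\<omega>. ereal (Y \<omega>))"
    and fin: "\<And>k. AE \<omega> in M. \<exists>c. partial_sum F (Xinf \<omega>) k = ereal c"
  shows "integrable M Y"
    and "\<And>k. integrable M (\<lambda>\<omega>. real_of_ereal (partial_sum F (Xinf \<omega>) (Suc k)))"
    and "(\<lambda>k. expectation (\<lambda>\<omega>. \<bar>real_of_ereal (partial_sum F (Xinf \<omega>) (Suc k)) - Y \<omega>\<bar>)) \<longlonglongrightarrow> 0"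
proof -
  let ?s = "\<lambda>k \<omega>. real_of_ereal (partial_sum F (Xinf \<omega>) (Suc k))"
  let ?e = "\<lambda>k \<omega>. \<bar>real_of_ereal (partial_sum F (Xinf \<omega>) (Suc k) - ereal (Y \<omega>))\<bar> powr 2"
  note L = assms(1)[unfolded tendsto_Lp_def]
  have two: "\<bar>y\<bar> powr 2 = y ^ 2" for y :: real by (cases "y = 0") (auto simp: powr_numeral)
  have Y: "Y \<in> borel_measurable M" "integrable M Y" "integrable M (\<lambda>\<omega>. Y \<omega> ^ 2)"
    using in_Lp_integrable[of Y] L by auto
  show "integrable M Y" by (rule Y(2))
  have s: "?s k \<in> borel_measurable M" "integrable M (?s k)" "integrable M (\<lambda>\<omega>. ?s k \<omega> ^ 2)" for k
  proof -
    have P: "in_Lp M 2 (\<lambda>\<omega>. partial_sum F (Xinf \<omega>) (Suc k))" using L by simp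
    then have m: "?s k \<in> borel_measurable M" unfolding in_Lp_def by (intro borel_measurable_real_of_ereal) auto
    have "in_Lp M 2 (\<lambda>\<omega>. ereal (?s k \<omega>))"
      using P m by (simp add: in_Lp_def)
    from in_Lp_integrable[OF this] show "?s k \<in> borel_measurable M" "integrable M (?s k)" "integrable M (\<lambda>\<omega>. ?s k \<omega> ^ 2)" .
  qed
  show "integrable M (?s k)" for k by (rule s(2))
  have d: "integrable M (\<lambda>\<omega>. (?s k \<omega> - Y \<omega>) ^ 2)" for k
  proof (rule Bochner_Integration.integrable_bound)
    show "integrable M (\<lambda>\<omega>. 2 * ?s k \<omega> ^ 2 + 2 * Y \<omega> ^ 2)" using s(3)[of k] Y(3) by simp
    show "(\<lambda>\<omega>. (?s k \<omega> - Y \<omega>) ^ 2) \<in> borel_measurable M" using s(1)[of k] Y(1) by simp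
    show "AE \<omega> in M. norm ((?s k \<omega> - Y \<omega>)\<^sup>2) \<le> norm (2 * ?s k \<omega> ^ 2 + 2 * Y \<omega> ^ 2)"
    proof (intro AE_I2)
      fix \<omega>
      have "0 \<le> (?s k \<omega> + Y \<omega>)\<^sup>2" by simp
      then have "(?s k \<omega> - Y \<omega>)\<^sup>2 \<le> 2 * ?s k \<omega> ^ 2 + 2 * Y \<omega> ^ 2"
        by (simp add: power2_sum power2_diff)
      then show "norm ((?s k \<omega> - Y \<omega>)\<^sup>2) \<le> norm (2 * ?s k \<omega> ^ 2 + 2 * Y \<omega> ^ 2)"
        by simp
    qed
  qed
  have "(\<lambda>k. \<integral>\<omega>. ?e k \<omega> \<partial>M) \<longlonglongrightarrow> 0"
    using L by (intro LIMSEQ_Suc) auto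
  moreover have "(\<integral>\<omega>. ?e k \<omega> \<partial>M) =
      expectation (\<lambda>\<omega>. (?s k \<omega> - Y \<omega>) ^ 2)" for k
  proof (rule integral_cong_AE)
    show "AE \<omega> in M. ?e k \<omega> = (?s k \<omega> - Y \<omega>) ^ 2"
      using fin[of "Suc k"] by eventually_elim (auto simp: two)
    have "(\<lambda>\<omega>. partial_sum F (Xinf \<omega>) (Suc k)) \<in> borel_measurable M" using L by (simp add: in_Lp_def)
    then show "(\<lambda>\<omega>. ?e k \<omega>) \<in> borel_measurable M"
      using Y(1) by measurable
  qed (use d[of k] in auto)
  ultimately have "(\<lambda>k. expectation (\<lambda>\<omega>. (?s k \<omega> - Y \<omega>) ^ 2)) \<longlonglongrightarrow> 0" by simp
  then show "(\<lambda>k. expectation (\<lambda>\<omega>. \<bar>?s k \<omega> - Y \<omega>\<bar>)) \<longlonglongrightarrow> 0"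
    using s(2) Y(2) d by (intro L2_imp_L1) auto
qed

lemma toll_sum_L1:
  fixes Y Z :: "'a \<Rightarrow> real"
  assumes C: "tendsto_Lp M 2 (\<lambda>k \<omega>. partial_sum C_fun (Xinf \<omega>) k) (\<lambda>\<omega>. ereal (Y \<omega>))"
    and D: "tendsto_Lp M 2 (\<lambda>k \<omega>. partial_sum D_fun (Xinf \<omega>) k) (\<lambda>\<omega>. ereal (Z \<omega>))"
  shows "integrable M (\<lambda>\<omega>. Y \<omega> + Z \<omega>)"
    and "(\<lambda>k. expectation (\<lambda>\<omega>. \<bar>toll_sum k \<omega> - (Y \<omega> + Z \<omega>)\<bar>)) \<longlonglongrightarrow> 0"
proof -
  let ?c = "\<lambda>k \<omega>. real_of_ereal (partial_sum C_fun (Xinf \<omega>) (Suc k))"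
  let ?d = "\<lambda>k \<omega>. real_of_ereal (partial_sum D_fun (Xinf \<omega>) (Suc k))"
  let ?cY = "\<lambda>k \<omega>. \<bar>?c k \<omega> - Y \<omega>\<bar>" and ?dZ = "\<lambda>k \<omega>. \<bar>?d k \<omega> - Z \<omega>\<bar>"
  let ?s = "\<lambda>k \<omega>. \<bar>toll_sum (Suc k) \<omega> - (Y \<omega> + Z \<omega>)\<bar>"
  have "AE \<omega> in M. \<exists>c. partial_sum C_fun (Xinf \<omega>) k = ereal c" for k
    using AE_partial_sum[of k] by eventually_elim blast
  note C' = partial_sum_L1[OF C this]
  have "AE \<omega> in M. \<exists>c. partial_sum D_fun (Xinf \<omega>) k = ereal c" for k
    using AE_partial_sum[of k] by eventually_elim blast
  note D' = partial_sum_L1[OF D this]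
  show int: "integrable M (\<lambda>\<omega>. Y \<omega> + Z \<omega>)" using C'(1) D'(1) by simp
  have "(\<lambda>k. expectation (\<lambda>\<omega>. ?s k \<omega>)) \<longlonglongrightarrow> 0"
  proof (rule Lim_null_comparison[OF always_eventually])
    show "(\<lambda>k. expectation (\<lambda>\<omega>. ?cY k \<omega>) + expectation (\<lambda>\<omega>. ?dZ k \<omega>)) \<longlonglongrightarrow> 0"
      using tendsto_add[OF C'(3) D'(3)] by simp
    show "\<forall>k. norm (expectation (\<lambda>\<omega>. ?s k \<omega>)) \<le>
        expectation (\<lambda>\<omega>. ?cY k \<omega>) + expectation (\<lambda>\<omega>. ?dZ k \<omega>)"
    proof
      fix k
      have i: "integrable M (\<lambda>\<omega>. ?cY k \<omega>)" "integrable M (\<lambda>\<omega>. ?dZ k \<omega>)"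
        using C'(1,2) D'(1,2) by auto
      have "expectation (\<lambda>\<omega>. ?s k \<omega>) \<le>
          expectation (\<lambda>\<omega>. ?cY k \<omega> + ?dZ k \<omega>)"
      proof (rule integral_mono_AE)
        show "AE \<omega> in M. ?s k \<omega> \<le> ?cY k \<omega> + ?dZ k \<omega>"
          using AE_partial_sum[of "Suc k"]
        proof eventually_elim
          case (elim \<omega>)
          then have "toll_sum (Suc k) \<omega> = ?c k \<omega> + ?d k \<omega>" by auto
          then show ?case by linarith
        qed
      qed (use i int integrable_toll_sum in auto)
      also have "\<dots> = expectation (\<lambda>\<omega>. ?cY k \<omega>) + expectation (\<lambda>\<omega>. ?dZ k \<omega>)"
        using i by (rule Bochner_Integration.integral_add)
      finally show "norm (expectation (\<lambda>\<omega>. ?s k \<omega>)) \<le>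
        expectation (\<lambda>\<omega>. ?cY k \<omega>) + expectation (\<lambda>\<omega>. ?dZ k \<omega>)"
        by (simp add: integral_nonneg_AE)
    qed
  qed
  then show "(\<lambda>k. expectation (\<lambda>\<omega>. \<bar>toll_sum k \<omega> - (Y \<omega> + Z \<omega>)\<bar>)) \<longlonglongrightarrow> 0"
    by (rule filterlim_sequentially_Suc[THEN iffD1])
qed

end

theorem theorem11:
  fixes M :: "'a measure"
    and X :: "nat \<Rightarrow> 'a \<Rightarrow> nat list set"
    and Xinf :: "'a \<Rightarrow> ext_node measure"
    and Yinf Zinf :: "'a \<Rightarrow> real"
  assumes "prob_space M"
    and "harris_chain M X"
    and "harris_limit M X Xinf"
    and "\<And>p. p > 1 \<Longrightarrow>
           tendsto_Lp M p (\<lambda>k \<omega>. partial_sum C_fun (Xinf \<omega>) k) (\<lambda>\<omega>. ereal (Yinf \<omega>))"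
    and "\<And>p. p > 1 \<Longrightarrow>
           tendsto_Lp M p (\<lambda>k \<omega>. partial_sum D_fun (Xinf \<omega>) k) (\<lambda>\<omega>. ereal (Zinf \<omega>))"
  shows "(AE \<omega> in M. (\<lambda>n. HPL (X n \<omega>) / real n - harm n + 2) \<longlonglongrightarrow> Yinf \<omega> + Zinf \<omega>) \<and>
         (\<forall>p>0. tendsto_Lp M p (\<lambda>n \<omega>. ereal (HPL (X n \<omega>) / real n - harm n + 2))
                               (\<lambda>\<omega>. ereal (Yinf \<omega> + Zinf \<omega>)))"
proof -
  interpret prob_space M by fact
  interpret harris_limit_process M X Xinf
    by unfold_locales (use assms(2,3) in auto)
  note V = toll_sum_L1[OF assms(4)[of 2] assms(5)[of 2], simplified]
  show ?thesis
    using HPL_norm_AE[OF V] HPL_norm_Lp[OF V] unfolding HPL_norm_def by blast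
qed

end
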